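(* Let $E$ be a $W^*$-correspondence over a $W^*$-algebra $M$, let $\pi:M\to B(H)$ be a faithful normal representation, and let $\rho_0=\rho_\pi$ be the induced representation of $H^\infty(E)$ on $\mathcal{F}(E)\otimes_\pi H$. Let $Y\in\mathcal{L}(\mathcal{F}(E))$ with $Y\otimes I_H\in Alg\,Lat\,\rho_0(H^{\infty}(E))$. Then $$\Phi_0(Y)\otimes I_H\in\rho_0(H^{\infty}(E)).$$
   Context: A Hilbert $W^*$-module over a $W^*$-algebra $M$ is a self-dual right Hilbert $C^*$-module $E$ over $M$ (the $M$-valued inner product is linear in the second variable); $\mathcal{L}(E)$ is the $W^*$-algebra of adjointable operators on $E$. $E$ is a dual Banach space; its weak$^*$-topology is called the $\sigma$-topology. A $W^*$-correspondence over $M$ is a Hilbert $W^*$-module $E$ over $M$ with a left action given by a normal $*$-homomorphism $\phi:M\to\mathcal{L}(E)$; it is always assumed essential: $\phi(M)E$ is dense in $E$ in the $\sigma$-topology. $E^{\otimes 0}=M$ with $\phi_0(a)b=ab$; for $n\ge1$, $E^{\otimes n}$ is the self-dual completion of the internal tensor power balanced over $\phi$ (inner product $\langle\xi_1\otimes\eta_1,\xi_2\otimes\eta_2\rangle=\langle\eta_1,\phi(\langle\xi_1,\xi_2\rangle)\eta_2\rangle$), with left action $\phi_n(a)(\xi_1\otimes\dots\otimes\xi_n)=(\phi(a)\xi_1)\otimes\xi_2\otimes\dots\otimes\xi_n$. The full Fock space $\mathcal{F}(E)=\sum^{\oplus}_{n\ge0}E^{\otimes n}$ is the ultraweak direct sum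 (self-dual completion of the Hilbert module direct sum), with left action $\phi_\infty(a)=\sum_{n\ge 0}\phi_n(a)$. For $\xi\in E$, $T_\xi\in\mathcal{L}(\mathcal{F}(E))$ is $T_\xi\eta=\xi\otimes\eta$. The Hardy algebra $H^\infty(E)$ is the weak$^*$ (ultraweak) closure in $\mathcal{L}(\mathcal{F}(E))$ of the algebra generated by all $T_\xi$ ($\xi\in E$) and all $\phi_\infty(a)$ ($a\in M$). For a normal (nondegenerate) representation $\pi:M\to B(H)$ and a Hilbert $W^*$-module $F$ over $M$, $F\otimes_\pi H$ is the Hilbert space completion of the algebraic tensor product with $\langle\xi_1\otimes h_1,\xi_2\otimes h_2\rangle=\langle h_1,\pi(\langle\xi_1,\xi_2\rangle)h_2\rangle$. The induced representation is $\rho_\pi(X)=X\otimes I_H$, $X\in H^\infty(E)$. Zeroth Fourier coefficient: let $P_n\in\mathcal{L}(\mathcal{F}(E))$ be the projection onto $E^{\otimes n}$, $W_t=\sum_{n\ge0}e^{int}P_n$, $\gamma_t(T)=W_tTW_t^*$ ($t\in\mathbb{R}$). For $T\in\mathcal{L}(\mathcal{F}(E))$, $\Phi_0(T)=\frac1{2\pi}\int_0^{2\pi}\gamma_t(T)\,dt$ (weak$^*$-convergent integral); equivalently $\Phi_0(T)=\sum_kP_kTP_k$. For a subalgebra $\mathcal{A}\subseteq B(K)$, $Lat\,\mathcal{A}$ is the lattice of closed $\mathcal{A}$-invariant subspaces of $K$, and $Alg\,Lat\,\mathcal{A}=\{T\in B(K):T\mathcal{N}\subseteq\mathcal{N}\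 \forall \mathcal{N}\in Lat\,\mathcal{A}\}$. *)

theory Defs
  imports "HOL-Analysis.Analysis" "HOL-Library.Function_Algebras"
begin

section \<open>Complex vector spaces, Hilbert spaces and W*-algebras\<close>

class complex_vec = ab_group_add +
  fixes scaleC :: "complex \<Rightarrow> 'a \<Rightarrow> 'a"  (infixr \<open>*\<^sub>C\<close> 75)
  assumes scaleC_add_right: "c *\<^sub>C (x + y) = c *\<^sub>C x + c *\<^sub>C y"
    and scaleC_add_left: "(c + d) *\<^sub>C x = c *\<^sub>C x + d *\<^sub>C x"
    and scaleC_scaleC: "c *\<^sub>C (d *\<^sub>C x) = (c * d) *\<^sub>C x"
    and scaleC_one: "1 *\<^sub>C x = x"

global_interpretation complex_vec: vector_space "scaleC :: complex \<Rightarrow> 'a \<Rightarrow> 'a :: complex_vec"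
  defines csubspace = complex_vec.subspace
    and cspan = complex_vec.span
  by unfold_locales (simp_all add: scaleC_add_right scaleC_add_left scaleC_scaleC scaleC_one)

instantiation "fun" :: (type, complex_vec) complex_vec
begin
definition scaleC_fun :: "complex \<Rightarrow> ('a \<Rightarrow> 'b) \<Rightarrow> 'a \<Rightarrow> 'b" where
  "scaleC_fun c f = (\<lambda>x. c *\<^sub>C f x)"
instance
  by intro_classes
    (simp_all add: scaleC_fun_def fun_eq_iff scaleC_add_right scaleC_add_left scaleC_scaleC scaleC_one)
end

class complex_banach = complex_vec + banach +
  assumes scaleR_eq_scaleC: "r *\<^sub>R x = complex_of_real r *\<^sub>C x"
    and norm_scaleC: "norm (c *\<^sub>C x) = cmod c * norm x"

class chilbert_space = complex_banach +
  fixes cinner :: "'a \<Rightarrow> 'a \<Rightarrow> complex"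
  assumes cinner_add_right: "cinner x (y + z) = cinner x y + cinner x z"
    and cinner_scaleC_right: "cinner x (c *\<^sub>C y) = c * cinner x y"
    and cinner_commute: "cinner x y = cnj (cinner y x)"
    and cinner_self_nonneg: "0 \<le> Re (cinner x x)"
    and norm_eq_sqrt_cinner: "norm x = sqrt (Re (cinner x x))"

text \<open>Unital C*-algebras. The unit comes from \<^class>\<open>monoid_mult\<close>, which, unlike
  \<^class>\<open>real_normed_algebra_1\<close>, does not exclude the zero algebra.\<close>

class cstar_algebra = complex_banach + real_normed_algebra + monoid_mult +
  fixes star :: "'a \<Rightarrow> 'a"
  assumes scaleC_mult_left: "(c *\<^sub>C a) * b = c *\<^sub>C (a * b)"
    and scaleC_mult_right: "a * (c *\<^sub>C b) = c *\<^sub>C (a * b)"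
    and star_star: "star (star a) = a"
    and star_add: "star (a + b) = star a + star b"
    and star_scaleC: "star (c *\<^sub>C a) = cnj c *\<^sub>C star a"
    and star_mult: "star (a * b) = star b * star a"
    and cstar_identity: "norm (star a * a) = (norm a)\<^sup>2"

definition positive :: "'a :: cstar_algebra \<Rightarrow> bool" where
  "positive a \<longleftrightarrow> (\<exists>b. a = star b * b)"

definition (in complex_banach) bounded_clinear_functional :: "('a \<Rightarrow> complex) \<Rightarrow> bool" where
  "bounded_clinear_functional f \<longleftrightarrow>
     (\<forall>x y. f (x + y) = f x + f y) \<and> (\<forall>c x. f (c *\<^sub>C x) = c * f x) \<and>
     (\<exists>C. \<forall>x. cmod (f x) \<le> C * norm x)"

text \<open>\<open>P\<close> is a norm closed subspace of the Banach dual of \<open>'a\<close>, and the evaluation map from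
  \<open>'a\<close> into the Banach dual of \<open>P\<close> is isometric and onto. The operator norm is spelled out, as
  \<^const>\<open>onorm\<close> is not available inside a class.\<close>

definition (in complex_banach) is_predual :: "('a \<Rightarrow> complex) set \<Rightarrow> bool" where
  "is_predual P \<longleftrightarrow>
     (\<forall>f\<in>P. bounded_clinear_functional f) \<and>
     (\<lambda>x. 0) \<in> P \<and>
     (\<forall>f\<in>P. \<forall>g\<in>P. (\<lambda>x. f x + g x) \<in> P) \<and>
     (\<forall>c. \<forall>f\<in>P. (\<lambda>x. c * f x) \<in> P) \<and>
     (\<forall>f. bounded_clinear_functional f \<and>
          (\<forall>e>0. \<exists>g\<in>P. \<forall>x. cmod (f x - g x) \<le> e * norm x) \<longrightarrow> f \<in> P) \<and>
     (\<forall>a. norm a = (SUP f\<in>{f\<in>P. \<forall>x. cmod (f x) \<le> norm x}. cmod (f a))) \<and>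
     (\<forall>L C. (\<forall>f\<in>P. \<forall>g\<in>P. L (\<lambda>x. f x + g x) = L f + L g) \<and>
            (\<forall>c. \<forall>f\<in>P. L (\<lambda>x. c * f x) = c * L f) \<and>
            (\<forall>f\<in>P. \<forall>K\<ge>0. (\<forall>x. cmod (f x) \<le> K * norm x) \<longrightarrow> cmod (L f) \<le> C * K)
        \<longrightarrow> (\<exists>a. \<forall>f\<in>P. L f = f a))"

text \<open>W*-algebras in the sense of Sakai: C*-algebras which are dual Banach spaces. The predual,
  realised as the space of normal functionals, is unique, so that fixing it adds no structure.\<close>

class wstar_algebra = cstar_algebra +
  fixes predual :: "('a \<Rightarrow> complex) set"
  assumes is_predual_predual: "is_predual predual"

definition weakstar_lim :: "(nat \<Rightarrow> 'm :: wstar_algebra) \<Rightarrow> 'm" where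
  "weakstar_lim s = (THE c. \<forall>\<omega>\<in>predual. (\<lambda>N. \<omega> (s N)) \<longlonglongrightarrow> \<omega> c)"

definition initial_topology :: "'a set \<Rightarrow> ('a \<Rightarrow> complex) set \<Rightarrow> 'a topology" where
  "initial_topology A \<Phi> = topology_generated_by {{x\<in>A. f x \<in> U} | f U. f \<in> \<Phi> \<and> open U}"


section \<open>Hilbert W*-modules\<close>

text \<open>The vector space structure of a module is inherited from the ambient type, of which the
  carrier is a linear subspace. The algebra acts on the right.\<close>

record ('e, 'm) hmodule =
  carrier :: "'e set"
  ract :: "'e \<Rightarrow> 'm \<Rightarrow> 'e"
  ip :: "'e \<Rightarrow> 'e \<Rightarrow> 'm"

definition hnorm :: "('e, 'm :: wstar_algebra) hmodule \<Rightarrow> 'e \<Rightarrow> real" where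
  "hnorm E x = sqrt (norm (ip E x x))"

definition hilbert_module :: "('e :: complex_vec, 'm :: wstar_algebra) hmodule \<Rightarrow> bool" where
  "hilbert_module E \<longleftrightarrow>
     csubspace (carrier E) \<and>
     (\<forall>x\<in>carrier E. \<forall>a. ract E x a \<in> carrier E) \<and>
     (\<forall>x\<in>carrier E. \<forall>y\<in>carrier E. \<forall>a. ract E (x + y) a = ract E x a + ract E y a) \<and>
     (\<forall>x\<in>carrier E. \<forall>a b. ract E x (a + b) = ract E x a + ract E x b) \<and>
     (\<forall>x\<in>carrier E. \<forall>a b. ract E x (a * b) = ract E (ract E x a) b) \<and>
     (\<forall>x\<in>carrier E. ract E x 1 = x) \<and>
     (\<forall>x\<in>carrier E. \<forall>a c. ract E (c *\<^sub>C x) a = c *\<^sub>C ract E x a \<and>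
                             ract E x (c *\<^sub>C a) = c *\<^sub>C ract E x a) \<and>
     (\<forall>x\<in>carrier E. \<forall>y\<in>carrier E. \<forall>z\<in>carrier E. ip E x (y + z) = ip E x y + ip E x z) \<and>
     (\<forall>x\<in>carrier E. \<forall>y\<in>carrier E. \<forall>c. ip E x (c *\<^sub>C y) = c *\<^sub>C ip E x y) \<and>
     (\<forall>x\<in>carrier E. \<forall>y\<in>carrier E. \<forall>a. ip E x (ract E y a) = ip E x y * a) \<and>
     (\<forall>x\<in>carrier E. \<forall>y\<in>carrier E. star (ip E x y) = ip E y x) \<and>
     (\<forall>x\<in>carrier E. positive (ip E x x)) \<and>
     (\<forall>x\<in>carrier E. ip E x x = 0 \<longrightarrow> x = 0) \<and>
     (\<forall>s. (\<forall>n. s n \<in> carrier E) \<and> (\<forall>e>0. \<exists>N. \<forall>m\<ge>N. \<forall>n\<ge>N. hnorm E (s m - s n) < e)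
        \<longrightarrow> (\<exists>x\<in>carrier E. (\<lambda>n. hnorm E (s n - x)) \<longlonglongrightarrow> 0))"

definition self_dual :: "('e :: complex_vec, 'm :: wstar_algebra) hmodule \<Rightarrow> bool" where
  "self_dual E \<longleftrightarrow>
     (\<forall>f C. (\<forall>x\<in>carrier E. \<forall>y\<in>carrier E. f (x + y) = f x + f y) \<and>
            (\<forall>x\<in>carrier E. \<forall>a. f (ract E x a) = f x * a) \<and>
            (\<forall>x\<in>carrier E. norm (f x) \<le> C * hnorm E x)
        \<longrightarrow> (\<exists>y\<in>carrier E. \<forall>x\<in>carrier E. f x = ip E y x))"

definition hilbert_wmodule :: "('e :: complex_vec, 'm :: wstar_algebra) hmodule \<Rightarrow> bool" where
  "hilbert_wmodule E \<longleftrightarrow> hilbert_module E \<and> self_dual E"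

text \<open>The weak*-topology of a self-dual module, regarded as the dual of the (conjugate)
  projective tensor product of the module and the predual of the algebra.\<close>

definition sigma_functionals :: "('e, 'm :: wstar_algebra) hmodule \<Rightarrow> ('e \<Rightarrow> complex) set" where
  "sigma_functionals E =
     {(\<lambda>x. \<Sum>n. \<omega> n (ip E (\<eta> n) x)) | (\<omega> :: nat \<Rightarrow> 'm \<Rightarrow> complex) \<eta>.
        (\<forall>n. \<omega> n \<in> predual) \<and> (\<forall>n. \<eta> n \<in> carrier E) \<and>
        summable (\<lambda>n. onorm (\<omega> n) * hnorm E (\<eta> n))}"

definition sigma_topology :: "('e, 'm :: wstar_algebra) hmodule \<Rightarrow> 'e topology" where
  "sigma_topology E = initial_topology (carrier E) (sigma_functionals E)"

text \<open>Operators on a module are functions on the ambient type vanishing off the carrier, so that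
  they are determined by their values on the carrier. Adjointable operators are automatically
  linear, right modular and bounded.\<close>

definition adjointables :: "('e :: complex_vec, 'm :: wstar_algebra) hmodule \<Rightarrow> ('e \<Rightarrow> 'e) set" where
  "adjointables E =
     {T. T ` carrier E \<subseteq> carrier E \<and> (\<forall>x. x \<notin> carrier E \<longrightarrow> T x = 0) \<and>
         (\<exists>S. S ` carrier E \<subseteq> carrier E \<and>
              (\<forall>x\<in>carrier E. \<forall>y\<in>carrier E. ip E (S x) y = ip E x (T y)))}"

definition adjoint_of ::
    "('e :: complex_vec, 'm :: wstar_algebra) hmodule \<Rightarrow> ('e \<Rightarrow> 'e) \<Rightarrow> 'e \<Rightarrow> 'e" where
  "adjoint_of E T =
     (THE S. S \<in> adjointables E \<and>
        (\<forall>x\<in>carrier E. \<forall>y\<in>carrier E. ip E (S x) y = ip E x (T y)))"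

definition op_on :: "('e, 'm) hmodule \<Rightarrow> ('e \<Rightarrow> 'e) \<Rightarrow> 'e \<Rightarrow> 'e :: complex_vec" where
  "op_on E T = (\<lambda>x. if x \<in> carrier E then T x else 0)"

text \<open>The predual of the W*-algebra of adjointable operators on a self-dual module, and the
  resulting weak*-topology.\<close>

definition normal_functionals ::
    "('e :: complex_vec, 'm :: wstar_algebra) hmodule \<Rightarrow> (('e \<Rightarrow> 'e) \<Rightarrow> complex) set" where
  "normal_functionals E =
     {(\<lambda>T. \<Sum>n. \<omega> n (ip E (x n) (T (y n)))) | (\<omega> :: nat \<Rightarrow> 'm \<Rightarrow> complex) x y.
        (\<forall>n. \<omega> n \<in> predual) \<and> (\<forall>n. x n \<in> carrier E \<and> y n \<in> carrier E) \<and>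
        summable (\<lambda>n. onorm (\<omega> n) * hnorm E (x n) * hnorm E (y n))}"

definition ultraweak_topology ::
    "('e :: complex_vec, 'm :: wstar_algebra) hmodule \<Rightarrow> ('e \<Rightarrow> 'e) topology" where
  "ultraweak_topology E = initial_topology (adjointables E) (normal_functionals E)"


section \<open>W*-correspondences and their tensor powers\<close>

definition wstar_correspondence ::
    "('e :: complex_vec, 'm :: wstar_algebra) hmodule \<Rightarrow> ('m \<Rightarrow> 'e \<Rightarrow> 'e) \<Rightarrow> bool" where
  "wstar_correspondence E \<phi> \<longleftrightarrow>
     hilbert_wmodule E \<and>
     (\<forall>a. \<phi> a \<in> adjointables E) \<and>
     (\<forall>a b. \<forall>x\<in>carrier E. \<phi> (a + b) x = \<phi> a x + \<phi> b x) \<and>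
     (\<forall>c a. \<forall>x\<in>carrier E. \<phi> (c *\<^sub>C a) x = c *\<^sub>C \<phi> a x) \<and>
     (\<forall>a b. \<forall>x\<in>carrier E. \<phi> (a * b) x = \<phi> a (\<phi> b x)) \<and>
     (\<forall>a. \<forall>x\<in>carrier E. \<forall>y\<in>carrier E. ip E (\<phi> (star a) x) y = ip E x (\<phi> a y)) \<and>
     (\<forall>f\<in>normal_functionals E. (\<lambda>a. f (\<phi> a)) \<in> predual) \<and>
     sigma_topology E closure_of {\<phi> a x | a x. x \<in> carrier E} = carrier E"

text \<open>\<open>(Z, \<theta>)\<close>, together with \<open>(\<xi>, \<eta>) \<mapsto> t \<xi> \<eta>\<close>, is the self-dual completion of the internal
  tensor product of \<open>(E, \<phi>)\<close> and \<open>(X, \<psi>)\<close> balanced over \<open>\<psi>\<close>. The formula for the inner product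
  forces \<open>t\<close> to be bilinear and balanced, and the density of the linear span of the elementary
  tensors determines \<open>(Z, \<theta>, t)\<close> up to a unique isomorphism.\<close>

definition internal_tensor ::
    "('e :: complex_vec, 'm :: wstar_algebra) hmodule \<Rightarrow> ('m \<Rightarrow> 'e \<Rightarrow> 'e) \<Rightarrow>
     ('x :: complex_vec, 'm) hmodule \<Rightarrow> ('m \<Rightarrow> 'x \<Rightarrow> 'x) \<Rightarrow>
     ('z :: complex_vec, 'm) hmodule \<Rightarrow> ('m \<Rightarrow> 'z \<Rightarrow> 'z) \<Rightarrow> ('e \<Rightarrow> 'x \<Rightarrow> 'z) \<Rightarrow> bool" where
  "internal_tensor E \<phi> X \<psi> Z \<theta> t \<longleftrightarrow>
     wstar_correspondence Z \<theta> \<and>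
     (\<forall>\<xi>\<in>carrier E. \<forall>\<eta>\<in>carrier X. t \<xi> \<eta> \<in> carrier Z) \<and>
     (\<forall>\<xi>\<^sub>1\<in>carrier E. \<forall>\<xi>\<^sub>2\<in>carrier E. \<forall>\<eta>\<^sub>1\<in>carrier X. \<forall>\<eta>\<^sub>2\<in>carrier X.
        ip Z (t \<xi>\<^sub>1 \<eta>\<^sub>1) (t \<xi>\<^sub>2 \<eta>\<^sub>2) = ip X \<eta>\<^sub>1 (\<psi> (ip E \<xi>\<^sub>1 \<xi>\<^sub>2) \<eta>\<^sub>2)) \<and>
     (\<forall>a. \<forall>\<xi>\<in>carrier E. \<forall>\<eta>\<in>carrier X. \<theta> a (t \<xi> \<eta>) = t (\<phi> a \<xi>) \<eta>) \<and>
     sigma_topology Z closure_of cspan {t \<xi> \<eta> | \<xi> \<eta>. \<xi> \<in> carrier E \<and> \<eta> \<in> carrier X} = carrier Z"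

text \<open>\<open>\<iota>\<close> identifies the algebra, with its left and right multiplication and the inner product
  \<open>(a, b) \<mapsto> a* b\<close>, with the module \<open>(X, \<psi>)\<close>.\<close>

definition trivial_correspondence ::
    "('x :: complex_vec, 'm :: wstar_algebra) hmodule \<Rightarrow> ('m \<Rightarrow> 'x \<Rightarrow> 'x) \<Rightarrow> ('m \<Rightarrow> 'x) \<Rightarrow> bool" where
  "trivial_correspondence X \<psi> \<iota> \<longleftrightarrow>
     wstar_correspondence X \<psi> \<and>
     bij_betw \<iota> UNIV (carrier X) \<and>
     (\<forall>a b. \<iota> (a + b) = \<iota> a + \<iota> b) \<and>
     (\<forall>c a. \<iota> (c *\<^sub>C a) = c *\<^sub>C \<iota> a) \<and>
     (\<forall>a b. ract X (\<iota> a) b = \<iota> (a * b)) \<and>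
     (\<forall>a b. ip X (\<iota> a) (\<iota> b) = star a * b) \<and>
     (\<forall>a b. \<psi> a (\<iota> b) = \<iota> (a * b))"

text \<open>\<open>(X n, \<psi> n)\<close> is the \<open>n\<close>-th tensor power of \<open>(E, \<phi>)\<close>, and \<open>tens n \<xi> \<eta>\<close> is the
  element \<open>\<xi> \<otimes> \<eta>\<close> of the power \<open>n + 1\<close>, for \<open>\<eta>\<close> in the power \<open>n\<close>. The power \<open>1\<close> is the tensor
  product of \<open>E\<close> with the algebra, which is \<open>E\<close> by \<open>\<xi> \<otimes> a \<mapsto> \<xi>a\<close>. All powers are realised inside a
  single type.\<close>

definition tensor_powers ::
    "('e :: complex_vec, 'm :: wstar_algebra) hmodule \<Rightarrow> ('m \<Rightarrow> 'e \<Rightarrow> 'e) \<Rightarrow>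
     (nat \<Rightarrow> ('x :: complex_vec, 'm) hmodule) \<Rightarrow> (nat \<Rightarrow> 'm \<Rightarrow> 'x \<Rightarrow> 'x) \<Rightarrow>
     ('m \<Rightarrow> 'x) \<Rightarrow> (nat \<Rightarrow> 'e \<Rightarrow> 'x \<Rightarrow> 'x) \<Rightarrow> bool" where
  "tensor_powers E \<phi> X \<psi> \<iota> tens \<longleftrightarrow>
     trivial_correspondence (X 0) (\<psi> 0) \<iota> \<and>
     (\<forall>n. internal_tensor E \<phi> (X n) (\<psi> n) (X (Suc n)) (\<psi> (Suc n)) (tens n))"


section \<open>The full Fock space and the Hardy algebra\<close>

text \<open>The ultraweak direct sum: sequences for which the partial sums of \<open>\<langle>x\<^sub>n, x\<^sub>n\<rangle>\<close> are bounded,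
  with the ultraweakly convergent inner product \<open>\<Sum>\<^sub>n \<langle>x\<^sub>n, y\<^sub>n\<rangle>\<close>. This is Paschke's description of
  the self-dual completion of the Hilbert module direct sum of self-dual modules.\<close>

definition ultraweak_sum ::
    "(nat \<Rightarrow> ('x :: complex_vec, 'm :: wstar_algebra) hmodule) \<Rightarrow> (nat \<Rightarrow> 'x, 'm) hmodule" where
  "ultraweak_sum X =
     \<lparr>carrier = {x. (\<forall>n. x n \<in> carrier (X n)) \<and>
                    (\<exists>C. \<forall>N. norm (\<Sum>n<N. ip (X n) (x n) (x n)) \<le> C)},
      ract = (\<lambda>x a n. ract (X n) (x n) a),
      ip = (\<lambda>x y. weakstar_lim (\<lambda>N. \<Sum>n<N. ip (X n) (x n) (y n)))\<rparr>"

definition creation ::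
    "(nat \<Rightarrow> ('x :: complex_vec, 'm :: wstar_algebra) hmodule) \<Rightarrow> (nat \<Rightarrow> 'e \<Rightarrow> 'x \<Rightarrow> 'x) \<Rightarrow>
     'e \<Rightarrow> (nat \<Rightarrow> 'x) \<Rightarrow> nat \<Rightarrow> 'x" where
  "creation X tens \<xi> =
     op_on (ultraweak_sum X) (\<lambda>x n. case n of 0 \<Rightarrow> 0 | Suc m \<Rightarrow> tens m \<xi> (x m))"

definition fock_left ::
    "(nat \<Rightarrow> ('x :: complex_vec, 'm :: wstar_algebra) hmodule) \<Rightarrow> (nat \<Rightarrow> 'm \<Rightarrow> 'x \<Rightarrow> 'x) \<Rightarrow>
     'm \<Rightarrow> (nat \<Rightarrow> 'x) \<Rightarrow> nat \<Rightarrow> 'x" where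
  "fock_left X \<psi> a = op_on (ultraweak_sum X) (\<lambda>x n. \<psi> n a (x n))"

inductive_set generated_algebra :: "('v \<Rightarrow> 'v :: complex_vec) set \<Rightarrow> ('v \<Rightarrow> 'v) set"
  for G :: "('v \<Rightarrow> 'v) set" where
  generator: "T \<in> G \<Longrightarrow> T \<in> generated_algebra G"
| add: "S \<in> generated_algebra G \<Longrightarrow> T \<in> generated_algebra G \<Longrightarrow> (\<lambda>x. S x + T x) \<in> generated_algebra G"
| scale: "T \<in> generated_algebra G \<Longrightarrow> (\<lambda>x. c *\<^sub>C T x) \<in> generated_algebra G"
| mult: "S \<in> generated_algebra G \<Longrightarrow> T \<in> generated_algebra G \<Longrightarrow> S \<circ> T \<in> generated_algebra G"

definition hardy_algebra ::
    "('e :: complex_vec, 'm :: wstar_algebra) hmodule \<Rightarrow> (nat \<Rightarrow> ('x :: complex_vec, 'm) hmodule) \<Rightarrow>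
     (nat \<Rightarrow> 'm \<Rightarrow> 'x \<Rightarrow> 'x) \<Rightarrow> (nat \<Rightarrow> 'e \<Rightarrow> 'x \<Rightarrow> 'x) \<Rightarrow> ((nat \<Rightarrow> 'x) \<Rightarrow> nat \<Rightarrow> 'x) set" where
  "hardy_algebra E X \<psi> tens =
     ultraweak_topology (ultraweak_sum X) closure_of
       generated_algebra (creation X tens ` carrier E \<union> range (fock_left X \<psi>))"

text \<open>Since the projection \<open>P\<^sub>n\<close> keeps the \<open>n\<close>-th component only, \<open>W\<^sub>t = \<Sum>\<^sub>n e\<^sup>i\<^sup>n\<^sup>t P\<^sub>n\<close> multiplies
  the \<open>n\<close>-th component by \<open>e\<^sup>i\<^sup>n\<^sup>t\<close>.\<close>

definition gauge_unitary ::
    "(nat \<Rightarrow> ('x :: complex_vec, 'm :: wstar_algebra) hmodule) \<Rightarrow> real \<Rightarrow> (nat \<Rightarrow> 'x) \<Rightarrow> nat \<Rightarrow> 'x" where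
  "gauge_unitary X t = op_on (ultraweak_sum X) (\<lambda>x n. cis (real n * t) *\<^sub>C x n)"

definition gauge_action ::
    "(nat \<Rightarrow> ('x :: complex_vec, 'm :: wstar_algebra) hmodule) \<Rightarrow> real \<Rightarrow>
     ((nat \<Rightarrow> 'x) \<Rightarrow> nat \<Rightarrow> 'x) \<Rightarrow> (nat \<Rightarrow> 'x) \<Rightarrow> nat \<Rightarrow> 'x" where
  "gauge_action X t T =
     gauge_unitary X t \<circ> T \<circ> adjoint_of (ultraweak_sum X) (gauge_unitary X t)"

definition fourier0 ::
    "(nat \<Rightarrow> ('x :: complex_vec, 'm :: wstar_algebra) hmodule) \<Rightarrow>
     ((nat \<Rightarrow> 'x) \<Rightarrow> nat \<Rightarrow> 'x) \<Rightarrow> (nat \<Rightarrow> 'x) \<Rightarrow> nat \<Rightarrow> 'x" where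
  "fourier0 X T =
     (THE Z. Z \<in> adjointables (ultraweak_sum X) \<and>
        (\<forall>f\<in>normal_functionals (ultraweak_sum X).
           ((\<lambda>t. f (gauge_action X t T)) has_integral complex_of_real (2 * pi) * f Z) {0..2 * pi}))"


section \<open>Representations on Hilbert spaces\<close>

definition bounded_clinear :: "('h :: complex_banach \<Rightarrow> 'k :: complex_banach) \<Rightarrow> bool" where
  "bounded_clinear T \<longleftrightarrow> bounded_linear T \<and> (\<forall>c x. T (c *\<^sub>C x) = c *\<^sub>C T x)"

definition normal_representation ::
    "('m :: wstar_algebra \<Rightarrow> 'h \<Rightarrow> 'h :: chilbert_space) \<Rightarrow> bool" where
  "normal_representation \<pi> \<longleftrightarrow>
     (\<forall>a. bounded_clinear (\<pi> a)) \<and>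
     (\<forall>a b h. \<pi> (a + b) h = \<pi> a h + \<pi> b h) \<and>
     (\<forall>c a h. \<pi> (c *\<^sub>C a) h = c *\<^sub>C \<pi> a h) \<and>
     (\<forall>a b h. \<pi> (a * b) h = \<pi> a (\<pi> b h)) \<and>
     (\<forall>a h k. cinner (\<pi> (star a) h) k = cinner h (\<pi> a k)) \<and>
     closure (cspan {\<pi> a h | a h. True}) = UNIV \<and>
     (\<forall>h k :: nat \<Rightarrow> 'h. summable (\<lambda>n. (norm (h n))\<^sup>2) \<and> summable (\<lambda>n. (norm (k n))\<^sup>2)
        \<longrightarrow> (\<lambda>a. \<Sum>n. cinner (h n) (\<pi> a (k n))) \<in> predual)"

text \<open>The Hilbert space \<open>'k\<close>, together with \<open>(x, h) \<mapsto> \<tau> x h\<close>, is the tensor product of \<open>F\<close> with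
  \<open>'h\<close> along \<open>\<pi>\<close>.\<close>

definition hilbert_tensor ::
    "('f :: complex_vec, 'm :: wstar_algebra) hmodule \<Rightarrow> ('m \<Rightarrow> 'h \<Rightarrow> 'h :: chilbert_space) \<Rightarrow>
     ('f \<Rightarrow> 'h \<Rightarrow> 'k :: chilbert_space) \<Rightarrow> bool" where
  "hilbert_tensor F \<pi> \<tau> \<longleftrightarrow>
     (\<forall>x\<in>carrier F. \<forall>y\<in>carrier F. \<forall>h k. cinner (\<tau> x h) (\<tau> y k) = cinner h (\<pi> (ip F x y) k)) \<and>
     closure (cspan {\<tau> x h | x h. x \<in> carrier F}) = UNIV"

text \<open>The operator \<open>T \<otimes> I\<close>.\<close>

definition ampliation ::
    "('f :: complex_vec, 'm :: wstar_algebra) hmodule \<Rightarrow> ('f \<Rightarrow> 'h \<Rightarrow> 'k :: chilbert_space) \<Rightarrow>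
     ('f \<Rightarrow> 'f) \<Rightarrow> 'k \<Rightarrow> 'k" where
  "ampliation F \<tau> T =
     (THE B. bounded_clinear B \<and> (\<forall>x\<in>carrier F. \<forall>h. B (\<tau> x h) = \<tau> (T x) h))"

definition Lat :: "('k \<Rightarrow> 'k :: complex_banach) set \<Rightarrow> 'k set set" where
  "Lat \<A> = {N. csubspace N \<and> closed N \<and> (\<forall>T\<in>\<A>. T ` N \<subseteq> N)}"

definition Alg :: "'k set set \<Rightarrow> ('k \<Rightarrow> 'k :: complex_banach) set" where
  "Alg \<L> = {T. bounded_clinear T \<and> (\<forall>N\<in>\<L>. T ` N \<subseteq> N)}"

end

theory Submission
  imports Defs
begin

text \<open>Write \<open>Y\<^sub>k\<close> for the diagonal blocks of \<open>Y \<otimes> I\<close>. Let \<open>S\<^sub>0\<close> be a bounded operator from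
  \<open>E\<^sup>\<otimes>\<^sup>k \<otimes> H\<close> to \<open>M \<otimes> H\<close> which intertwines the left actions of \<open>M\<close>. The operator
  \<open>S = 1 \<otimes> S\<^sub>0\<close>, which lowers degrees by \<open>k\<close>, commutes with the creation operators on the space \<open>L\<close>
  of vectors of degree at least \<open>k\<close>, so that \<open>(1 - \<lambda>S)L\<close> is invariant under the Hardy algebra and
  hence under \<open>Y \<otimes> I\<close>. Comparing the components of degree \<open>0\<close> as \<open>\<lambda> \<rightarrow> 0\<close> gives
  \<open>Y\<^sub>0 S\<^sub>0 = S\<^sub>0 Y\<^sub>k\<close>. As a right module map of \<open>M\<close>, the block \<open>Y\<^sub>0\<close> is the left multiplication by some
  \<open>a \<in> M\<close>, and therefore \<open>S\<^sub>0 (Y\<^sub>k - \<phi>\<^sub>k(a)) = 0\<close>. Since \<open>\<pi>\<close> is faithful and normal, the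
  intertwiners \<open>S\<^sub>0\<close> separate the vectors of degree \<open>k\<close>, by an argument in the spirit of Kaplansky's
  density theorem. Hence \<open>Y\<^sub>k = \<phi>\<^sub>k(a)\<close> for all \<open>k\<close>, which means that the zeroth Fourier coefficient of \<open>Y\<close> is the left action of \<open>a\<close>.

  All estimates are carried out on Hilbert spaces; this is possible because a faithful normal
  representation is isometric, which follows here from the weak* compactness of the unit ball.\<close>


text \<open>The obstacle is the gap between module data and Hilbert space data. Operators are known
  only through inner products of elementary tensors, invariant subspaces live in the completed
  space, and the Hardy algebra is closed in a topology tested by functionals built from module
  elements. Operators are therefore built from Gram matrices: the growth rate of the iterates of T*T
  bounds T, which takes the Cauchy-Schwarz inequality and no order theory of C*-algebras. Elementary
  tensors are rescaled by invertible elements of the algebra, so that a vector functional with one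
  elementary vector becomes normal. The parameter \<lambda> is used twice. For g in degree k the
  degree 0 parts satisfy P_0 Y g = \<lambda> (P_0 Y S_0 g - S_0 P_k v), where v depends on \<lambda>
  and tends to Y g. The limit gives P_0 Y g = 0; dividing by \<lambda> then leaves the relation
  itself. Separation needs contractions of the algebra and not just elements, because only bounded
  sets are sure to have weak* cluster points.\<close>

lemma scaleC_zero [simp]: "c *\<^sub>C 0 = 0" "0 *\<^sub>C x = 0"
  by (rule complex_vec.scale_zero_right, rule complex_vec.scale_zero_left)

lemmas scaleC_minus = complex_vec.scale_minus_right complex_vec.scale_minus_left
lemmas scaleC_diff = complex_vec.scale_right_diff_distrib complex_vec.scale_left_diff_distrib

lemma bounded_linear_scaleC: "bounded_linear (\<lambda>x :: 'a :: complex_banach. c *\<^sub>C x)"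
  by (rule bounded_linear_intro[where K = "cmod c"])
     (simp_all add: scaleC_add_right scaleR_eq_scaleC scaleC_scaleC norm_scaleC mult.commute)

lemmas tendsto_scaleC = bounded_linear.tendsto[OF bounded_linear_scaleC]

lemma csubspace_imp_subspace:
  fixes S :: "'a :: complex_banach set"
  shows "csubspace S \<Longrightarrow> subspace S"
  unfolding complex_vec.subspace_def real_vector.subspace_def by (simp add: scaleR_eq_scaleC)

lemma csubspace_closure:
  fixes S :: "'a :: complex_banach set"
  assumes "csubspace S"
  shows "csubspace (closure S)"
proof -
  have "0 \<in> closure S"
    using assms complex_vec.subspace_0 closure_subset by blast
  moreover have "x + y \<in> closure S" if xy: "x \<in> closure S" "y \<in> closure S" for x y
  proof -
    obtain s t where "\<And>n. s n \<in> S" "s \<longlonglongrightarrow> x" "\<And>n. t n \<in> S" "t \<longlonglongrightarrow> y"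
      using xy unfolding closure_sequential by blast
    then show ?thesis
      unfolding closure_sequential using complex_vec.subspace_add[OF assms]
      by (intro exI[of _ "\<lambda>n. s n + t n"]) (auto intro: tendsto_add)
  qed
  moreover have "c *\<^sub>C x \<in> closure S" if "x \<in> closure S" for c x
  proof -
    have "(\<lambda>x. c *\<^sub>C x) ` closure S \<subseteq> closure ((\<lambda>x. c *\<^sub>C x) ` S)"
      by (rule closure_bounded_linear_image_subset[OF bounded_linear_scaleC])
    also have "\<dots> \<subseteq> closure S"
      using assms by (intro closure_mono) (auto simp: complex_vec.subspace_def)
    finally show ?thesis using that by blast
  qed
  ultimately show ?thesis by (auto simp: complex_vec.subspace_def)
qed

lemma bounded_clinear_simps:
  assumes "bounded_clinear T"
  shows "bounded_linear T" "T (x + y) = T x + T y" "T (x - y) = T x - T y" "T 0 = 0"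
    "T (- x) = - T x" "T (c *\<^sub>C x) = c *\<^sub>C T x"
  using assms unfolding bounded_clinear_def
  by (auto simp: linear_simps bounded_linear.bounded_linear)

lemma bounded_clinear_sum:
  assumes "bounded_clinear T"
  shows "T (\<Sum>i\<in>I. f i) = (\<Sum>i\<in>I. T (f i))"
  using bounded_clinear_simps(1)[OF assms] by (simp add: linear_sum bounded_linear.linear)

lemma bounded_clinearI:
  fixes T :: "'a :: complex_banach \<Rightarrow> 'b :: complex_banach"
  assumes "\<And>x y. T (x + y) = T x + T y" "\<And>c x. T (c *\<^sub>C x) = c *\<^sub>C T x"
    "\<And>x. norm (T x) \<le> C * norm x"
  shows "bounded_clinear T"
  unfolding bounded_clinear_def using assms
  by (auto intro!: bounded_linear_intro[where K = C] simp: scaleR_eq_scaleC mult.commute)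

lemma bounded_clinear_compose:
  "bounded_clinear S \<Longrightarrow> bounded_clinear T \<Longrightarrow> bounded_clinear (\<lambda>x. S (T x))"
  unfolding bounded_clinear_def by (auto intro: bounded_linear_compose)

lemma bounded_clinear_diff:
  "bounded_clinear S \<Longrightarrow> bounded_clinear T \<Longrightarrow> bounded_clinear (\<lambda>x. S x - T x)"
  unfolding bounded_clinear_def by (auto intro: bounded_linear_sub simp: scaleC_diff)

lemma bounded_clinear_add:
  "bounded_clinear S \<Longrightarrow> bounded_clinear T \<Longrightarrow> bounded_clinear (\<lambda>x. S x + T x)"
  unfolding bounded_clinear_def by (auto intro: bounded_linear_add simp: scaleC_add_right)

lemma bounded_clinear_scaleC:
  "bounded_clinear (\<lambda>x :: 'a :: complex_banach. c *\<^sub>C x)"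
  unfolding bounded_clinear_def by (auto intro: bounded_linear_scaleC simp: scaleC_scaleC mult.commute)

lemma bounded_clinear_ident: "bounded_clinear (\<lambda>x :: 'a :: complex_banach. x)"
  unfolding bounded_clinear_def by (auto intro: bounded_linear_ident)

lemma bounded_clinear_zero: "bounded_clinear (\<lambda>x :: 'a :: complex_banach. 0 :: 'b :: complex_banach)"
  unfolding bounded_clinear_def by (auto intro: bounded_linear_zero)

lemma bounded_clinear_eq_on_closure:
  assumes "bounded_clinear S" "bounded_clinear T" "\<And>x. x \<in> G \<Longrightarrow> S x = T x"
    "x \<in> closure (cspan G)"
  shows "S x = T x"
proof -
  have "csubspace {x. S x = T x}"
    using assms(1,2) by (simp add: complex_vec.subspace_def bounded_clinear_simps)
  then have "cspan G \<subseteq> {x. S x = T x}"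
    using assms(3) by (intro complex_vec.span_minimal) auto
  moreover have "closed {x. S x = T x}"
    using assms(1,2) by (intro closed_Collect_eq linear_continuous_on bounded_clinear_simps(1))
  ultimately show ?thesis using assms(4) closure_minimal by blast
qed

lemma bounded_clinear_image_closure_cspan:
  assumes "bounded_clinear T" "\<And>x. x \<in> G \<Longrightarrow> T x \<in> N" "csubspace N" "closed N"
    "x \<in> closure (cspan G)"
  shows "T x \<in> N"
proof -
  have "csubspace {x. T x \<in> N}"
    using assms(1,3) by (simp add: complex_vec.subspace_def bounded_clinear_simps)
  then have "cspan G \<subseteq> {x. T x \<in> N}"
    using assms(2) by (intro complex_vec.span_minimal) auto
  moreover have "closed {x. T x \<in> N}"
    using continuous_closed_vimage[OF assms(4), of T]
      linear_continuous_at[OF bounded_clinear_simps(1)[OF assms(1)]]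
    by (simp add: vimage_def)
  ultimately show ?thesis using assms(5) closure_minimal by blast
qed

lemma csubspace_closure_cspan: "csubspace (closure (cspan (G :: 'a :: complex_banach set)))"
  by (intro csubspace_closure complex_vec.subspace_span)

lemma in_closure_cspan: "x \<in> G \<Longrightarrow> x \<in> closure (cspan G)"
  by (meson closure_subset complex_vec.span_base subsetD)

text \<open>Coefficients are indexed by \<open>J\<close> and not by vectors, because in the Gram
  arguments below different indices may name the same vector. A new index may already belong to
  \<open>I\<close>, so its coefficient is added to the old one.\<close>

lemma cspan_range_sum:
  assumes "x \<in> cspan (f ` J)"
  obtains I c where "finite I" "I \<subseteq> J" "x = (\<Sum>i\<in>I. c i *\<^sub>C f i)"
proof -
  have "\<exists>I c. finite I \<and> I \<subseteq> J \<and> x = (\<Sum>i\<in>I. c i *\<^sub>C f i)"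
    using assms
  proof (induction rule: complex_vec.span_induct_alt)
    case base
    show ?case by (rule exI[of _ "{}"]) simp
  next
    case (step c y z)
    then obtain I d i where I: "finite I" "I \<subseteq> J" "z = (\<Sum>i\<in>I. d i *\<^sub>C f i)" and i: "i \<in> J" "y = f i"
      by auto
    let ?d = "\<lambda>j. (if j = i then c else 0) + (if j \<in> I then d j else 0)"
    have "c *\<^sub>C y + z = (\<Sum>j\<in>insert i I. ?d j *\<^sub>C f j)"
    proof -
      have "(\<Sum>j\<in>insert i I. (if j = i then c else 0) *\<^sub>C f j) = c *\<^sub>C f i"
        using I(1) by (subst sum.remove[of _ i]) auto
      moreover have "(\<Sum>j\<in>insert i I. (if j \<in> I then d j else 0) *\<^sub>C f j) = z"
        unfolding I(3) using I(1) by (intro sum.mono_neutral_cong_right) auto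
      ultimately show ?thesis by (simp add: scaleC_add_left sum.distrib i(2))
    qed
    then show ?case using I i by (intro exI[of _ "insert i I"] exI[of _ ?d]) auto
  qed
  then show ?thesis using that by blast
qed

subsection \<open>Hilbert spaces\<close>

lemma cinner_add_left: "cinner (x + y) z = cinner x z + cinner y z" for x :: "'a :: chilbert_space"
  by (metis cinner_add_right cinner_commute complex_cnj_add)

lemma cinner_scaleC_left: "cinner (c *\<^sub>C x) z = cnj c * cinner x z" for x :: "'a :: chilbert_space"
  by (metis cinner_commute cinner_scaleC_right complex_cnj_mult)

lemma cinner_zero [simp]: "cinner 0 x = 0" "cinner x 0 = 0" for x :: "'a :: chilbert_space"
  using cinner_scaleC_left[of 0 0 x] cinner_scaleC_right[of x 0 0] by simp_all

lemma cinner_minus: "cinner (- x) y = - cinner x y" "cinner x (- y) = - cinner x y"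
  for x :: "'a :: chilbert_space"
  using cinner_add_left[of x "- x" y] cinner_add_right[of x y "- y"]
  by (simp_all add: eq_neg_iff_add_eq_0 add.commute)

lemma cinner_diff: "cinner (x - y) z = cinner x z - cinner y z" "cinner x (y - z) = cinner x y - cinner x z"
  for x :: "'a :: chilbert_space"
  using cinner_add_left[of x "- y" z] cinner_add_right[of x y "- z"] by (simp_all add: cinner_minus)

lemma cinner_sum: "cinner (\<Sum>i\<in>I. f i) y = (\<Sum>i\<in>I. cinner (f i) y)"
    "cinner y (\<Sum>i\<in>I. f i) = (\<Sum>i\<in>I. cinner y (f i))"
  for y :: "'a :: chilbert_space"
  by (induction I rule: infinite_finite_induct; simp add: cinner_add_left cinner_add_right)+

lemmas cinner_linear = cinner_add_left cinner_add_right cinner_scaleC_left cinner_scaleC_right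
  cinner_minus cinner_diff

lemma cinner_self: "cinner x x = complex_of_real ((norm x)\<^sup>2)" for x :: "'a :: chilbert_space"
proof -
  have "Im (cinner x x) = 0" using cinner_commute[of x x] by (metis Reals_cnj_iff complex_is_Real_iff)
  then show ?thesis by (simp add: norm_eq_sqrt_cinner cinner_self_nonneg complex_eq_iff)
qed

lemma cmod_cinner_self: "cmod (cinner x x) = (norm x)\<^sup>2" for x :: "'a :: chilbert_space"
  by (simp only: cinner_self norm_of_real) simp

lemma norm_add_sq: "(norm (x + y))\<^sup>2 = (norm x)\<^sup>2 + (norm y)\<^sup>2 + 2 * Re (cinner x y)"
  for x :: "'a :: chilbert_space"
proof -
  have "complex_of_real ((norm (x + y))\<^sup>2) = complex_of_real ((norm x)\<^sup>2) + complex_of_real ((norm y)\<^sup>2)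
      + (cinner x y + cnj (cinner x y))"
    by (simp only: cinner_self[symmetric] cinner_linear cinner_commute[of y x, symmetric]) simp
  then show ?thesis by (simp add: complex_add_cnj complex_eq_iff)
qed

lemma cauchy_schwarz: "cmod (cinner x y) \<le> norm x * norm y" for x :: "'a :: chilbert_space"
proof (cases "y = 0")
  case False
  define c where "c = cinner y x / complex_of_real ((norm y)\<^sup>2)"
  have "0 \<le> (norm (x + (- c) *\<^sub>C y))\<^sup>2" by simp
  also have "(norm (x + (- c) *\<^sub>C y))\<^sup>2 = (norm x)\<^sup>2 + (cmod c * norm y)\<^sup>2 - 2 * Re (c * cinner x y)"
    unfolding norm_add_sq by (simp add: norm_scaleC cinner_linear)
  also have "c * cinner x y = complex_of_real ((cmod (cinner x y))\<^sup>2 / (norm y)\<^sup>2)"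
    unfolding c_def by (subst cinner_commute[of y x]) (simp add: complex_norm_square[symmetric] mult.commute)
  also have "cmod c * norm y = cmod (cinner x y) / norm y"
    using False unfolding c_def
    by (subst cinner_commute[of y x]) (simp add: norm_divide power2_eq_square norm_mult)
  finally have "(cmod (cinner x y))\<^sup>2 / (norm y)\<^sup>2 \<le> (norm x)\<^sup>2"
    using zero_le_power2[of "norm (x + (- c) *\<^sub>C y)"] by (simp add: power_divide)
  then have "(cmod (cinner x y))\<^sup>2 \<le> (norm x * norm y)\<^sup>2"
    using False by (simp add: field_simps power_mult_distrib)
  then show ?thesis using power2_le_imp_le by fastforce
qed simp

lemma bounded_linear_cinner_right: "bounded_linear (cinner x)" for x :: "'a :: chilbert_space"
  by (rule bounded_linear_intro[where K = "norm x"])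
     (use cauchy_schwarz[of x] in \<open>simp_all add: cinner_linear scaleR_eq_scaleC scaleR_conv_of_real mult.commute\<close>)

lemma bounded_linear_cinner_left: "bounded_linear (\<lambda>x. cinner x y)" for y :: "'a :: chilbert_space"
  by (rule bounded_linear_intro[where K = "norm y"])
     (use cauchy_schwarz[of _ y] in \<open>simp_all add: cinner_linear scaleR_eq_scaleC scaleR_conv_of_real\<close>)

lemmas tendsto_cinner_left = bounded_linear.tendsto[OF bounded_linear_cinner_left]

lemma cinner_ext: "(\<And>z. cinner z x = cinner z y) \<Longrightarrow> x = y" for x :: "'a :: chilbert_space"
proof -
  assume "\<And>z. cinner z x = cinner z y"
  then have "cinner (x - y) (x - y) = 0" by (simp add: cinner_diff)
  then show ?thesis by (simp add: cinner_self)
qed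

lemma orthogonal_closure_cspan:
  fixes x :: "'a :: chilbert_space"
  assumes "\<And>g. g \<in> G \<Longrightarrow> cinner x g = 0" "y \<in> closure (cspan G)"
  shows "cinner x y = 0"
proof -
  have "csubspace {y. cinner x y = 0}" by (simp add: complex_vec.subspace_def cinner_linear)
  then have "cspan G \<subseteq> {y. cinner x y = 0}" using assms by (intro complex_vec.span_minimal) auto
  moreover have "closed {y. cinner x y = 0}"
    by (intro closed_Collect_eq linear_continuous_on[OF bounded_linear_cinner_right] continuous_on_const)
  ultimately show ?thesis using assms(2) closure_minimal by blast
qed

lemma total_zero:
  fixes x :: "'a :: chilbert_space"
  assumes "closure (cspan G) = UNIV" "\<And>g. g \<in> G \<Longrightarrow> cinner g x = 0"
  shows "x = 0"
proof -
  have "cinner x x = 0"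
    using orthogonal_closure_cspan[of G x x] assms cinner_commute by (metis UNIV_I complex_cnj_zero)
  then show ?thesis by (simp add: cinner_self)
qed

text \<open>Real subspaces, and hence real parts, are what \<open>self_adjoint_approximation\<close>
  needs: it projects onto the closure of the vectors produced by self-adjoint elements, which is in
  general only real linear.\<close>

lemma projection_exists:
  fixes S :: "'a :: chilbert_space set"
  assumes S: "subspace S" "closed S"
  obtains p where "p \<in> S" "\<And>s. s \<in> S \<Longrightarrow> Re (cinner (x - p) s) = 0"
proof -
  define d where "d = (INF s\<in>S. (norm (x - s))\<^sup>2)"
  have bdd: "bdd_below ((\<lambda>s. (norm (x - s))\<^sup>2) ` S)" by (rule bdd_belowI2[of _ 0]) simp
  have ne: "S \<noteq> {}" using S(1) real_vector.subspace_0 by auto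
  have dle: "d \<le> (norm (x - s))\<^sup>2" if "s \<in> S" for s
    unfolding d_def by (rule cINF_lower[OF bdd that])
  have "\<exists>s\<in>S. (norm (x - s))\<^sup>2 < d + 1 / (real n + 1)" for n
  proof -
    have "d < d + 1 / (real n + 1)" by simp
    then show ?thesis using cINF_less_iff[OF ne bdd, folded d_def] by blast
  qed
  then obtain s where s: "\<And>n. s n \<in> S" "\<And>n. (norm (x - s n))\<^sup>2 < d + 1 / (real n + 1)" by metis
  \<comment> \<open>Parallelogram law: the midpoint of \<open>s m\<close> and \<open>s n\<close>
    lies in \<open>S\<close>, so its squared distance from \<open>x\<close> is at least
    \<open>d\<close>.\<close>
  have dist: "(norm (s m - s n))\<^sup>2 \<le> 2 / (real m + 1) + 2 / (real n + 1)" for m n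
  proof -
    let ?a = "x - s m" and ?b = "x - s n"
    have "(norm (?a + ?b))\<^sup>2 + (norm (?a - ?b))\<^sup>2 = 2 * (norm ?a)\<^sup>2 + 2 * (norm ?b)\<^sup>2"
      using norm_add_sq[of ?a ?b] norm_add_sq[of ?a "- ?b", unfolded norm_minus_cancel cinner_minus]
      by simp
    moreover have "?a + ?b = 2 *\<^sub>R (x - (1/2) *\<^sub>R (s m + s n))" by (simp add: algebra_simps scaleR_2)
    then have "(norm (?a + ?b))\<^sup>2 = 4 * (norm (x - (1/2) *\<^sub>R (s m + s n)))\<^sup>2"
      by (simp add: power_mult_distrib)
    moreover have "(1/2) *\<^sub>R (s m + s n) \<in> S"
      using S(1) s(1) by (intro subspace_mul subspace_add)
    ultimately show ?thesis
      using dle[of "(1/2) *\<^sub>R (s m + s n)"] s(2)[of m] s(2)[of n]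
      by (simp add: norm_minus_commute)
  qed
  have "Cauchy s"
  proof (rule CauchyI)
    fix e :: real assume "e > 0"
    obtain N :: nat where N: "4 / e\<^sup>2 < N" using reals_Archimedean2 by blast
    show "\<exists>M. \<forall>m\<ge>M. \<forall>n\<ge>M. norm (s m - s n) < e"
    proof (intro exI allI impI)
      fix m n :: nat assume mn: "N \<le> m" "N \<le> n"
      have N0: "real N + 1 > 0" by simp
      have "(norm (s m - s n))\<^sup>2 \<le> 2 / (real N + 1) + 2 / (real N + 1)"
        by (rule order.trans[OF dist add_mono]) (use mn in \<open>auto intro!: divide_left_mono\<close>)
      also have "\<dots> < e\<^sup>2"
      proof -
        have "4 < e\<^sup>2 * N" using N \<open>e > 0\<close> by (simp add: field_simps)
        also have "\<dots> \<le> e\<^sup>2 * (real N + 1)" by (intro mult_left_mono) auto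
        finally have "4 / (real N + 1) < e\<^sup>2" using N0 by (simp only: pos_divide_less_eq)
        then show ?thesis by (simp add: add.commute)
      qed
      finally show "norm (s m - s n) < e" using \<open>e > 0\<close> by (simp add: power2_less_imp_less)
    qed
  qed
  then obtain p where p: "s \<longlonglongrightarrow> p" using Cauchy_convergent convergent_def by blast
  have pS: "p \<in> S" using closed_sequentially[OF S(2)] s(1) p by blast
  have "(\<lambda>n. d + 1 / (real n + 1)) \<longlonglongrightarrow> d + 0"
    using LIMSEQ_inverse_real_of_nat by (intro tendsto_add tendsto_const) (simp add: inverse_eq_divide add.commute)
  moreover have "(\<lambda>n. (norm (x - s n))\<^sup>2) \<longlonglongrightarrow> (norm (x - p))\<^sup>2" by (intro tendsto_intros p)
  ultimately have min: "(norm (x - p))\<^sup>2 \<le> d"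
    using s(2) by (intro tendsto_le[OF _ \<open>(\<lambda>n. d + 1 / (real n + 1)) \<longlonglongrightarrow> d + 0\<close>[simplified]])
      (auto intro!: always_eventually less_imp_le)
  have "Re (cinner (x - p) s) = 0" if "s \<in> S" for s
  proof (rule ccontr)
    assume nz: "Re (cinner (x - p) s) \<noteq> 0"
    define r where "r = Re (cinner (x - p) s)"
    have s0: "s \<noteq> 0" using nz by auto
    \<comment> \<open>The minimiser of t -> |x - p - t s|^2; it lowers the squared distance by r^2 /
      |s|^2.\<close>
    define t where "t = r / (norm s)\<^sup>2"
    have "p + t *\<^sub>R s \<in> S" using S(1) pS that by (intro subspace_add subspace_mul)
    from dle[OF this] have "d \<le> (norm ((x - p) + (- t) *\<^sub>R s))\<^sup>2" by (simp add: algebra_simps)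
    also have "\<dots> = (norm (x - p))\<^sup>2 + t\<^sup>2 * (norm s)\<^sup>2 - 2 * t * r"
      unfolding norm_add_sq by (simp add: power_mult_distrib scaleR_eq_scaleC cinner_linear scaleC_minus r_def norm_scaleC)
    also have "\<dots> = (norm (x - p))\<^sup>2 - r\<^sup>2 / (norm s)\<^sup>2"
      using s0 unfolding t_def by (simp add: field_simps power2_eq_square)
    finally have "r\<^sup>2 / (norm s)\<^sup>2 \<le> 0" using min by simp
    then show False using nz s0 by (simp add: r_def divide_le_0_iff)
  qed
  then show ?thesis using pS that by blast
qed

lemma complex_projection_exists:
  fixes S :: "'a :: chilbert_space set"
  assumes S: "csubspace S" "closed S"
  shows "\<exists>p\<in>S. \<forall>s\<in>S. cinner (x - p) s = 0"
proof -
  obtain p where p: "p \<in> S" "\<And>s. s \<in> S \<Longrightarrow> Re (cinner (x - p) s) = 0"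
    using projection_exists[OF csubspace_imp_subspace] S by blast
  have "cinner (x - p) s = 0" if "s \<in> S" for s
  proof -
    have "\<i> *\<^sub>C s \<in> S" using S(1) that by (simp add: complex_vec.subspace_def)
    then show ?thesis using p(2)[of s] p(2)[of "\<i> *\<^sub>C s"] that by (simp add: cinner_linear complex_eq_iff)
  qed
  then show ?thesis using p(1) by blast
qed

definition orth_proj :: "'a :: chilbert_space set \<Rightarrow> 'a \<Rightarrow> 'a" where
  "orth_proj S x = (SOME p. p \<in> S \<and> (\<forall>s\<in>S. cinner (x - p) s = 0))"

context
  fixes S :: "'a :: chilbert_space set"
  assumes S: "csubspace S" "closed S"
begin

lemma orth_proj_in: "orth_proj S x \<in> S"
  and orth_proj_orth: "s \<in> S \<Longrightarrow> cinner (x - orth_proj S x) s = 0"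
  using someI_ex[OF complex_projection_exists[OF S, of x, unfolded Bex_def]]
  unfolding orth_proj_def by blast+

lemma orth_proj_unique:
  assumes "p \<in> S" "\<And>s. s \<in> S \<Longrightarrow> cinner (x - p) s = 0"
  shows "orth_proj S x = p"
proof -
  let ?d = "orth_proj S x - p"
  have "?d \<in> S" using S(1) assms(1) orth_proj_in by (simp add: complex_vec.subspace_diff)
  then have "cinner (x - p) ?d - cinner (x - orth_proj S x) ?d = 0" using assms orth_proj_orth by simp
  then have "cinner ?d ?d = 0" unfolding cinner_diff(1) by simp
  then show ?thesis by (simp add: cinner_self)
qed

lemma orth_proj_ident: "x \<in> S \<Longrightarrow> orth_proj S x = x"
  by (rule orth_proj_unique) auto

lemma orth_proj_eq_0: "(\<And>s. s \<in> S \<Longrightarrow> cinner x s = 0) \<Longrightarrow> orth_proj S x = 0"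
  using S by (intro orth_proj_unique) (auto simp: complex_vec.subspace_def)

lemma orth_proj_selfadjoint: "cinner (orth_proj S x) y = cinner x (orth_proj S y)"
proof -
  have "cinner (orth_proj S x) (y - orth_proj S y) = 0"
    using orth_proj_orth[OF orth_proj_in, of y x] cinner_commute by (metis complex_cnj_zero)
  moreover have "cinner (x - orth_proj S x) (orth_proj S y) = 0" by (rule orth_proj_orth[OF orth_proj_in])
  ultimately show ?thesis by (simp add: cinner_diff)
qed

lemma norm_orth_proj: "norm (orth_proj S x) \<le> norm x"
proof -
  have "cinner (orth_proj S x) (orth_proj S x) = cinner x (orth_proj S x)"
    by (simp add: orth_proj_selfadjoint orth_proj_ident orth_proj_in)
  then have "(norm (orth_proj S x))\<^sup>2 \<le> norm x * norm (orth_proj S x)"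
    using cauchy_schwarz[of x "orth_proj S x"] by (metis cmod_cinner_self)
  then show ?thesis by (cases "orth_proj S x = 0") (auto simp: power2_eq_square)
qed

lemma bounded_clinear_orth_proj: "bounded_clinear (orth_proj S)"
proof (rule bounded_clinearI[where C = 1])
  show "orth_proj S (x + y) = orth_proj S x + orth_proj S y" for x y
    by (rule cinner_ext) (simp add: orth_proj_selfadjoint[symmetric] cinner_linear)
  show "orth_proj S (c *\<^sub>C x) = c *\<^sub>C orth_proj S x" for c x
    by (rule cinner_ext) (simp add: orth_proj_selfadjoint[symmetric] cinner_linear)
qed (simp add: norm_orth_proj)

end

lemma riesz_representation:
  fixes f :: "'a :: chilbert_space \<Rightarrow> complex"
  assumes f: "\<And>x y. f (x + y) = f x + f y" "\<And>c x. f (c *\<^sub>C x) = c * f x" "\<And>x. cmod (f x) \<le> C * norm x"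
  shows "\<exists>z. \<forall>x. f x = cinner z x"
proof (cases "\<forall>x. f x = 0")
  case True
  then show ?thesis by (intro exI[of _ 0]) simp
next
  case False
  have bl: "bounded_linear f"
    by (rule bounded_linear_intro[where K = C])
       (use f in \<open>simp_all add: scaleR_eq_scaleC scaleR_conv_of_real mult.commute\<close>)
  have fd: "f (x - y) = f x - f y" for x y using linear_simps(2)[OF bl] .
  let ?S = "{x. f x = 0}"
  have S: "csubspace ?S" using f linear_simps(3)[OF bl] by (simp add: complex_vec.subspace_def)
  have cl: "closed ?S"
    by (intro closed_Collect_eq linear_continuous_on[OF bl] continuous_on_const)
  obtain u where u: "f u \<noteq> 0" using False by blast
  obtain p where p: "f p = 0" "\<And>s. f s = 0 \<Longrightarrow> cinner (u - p) s = 0"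
    using complex_projection_exists[OF S cl, of u] by auto
  define v where "v = u - p"
  have fv: "f v \<noteq> 0" unfolding v_def using u p fd by simp
  then have v0: "v \<noteq> 0" using linear_simps(3)[OF bl] by auto
  have "cinner v x * f v = f x * complex_of_real ((norm v)\<^sup>2)" for x
  proof -
    have "f (f v *\<^sub>C x - f x *\<^sub>C v) = 0" by (simp add: fd f)
    from p(2)[OF this] show ?thesis unfolding v_def[symmetric] by (simp add: cinner_linear cinner_self mult.commute)
  qed
  then have "f x = cinner ((cnj (f v) / complex_of_real ((norm v)\<^sup>2)) *\<^sub>C v) x" for x
    using v0 fv by (simp add: cinner_linear field_simps)
  then show ?thesis by blast
qed

lemma adjoint_exists:
  fixes T :: "'a :: chilbert_space \<Rightarrow> 'b :: chilbert_space"
  assumes T: "bounded_clinear T"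
  obtains T' where "bounded_clinear T'" "\<And>x y. cinner (T' x) y = cinner x (T y)"
proof -
  obtain K where K: "\<And>x. norm (T x) \<le> norm x * K" "K \<ge> 0"
    using bounded_linear.nonneg_bounded[OF bounded_clinear_simps(1)[OF T]] by blast
  have "\<exists>z. \<forall>y. cinner x (T y) = cinner z y" for x
  proof (rule riesz_representation[where C = "norm x * K"])
    show "cmod (cinner x (T y)) \<le> norm x * K * norm y" for y
      using order.trans[OF cauchy_schwarz mult_left_mono[OF K(1)]] by (simp add: mult_ac)
  qed (simp_all add: bounded_clinear_simps[OF T] cinner_linear)
  then obtain T' where T': "\<And>x y. cinner (T' x) y = cinner x (T y)" by metis
  have T'2: "cinner y (T' x) = cinner (T y) x" for x y
    using T' cinner_commute by metis
  have "bounded_clinear T'"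
  proof (rule bounded_clinearI[where C = K])
    show "T' (x + y) = T' x + T' y" for x y
      by (rule cinner_ext) (simp add: T'2 cinner_linear)
    show "T' (c *\<^sub>C x) = c *\<^sub>C T' x" for c x
      by (rule cinner_ext) (simp add: T'2 cinner_linear)
    show "norm (T' x) \<le> K * norm x" for x
    proof (cases "T' x = 0")
      case False
      have "(norm (T' x))\<^sup>2 = cmod (cinner x (T (T' x)))"
        by (simp only: cmod_cinner_self[symmetric] T')
      also have "\<dots> \<le> norm x * (norm (T' x) * K)"
        using order.trans[OF cauchy_schwarz mult_left_mono[OF K(1)]] by simp
      finally show ?thesis using False by (simp add: power2_eq_square mult_ac)
    qed (use K in simp)
  qed
  then show ?thesis using that T' by blast
qed

subsection \<open>Products\<close>

text \<open>Products carry the graphs of operators in \<open>bounded_extension\<close> and the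
  doubled space of \<open>cyclic_subspace_splits\<close>.\<close>

instantiation prod :: (complex_vec, complex_vec) complex_vec
begin
definition scaleC_prod :: "complex \<Rightarrow> 'a \<times> 'b \<Rightarrow> 'a \<times> 'b" where
  "scaleC_prod c p = (c *\<^sub>C fst p, c *\<^sub>C snd p)"
instance
  by intro_classes
    (simp_all add: scaleC_prod_def scaleC_add_right scaleC_add_left scaleC_scaleC scaleC_one)
end

instance prod :: (complex_banach, complex_banach) complex_banach
proof
  fix c r and x :: "'a \<times> 'b"
  show "r *\<^sub>R x = complex_of_real r *\<^sub>C x"
    by (simp add: scaleC_prod_def scaleR_prod_def scaleR_eq_scaleC)
  have "(cmod c * norm (fst x))\<^sup>2 + (cmod c * norm (snd x))\<^sup>2 = (cmod c)\<^sup>2 * ((norm (fst x))\<^sup>2 + (norm (snd x))\<^sup>2)"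
    by (simp add: power_mult_distrib distrib_left)
  then show "norm (c *\<^sub>C x) = cmod c * norm x"
    by (simp add: scaleC_prod_def norm_prod_def norm_scaleC real_sqrt_mult)
qed

instantiation prod :: (chilbert_space, chilbert_space) chilbert_space
begin
definition cinner_prod :: "'a \<times> 'b \<Rightarrow> 'a \<times> 'b \<Rightarrow> complex" where
  "cinner_prod p q = cinner (fst p) (fst q) + cinner (snd p) (snd q)"
instance
proof
  fix x y z :: "'a \<times> 'b" and c
  show "cinner x (y + z) = cinner x y + cinner x z"
    by (simp add: cinner_prod_def cinner_linear)
  show "cinner x (c *\<^sub>C y) = c * cinner x y"
    by (simp add: cinner_prod_def cinner_linear scaleC_prod_def distrib_left)
  show "cinner x y = cnj (cinner y x)"
    by (simp add: cinner_prod_def cinner_commute[symmetric])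
  show "0 \<le> Re (cinner x x)"
    by (simp add: cinner_prod_def cinner_self_nonneg)
  show "norm x = sqrt (Re (cinner x x))"
    by (simp add: cinner_prod_def cinner_self norm_prod_def)
qed
end

lemma bounded_clinear_fst_snd: "bounded_clinear (fst :: 'a :: complex_banach \<times> 'b :: complex_banach \<Rightarrow> 'a)"
  "bounded_clinear (snd :: 'a :: complex_banach \<times> 'b :: complex_banach \<Rightarrow> 'b)"
  by (auto simp: bounded_clinear_def bounded_linear_fst bounded_linear_snd scaleC_prod_def)

subsection \<open>Construction of bounded operators from Gram matrices\<close>

text \<open>The closure \<open>G\<close> of the span of the pairs (v i, w i) is still the graph of a
  bounded map, because the bound passes to limits, and completeness of the target makes its domain
  the whole closed span \<open>V\<close> of the v i. Composing with the projection onto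
  \<open>V\<close> extends the map by 0 to the orthogonal complement.\<close>

lemma bounded_extension:
  fixes v :: "'i \<Rightarrow> 'a :: chilbert_space" and w :: "'i \<Rightarrow> 'b :: complex_banach"
  assumes bound: "\<And>I c. finite I \<Longrightarrow> I \<subseteq> J \<Longrightarrow> norm (\<Sum>i\<in>I. c i *\<^sub>C w i) \<le> C * norm (\<Sum>i\<in>I. c i *\<^sub>C v i)"
  obtains B where "bounded_clinear B" "\<And>i. i \<in> J \<Longrightarrow> B (v i) = w i"
    "\<And>x. (\<And>i. i \<in> J \<Longrightarrow> cinner x (v i) = 0) \<Longrightarrow> B x = 0"
    "\<And>x. norm (B x) \<le> \<bar>C\<bar> * norm x"
proof -
  define G where "G = closure (cspan ((\<lambda>i. (v i, w i)) ` J))"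
  have Gsub: "csubspace G" and Gcl: "closed G"
    unfolding G_def by (rule csubspace_closure_cspan) simp
  let ?Q = "{p :: 'a \<times> 'b. norm (snd p) \<le> \<bar>C\<bar> * norm (fst p)}"
  have "cspan ((\<lambda>i. (v i, w i)) ` J) \<subseteq> ?Q"
  proof
    fix p assume "p \<in> cspan ((\<lambda>i. (v i, w i)) ` J)"
    then obtain I c where I: "finite I" "I \<subseteq> J" "p = (\<Sum>i\<in>I. c i *\<^sub>C (v i, w i))"
      by (rule cspan_range_sum)
    have "fst p = (\<Sum>i\<in>I. c i *\<^sub>C v i)" "snd p = (\<Sum>i\<in>I. c i *\<^sub>C w i)"
      unfolding I(3) by (simp_all add: fst_sum snd_sum scaleC_prod_def)
    moreover have "C * norm (\<Sum>i\<in>I. c i *\<^sub>C v i) \<le> \<bar>C\<bar> * norm (\<Sum>i\<in>I. c i *\<^sub>C v i)"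
      by (intro mult_right_mono) auto
    ultimately show "p \<in> ?Q" using bound[OF I(1,2), of c] by simp
  qed
  moreover have "closed ?Q" by (intro closed_Collect_le continuous_intros)
  ultimately have "G \<subseteq> ?Q" unfolding G_def by (rule closure_minimal)
  then have GQ: "norm y \<le> \<bar>C\<bar> * norm x" if "(x, y) \<in> G" for x y
    using that by auto
  define V where "V = closure (cspan (v ` J))"
  have V: "csubspace V" "closed V" unfolding V_def by (rule csubspace_closure_cspan) simp
  have "\<exists>y. (x, y) \<in> G" if xV: "x \<in> V" for x
  proof -
    have dom: "\<exists>y. (x, y) \<in> G" if x: "x \<in> cspan (v ` J)" for x
    proof -
      obtain I c where I: "finite I" "I \<subseteq> J" "x = (\<Sum>i\<in>I. c i *\<^sub>C v i)"
        by (rule cspan_range_sum[OF x])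
      have "(\<Sum>i\<in>I. c i *\<^sub>C (v i, w i)) \<in> G"
        unfolding G_def using I(2)
        by (intro subsetD[OF closure_subset] complex_vec.span_sum complex_vec.span_scale complex_vec.span_base) auto
      then have "(fst (\<Sum>i\<in>I. c i *\<^sub>C (v i, w i)), snd (\<Sum>i\<in>I. c i *\<^sub>C (v i, w i))) \<in> G" by simp
      moreover have "fst (\<Sum>i\<in>I. c i *\<^sub>C (v i, w i)) = x"
        unfolding I(3) by (simp add: fst_sum scaleC_prod_def)
      ultimately show ?thesis by metis
    qed
    obtain s where s: "\<And>n. s n \<in> cspan (v ` J)" "s \<longlonglongrightarrow> x"
      using xV unfolding V_def closure_sequential by blast
    have "\<forall>n. \<exists>y. (s n, y) \<in> G" using dom s(1) by blast
    from choice[OF this] obtain t where t: "\<And>n. (s n, t n) \<in> G" by blast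
    have "Cauchy t"
    proof (rule CauchyI)
      fix e :: real assume e: "e > 0"
      then have e': "e / (\<bar>C\<bar> + 1) > 0" by simp
      obtain M where M: "\<And>m n. m \<ge> M \<Longrightarrow> n \<ge> M \<Longrightarrow> norm (s m - s n) < e / (\<bar>C\<bar> + 1)"
        using CauchyD[OF LIMSEQ_imp_Cauchy[OF s(2)] e'] by blast
      have "norm (t m - t n) < e" if "m \<ge> M" "n \<ge> M" for m n
      proof -
        have "(s m, t m) - (s n, t n) \<in> G" by (rule complex_vec.subspace_diff[OF Gsub t t])
        then have "norm (t m - t n) \<le> \<bar>C\<bar> * norm (s m - s n)" using GQ by simp
        also have "\<dots> \<le> (\<bar>C\<bar> + 1) * norm (s m - s n)" by (intro mult_right_mono) auto
        also have "\<dots> < e" using M[OF that] by (simp add: pos_less_divide_eq mult.commute)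
        finally show ?thesis .
      qed
      then show "\<exists>M. \<forall>m\<ge>M. \<forall>n\<ge>M. norm (t m - t n) < e" by blast
    qed
    then obtain y where "t \<longlonglongrightarrow> y" using Cauchy_convergent convergent_def by blast
    then have "(\<lambda>n. (s n, t n)) \<longlonglongrightarrow> (x, y)" using s(2) by (intro tendsto_Pair)
    then show ?thesis using closed_sequentially[OF Gcl, of "\<lambda>n. (s n, t n)"] t by blast
  qed
  then obtain b where b: "\<And>x. x \<in> V \<Longrightarrow> (x, b x) \<in> G" by metis
  have uniq: "y = y'" if "(x, y) \<in> G" "(x, y') \<in> G" for x y y'
  proof -
    have "(x, y) - (x, y') \<in> G" using Gsub that by (rule complex_vec.subspace_diff)
    then show ?thesis using GQ[of 0 "y - y'"] by simp
  qed
  define B where "B x = b (orth_proj V x)" for x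
  have BG: "(orth_proj V x, B x) \<in> G" for x
    unfolding B_def by (rule b[OF orth_proj_in[OF V]])
  have "bounded_clinear B"
  proof (rule bounded_clinearI[where C = "\<bar>C\<bar>"])
    note P = bounded_clinear_simps[OF bounded_clinear_orth_proj[OF V]]
    show "B (x + y) = B x + B y" for x y
      using complex_vec.subspace_add[OF Gsub BG[of x] BG[of y]] BG[of "x + y"]
      by (auto intro: uniq simp: P)
    show "B (c *\<^sub>C x) = c *\<^sub>C B x" for c x
      using complex_vec.subspace_scale[OF Gsub BG[of x], of c] BG[of "c *\<^sub>C x"]
      by (auto intro: uniq simp: P scaleC_prod_def)
    show "norm (B x) \<le> \<bar>C\<bar> * norm x" for x
      using order.trans[OF GQ[OF BG[of x]] mult_left_mono[OF norm_orth_proj[OF V]]] by simp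
  qed
  moreover have "B (v i) = w i" if "i \<in> J" for i
  proof -
    have "(v i, w i) \<in> G" unfolding G_def by (rule in_closure_cspan) (use that in auto)
    moreover have "orth_proj V (v i) = v i"
      by (rule orth_proj_ident[OF V]) (auto simp: V_def that intro!: in_closure_cspan)
    ultimately show ?thesis using BG[of "v i"] uniq by simp
  qed
  moreover have "B x = 0" if orth: "\<And>i. i \<in> J \<Longrightarrow> cinner x (v i) = 0" for x
  proof -
    have "cinner x s = 0" if "s \<in> V" for s
      using orthogonal_closure_cspan[of "v ` J" x s] that orth unfolding V_def by auto
    then have "orth_proj V x = 0" by (rule orth_proj_eq_0[OF V])
    then show ?thesis using BG[of x] uniq complex_vec.subspace_0[OF Gsub] by (auto simp: zero_prod_def)
  qed
  moreover have "norm (B x) \<le> \<bar>C\<bar> * norm x" for x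
    using order.trans[OF GQ[OF BG[of x]] mult_left_mono[OF norm_orth_proj[OF V]]] by simp
  ultimately show ?thesis using that by blast
qed

text \<open>Iterating \<open>conv\<close> gives (g 1 / g 0)^(2^n) <= g (2^n) / g 0 <= D * C^(2^n) /
  g 0 when g 0 > 0; for large n the constant D / g 0 cannot make up for a ratio g 1 / g 0 above
  \<open>C\<close>.\<close>

lemma dyadic_growth:
  fixes g :: "nat \<Rightarrow> real"
  assumes conv: "\<And>n. (g (2 ^ n))\<^sup>2 \<le> g (2 ^ Suc n) * g 0"
    and nonneg: "\<And>n. 0 \<le> g n" and growth: "\<And>n. g n \<le> D * C ^ n" and C: "C \<ge> 0"
  shows "g 1 \<le> C * g 0"
proof (cases "g 0 = 0")
  case True
  then show ?thesis using conv[of 0] by simp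
next
  case False
  then have g0: "g 0 > 0" using nonneg[of 0] by simp
  have D: "D \<ge> 0" using growth[of 0] g0 by simp
  have pw: "(g 1 / g 0) ^ (2 ^ n) \<le> g (2 ^ n) / g 0" for n
  proof (induction n)
    case (Suc n)
    have "(g 1 / g 0) ^ (2 ^ Suc n) = ((g 1 / g 0) ^ (2 ^ n))\<^sup>2" by (simp add: power_mult[symmetric] mult.commute)
    also have "\<dots> \<le> (g (2 ^ n) / g 0)\<^sup>2" using Suc nonneg by (intro power_mono) auto
    also have "\<dots> \<le> g (2 ^ Suc n) / g 0"
      using conv[of n] g0 by (simp add: power_divide power2_eq_square field_simps)
    finally show ?case .
  qed simp
  show ?thesis
  proof (rule ccontr)
    assume "\<not> g 1 \<le> C * g 0"
    then have lt: "C < g 1 / g 0" using g0 by (simp add: pos_less_divide_eq)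
    then have pos: "g 1 / g 0 > 0" using C by simp
    define r where "r = C / (g 1 / g 0)"
    have r: "0 \<le> r" "r < 1" unfolding r_def using lt C pos by (simp_all only: divide_nonneg_pos divide_less_eq_1_pos)
    have "1 \<le> D / g 0 * r ^ (2 ^ n)" for n
    proof -
      define p where "p = g 1 / g 0"
      have p: "p > 0" using pos unfolding p_def .
      have "p ^ (2 ^ n) \<le> D * C ^ (2 ^ n) / g 0"
        using order.trans[OF pw divide_right_mono[OF growth]] g0 unfolding p_def by simp
      then have "1 \<le> D * C ^ (2 ^ n) / g 0 / p ^ (2 ^ n)"
        using p by (simp only: pos_le_divide_eq zero_less_power mult_1)
      then show ?thesis unfolding r_def p_def[symmetric] by (simp add: power_divide)
    qed
    moreover have "(\<lambda>n. D / g 0 * r ^ (2 ^ n)) \<longlonglongrightarrow> D / g 0 * 0"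
    proof (intro tendsto_mult tendsto_const)
      have "filterlim (\<lambda>n :: nat. (2 :: nat) ^ n) at_top sequentially"
        by (rule filterlim_subseq) (simp add: strict_mono_def)
      moreover have "(\<lambda>n. r ^ n) \<longlonglongrightarrow> 0" using r by (intro LIMSEQ_power_zero) simp
      ultimately show "(\<lambda>n. r ^ (2 ^ n)) \<longlonglongrightarrow> 0" by (rule filterlim_compose[rotated])
    qed
    ultimately show False using LIMSEQ_le_const[of "\<lambda>n. D / g 0 * r ^ (2 ^ n)" 0 1] by auto
  qed
qed

text \<open>Here \<open>q\<close> plays the role of \<open>T\<^sup>*T\<close> for \<open>T v\<^sub>i = w\<^sub>i\<close>: the numbers \<open>\<langle>(T\<^sup>*T)\<^sup>m u, u\<rangle>\<close> are
  log-convex in \<open>m\<close>, so that their growth rate bounds the first quotient.\<close>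

lemma gram_inequality:
  fixes v :: "'i \<Rightarrow> 'a :: chilbert_space" and w :: "'i \<Rightarrow> 'b :: chilbert_space"
  assumes gram: "\<And>i j. i \<in> J \<Longrightarrow> j \<in> J \<Longrightarrow> cinner (w i) (w j) = cinner (v (q i)) (v j)"
    and q: "\<And>i. i \<in> J \<Longrightarrow> q i \<in> J"
    and growth: "\<And>i. i \<in> J \<Longrightarrow> \<exists>D. \<forall>m. norm (v ((q ^^ m) i)) \<le> D * C ^ m"
    and C: "C \<ge> 0" and I: "finite I" "I \<subseteq> J"
  shows "(norm (\<Sum>i\<in>I. c i *\<^sub>C w i))\<^sup>2 \<le> C * (norm (\<Sum>i\<in>I. c i *\<^sub>C v i))\<^sup>2"
proof -
  have qm: "(q ^^ m) i \<in> J" if "i \<in> J" for i m using that by (induction m) (auto intro: q)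
  have sym: "cinner (v (q i)) (v j) = cinner (v i) (v (q j))" if "i \<in> J" "j \<in> J" for i j
    using gram[OF that] gram[OF that(2,1)] cinner_commute by metis
  define u where "u m = (\<Sum>i\<in>I. c i *\<^sub>C v ((q ^^ m) i))" for m
  have shift: "cinner (u (Suc m)) (u n) = cinner (u m) (u (Suc n))" for m n
    unfolding u_def cinner_sum cinner_scaleC_left cinner_scaleC_right using I
    by (intro sum.cong refl arg_cong2[of _ _ _ _ "(*)"]) (auto simp: sym qm subset_iff)
  \<comment> \<open>Inner products of \<open>u m\<close> and \<open>u n\<close> depend only on m +
    n. Hence g (2 m) = |u m|^2, and Cauchy-Schwarz for \<open>u m\<close> and \<open>u 0\<close> is
    the convexity that \<open>dyadic_growth\<close> consumes.\<close>
  have shift': "cinner (u (m + n)) (u 0) = cinner (u m) (u n)" for m n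
  proof (induction n arbitrary: m)
    case (Suc n)
    from Suc[of "Suc m"] show ?case by (simp add: shift)
  qed simp
  define g where "g m = cmod (cinner (u m) (u 0))" for m
  have g2: "g (m + m) = (norm (u m))\<^sup>2" for m
    unfolding g_def shift' by (simp add: cinner_self norm_power)
  have "\<exists>D. \<forall>m. norm (u m) \<le> D * C ^ m"
  proof -
    obtain D where D: "\<And>i m. i \<in> J \<Longrightarrow> norm (v ((q ^^ m) i)) \<le> D i * C ^ m" using growth by metis
    have "norm (u m) \<le> (\<Sum>i\<in>I. cmod (c i) * D i) * C ^ m" for m
    proof -
      have "norm (u m) \<le> (\<Sum>i\<in>I. norm (c i *\<^sub>C v ((q ^^ m) i)))" unfolding u_def by (rule norm_sum)
      also have "\<dots> \<le> (\<Sum>i\<in>I. cmod (c i) * (D i * C ^ m))"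
        unfolding norm_scaleC using I D by (intro sum_mono mult_left_mono) auto
      finally show ?thesis by (simp add: sum_distrib_right mult.assoc)
    qed
    then show ?thesis by blast
  qed
  then obtain D where D: "\<And>m. norm (u m) \<le> D * C ^ m" by blast
  have "g 1 \<le> C * g 0"
  proof (rule dyadic_growth)
    show "(g (2 ^ n))\<^sup>2 \<le> g (2 ^ Suc n) * g 0" for n
    proof -
      have "(g (2 ^ n))\<^sup>2 \<le> (norm (u (2 ^ n)) * norm (u 0))\<^sup>2"
        unfolding g_def by (intro power_mono cauchy_schwarz) simp
      also have "\<dots> = g (2 ^ Suc n) * g 0"
        using g2[of "2 ^ n"] g2[of 0] by (simp add: power_mult_distrib mult_2)
      finally show ?thesis .
    qed
    show "g n \<le> D * norm (u 0) * C ^ n" for n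
      unfolding g_def
      using order.trans[OF cauchy_schwarz mult_right_mono[OF D norm_ge_zero], of n "u 0"] by (simp add: mult_ac)
  qed (simp_all add: g_def C)
  moreover have "g 1 = (norm (\<Sum>i\<in>I. c i *\<^sub>C w i))\<^sup>2"
  proof -
    have "cinner (u 1) (u 0) = cinner (\<Sum>i\<in>I. c i *\<^sub>C w i) (\<Sum>i\<in>I. c i *\<^sub>C w i)"
      unfolding u_def cinner_sum cinner_scaleC_left cinner_scaleC_right using I
      by (intro sum.cong refl arg_cong2[of _ _ _ _ "(*)"]) (auto simp: gram subset_iff)
    then show ?thesis unfolding g_def by (simp add: cinner_self norm_power)
  qed
  moreover have "g 0 = (norm (\<Sum>i\<in>I. c i *\<^sub>C v i))\<^sup>2"
    using g2[of 0] by (simp add: u_def)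
  ultimately show ?thesis by simp
qed

text \<open>\<open>q\<close> represents T*T on indices, so \<open>C\<close> bounds T*T and its
  square root bounds T. The constant D of the growth hypothesis may depend on the index, since only
  the rate of growth survives.\<close>

lemma operator_from_gram:
  fixes v :: "'i \<Rightarrow> 'a :: chilbert_space" and w :: "'i \<Rightarrow> 'b :: chilbert_space"
  assumes gram: "\<And>i j. i \<in> J \<Longrightarrow> j \<in> J \<Longrightarrow> cinner (w i) (w j) = cinner (v (q i)) (v j)"
    and q: "\<And>i. i \<in> J \<Longrightarrow> q i \<in> J"
    and growth: "\<And>i. i \<in> J \<Longrightarrow> \<exists>D. \<forall>m. norm (v ((q ^^ m) i)) \<le> D * C ^ m"
    and C: "C \<ge> 0"
  obtains B where "bounded_clinear B" "\<And>i. i \<in> J \<Longrightarrow> B (v i) = w i"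
    "\<And>x. (\<And>i. i \<in> J \<Longrightarrow> cinner x (v i) = 0) \<Longrightarrow> B x = 0"
    "\<And>x. norm (B x) \<le> sqrt C * norm x"
proof (rule bounded_extension[of J w "sqrt C" v])
  fix I c assume "finite I" "I \<subseteq> J"
  then show "norm (\<Sum>i\<in>I. c i *\<^sub>C w i) \<le> sqrt C * norm (\<Sum>i\<in>I. c i *\<^sub>C v i)"
    using real_sqrt_le_mono[OF gram_inequality[OF gram q growth C, of I c]]
    by (simp add: real_sqrt_mult)
next
  fix B :: "'a \<Rightarrow> 'b"
  assume B: "bounded_clinear B" "\<And>i. i \<in> J \<Longrightarrow> B (v i) = w i"
    "\<And>x. (\<And>i. i \<in> J \<Longrightarrow> cinner x (v i) = 0) \<Longrightarrow> B x = 0"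
    "\<And>x. norm (B x) \<le> \<bar>sqrt C\<bar> * norm x"
  show thesis by (rule that[OF B(1,2,3)]) (use B(4) C in simp_all)
qed

subsection \<open>Elementary C*-algebra theory\<close>


lemma star_one [simp]: "star (1 :: 'a :: cstar_algebra) = 1"
  by (metis mult_1_right mult_1_left star_mult star_star)

lemma star_zero [simp]: "star (0 :: 'a :: cstar_algebra) = 0"
  using star_add[of "0 :: 'a" 0] by simp

lemma star_minus: "star (- a) = - star (a :: 'a :: cstar_algebra)"
  using star_add[of a "- a"] by (simp add: eq_neg_iff_add_eq_0 add.commute)

lemma star_diff: "star (a - b) = star a - star (b :: 'a :: cstar_algebra)"
  using star_add[of a "- b"] by (simp add: star_minus)

lemma star_power: "star (a ^ n) = star (a :: 'a :: cstar_algebra) ^ n"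
  by (induction n) (simp_all add: star_mult power_commutes)

lemma norm_star: "norm (star a) = norm (a :: 'a :: cstar_algebra)"
proof -
  have le: "norm a \<le> norm (star a)" for a :: 'a
  proof (cases "a = 0")
    case False
    have "norm a * norm a \<le> norm (star a) * norm a"
      using cstar_identity[of a] norm_mult_ineq[of "star a" a] by (simp add: power2_eq_square)
    then show ?thesis using False by simp
  qed simp
  show ?thesis using le[of a] le[of "star a"] by (simp add: star_star)
qed

lemma norm_one_le: "norm (1 :: 'a :: cstar_algebra) \<le> 1"
proof (cases "norm (1 :: 'a) = 0")
  case False
  then show ?thesis using cstar_identity[of "1 :: 'a"] by (simp add: power2_eq_square)
qed simp

lemma norm_power_le: "norm (a ^ n) \<le> norm (a :: 'a :: cstar_algebra) ^ n"
proof (induction n)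
  case (Suc n)
  then show ?case
    using order.trans[OF norm_mult_ineq mult_left_mono[OF Suc norm_ge_zero]] by simp
qed (simp add: norm_one_le)

text \<open>The fixed points of z = 1 + y z and w = 1 + w y, supplied by the contraction principle,
  are a right and a left inverse of 1 - y and therefore agree.\<close>

lemma inverse_near_one:
  fixes y :: "'a :: cstar_algebra"
  assumes y: "norm y < 1"
  obtains z where "(1 - y) * z = 1" "z * (1 - y) = 1"
proof -
  have "dist (1 + y * u) (1 + y * v) \<le> norm y * dist u v" for u v
    using norm_mult_ineq[of y "u - v"] by (simp add: dist_norm right_diff_distrib)
  then have "\<exists>!z. 1 + y * z = z" using y by (intro banach_fix_type[where c = "norm y"]) auto
  then obtain z where z: "1 + y * z = z" by blast
  have "dist (1 + u * y) (1 + v * y) \<le> norm y * dist u v" for u v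
    using norm_mult_ineq[of "u - v" y] by (simp add: dist_norm left_diff_distrib mult.commute)
  then have "\<exists>!z. 1 + z * y = z" using y by (intro banach_fix_type[where c = "norm y"]) auto
  then obtain w where w: "1 + w * y = w" by blast
  have z1: "(1 - y) * z = 1" using z by (simp add: left_diff_distrib diff_eq_eq)
  have w1: "w * (1 - y) = 1" using w by (simp add: right_diff_distrib diff_eq_eq)
  have "w = w * ((1 - y) * z)" by (simp add: z1)
  also have "\<dots> = z" by (simp only: mult.assoc[symmetric] w1 mult_1_left)
  finally show ?thesis using that z1 w1 by simp
qed

text \<open>The Cayley transform \<open>u = (1 + ia)(1 - ia)\<^sup>-\<^sup>1\<close> is unitary and \<open>(1 - ia)\<^sup>-\<^sup>1 = (1 + u)/2\<close>.\<close>

lemma cayley: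
  fixes a :: "'a :: cstar_algebra"
  assumes a: "star a = a" and z: "(1 - \<i> *\<^sub>C a) * z = 1" "z * (1 - \<i> *\<^sub>C a) = 1"
  shows "norm z \<le> 1" "norm (z - star z) \<le> 1"
proof -
  let ?D = "1 - \<i> *\<^sub>C a" and ?D' = "1 + \<i> *\<^sub>C a"
  have D': "star ?D = ?D'" by (simp add: star_diff star_scaleC a scaleC_minus)
  have comm: "?D' * ?D = ?D * ?D'"
    by (simp add: algebra_simps scaleC_mult_left scaleC_mult_right)
  define u where "u = ?D' * z"
  have "?D + ?D' = 2 *\<^sub>C 1" using scaleC_add_left[of 1 1 "1 :: 'a"] by (simp add: scaleC_one)
  then have "(?D + ?D') * z = 2 *\<^sub>C z" by (simp only: scaleC_mult_left mult_1_left)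
  then have zu: "2 *\<^sub>C z = 1 + u" unfolding u_def by (simp only: distrib_right z(1))
  have sz: "star z * ?D' = 1" using arg_cong[OF z(1), of star] by (simp add: star_mult D')
  have "star u * u = star z * (?D * ?D') * z"
    unfolding u_def by (simp add: star_mult D'[symmetric] star_star mult.assoc)
  also have "\<dots> = (star z * ?D') * (?D * z)" by (simp only: comm[symmetric] mult.assoc)
  also have "\<dots> = 1" by (simp add: sz z)
  finally have "(norm u)\<^sup>2 = norm (1 :: 'a)" using cstar_identity[of u] by simp
  then have u: "norm u \<le> 1"
    using norm_one_le[where 'a = 'a] by (metis abs_norm_cancel abs_square_le_1)
  have "2 * norm z = norm (1 + u)" using zu norm_scaleC[of 2 z] by simp
  then show "norm z \<le> 1" using norm_triangle_ineq[of 1 u] u norm_one_le[where 'a = 'a] by simp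
  have "2 *\<^sub>C star z = 1 + star u"
    using arg_cong[OF zu, of star] by (simp only: star_scaleC star_add star_one complex_cnj_numeral)
  then have "2 *\<^sub>C (z - star z) = u - star u"
    using zu by (simp add: scaleC_diff(1))
  then have "2 * norm (z - star z) = norm (u - star u)" using norm_scaleC[of 2 "z - star z"] by simp
  then show "norm (z - star z) \<le> 1"
    using norm_triangle_ineq4[of u "star u"] u norm_star[of u] by simp
qed

text \<open>Continuation from 0 to \<open>a\<close> in n > |a| equal steps: by \<open>cayley\<close>
  every inverse met on the way has norm at most 1, so each increment, of norm |a| / n < 1, is within
  reach of \<open>inverse_near_one\<close>.\<close>

lemma resolvent_exists:
  fixes a :: "'a :: cstar_algebra"
  assumes a: "star a = a"
  obtains z where "(1 - \<i> *\<^sub>C a) * z = 1" "z * (1 - \<i> *\<^sub>C a) = 1"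
proof -
  obtain n :: nat where n: "norm a < n" using reals_Archimedean2 by blast
  then have n0: "n > 0" using norm_ge_zero[of a] by (metis gr0I not_less of_nat_0)
  define A where "A j = complex_of_real (real j / real n) *\<^sub>C a" for j
  have sA: "star (A j) = A j" for j unfolding A_def by (simp add: star_scaleC a)
  have "\<exists>z. (1 - \<i> *\<^sub>C A j) * z = 1 \<and> z * (1 - \<i> *\<^sub>C A j) = 1" for j
  proof (induction j)
    case 0
    show ?case by (rule exI[of _ 1]) (simp add: A_def)
  next
    case (Suc j)
    then obtain z where z: "(1 - \<i> *\<^sub>C A j) * z = 1" "z * (1 - \<i> *\<^sub>C A j) = 1" by blast
    define e where "e = \<i> *\<^sub>C (complex_of_real (1 / real n) *\<^sub>C a)"
    have step: "\<i> *\<^sub>C A (Suc j) = \<i> *\<^sub>C A j + e"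
      unfolding A_def e_def scaleC_add_right[symmetric] scaleC_add_left[symmetric]
      by (simp add: add_divide_distrib add.commute)
    have "norm (z * e) \<le> norm z * norm e" by (rule norm_mult_ineq)
    also have "\<dots> \<le> 1 * (norm a / n)"
      using cayley(1)[OF sA z] by (intro mult_mono) (simp_all add: e_def norm_scaleC norm_divide)
    also have "\<dots> < 1" using n n0 by simp
    finally obtain w where w: "(1 - z * e) * w = 1" "w * (1 - z * e) = 1" by (rule inverse_near_one)
    have fac: "1 - \<i> *\<^sub>C A (Suc j) = (1 - \<i> *\<^sub>C A j) * (1 - z * e)"
    proof -
      have "(1 - \<i> *\<^sub>C A j) * (1 - z * e) = (1 - \<i> *\<^sub>C A j) - ((1 - \<i> *\<^sub>C A j) * z) * e"
        by (simp add: right_diff_distrib mult.assoc)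
      then show ?thesis by (simp add: z(1) step)
    qed
    have "(1 - \<i> *\<^sub>C A (Suc j)) * (w * z) = (1 - \<i> *\<^sub>C A j) * ((1 - z * e) * w) * z"
      unfolding fac by (simp only: mult.assoc)
    moreover have "(w * z) * (1 - \<i> *\<^sub>C A (Suc j)) = w * (z * (1 - \<i> *\<^sub>C A j)) * (1 - z * e)"
      unfolding fac by (simp only: mult.assoc)
    ultimately show ?case by (intro exI[of _ "w * z"]) (simp add: w z)
  qed
  from this[of n] show ?thesis using that n0 by (auto simp: A_def scaleC_one)
qed

text \<open>1 + a^2 factors into 1 + ia and 1 - ia, whose inverses \<open>star z\<close> and z give
  r = z * star z. Moreover z - star z = 2i a r, which \<open>cayley\<close> bounds by 1; this is the
  scalar estimate |2t / (1 + t^2)| <= 1.\<close>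

lemma one_plus_square_inverse:
  fixes a :: "'a :: cstar_algebra"
  assumes a: "star a = a"
  obtains r where "r * (1 + a * a) = 1" "(1 + a * a) * r = 1" "star r = r" "norm r \<le> 1"
    "norm (2 *\<^sub>C (a * r)) \<le> 1" "\<And>x. x * a = a * x \<Longrightarrow> x * r = r * x"
proof -
  let ?D = "1 - \<i> *\<^sub>C a" and ?D' = "1 + \<i> *\<^sub>C a"
  obtain z where z: "?D * z = 1" "z * ?D = 1" using resolvent_exists[OF a] .
  have D': "star ?D = ?D'" by (simp add: star_diff star_scaleC a scaleC_minus)
  have sz: "star z * ?D' = 1" "?D' * star z = 1"
    using arg_cong[OF z(1), of star] arg_cong[OF z(2), of star] by (simp_all add: star_mult D')
  have DD: "?D' * ?D = 1 + a * a" "?D * ?D' = 1 + a * a"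
    by (simp_all add: algebra_simps scaleC_mult_left scaleC_mult_right scaleC_scaleC scaleC_minus scaleC_one)
  define r where "r = z * star z"
  have r1: "r * (1 + a * a) = 1"
    unfolding r_def DD(1)[symmetric] using sz(1) z(2) by (metis mult.assoc mult_1_right)
  have r2: "(1 + a * a) * r = 1"
    unfolding r_def DD(1)[symmetric] using sz(2) z(1) by (metis mult.assoc mult_1_left)
  have nz: "norm z \<le> 1" "norm (z - star z) \<le> 1" by (rule cayley[OF a z])+
  have "norm r \<le> norm z * norm (star z)" unfolding r_def by (rule norm_mult_ineq)
  also have "\<dots> \<le> 1" using nz(1) by (simp add: norm_star mult_le_one)
  finally have r3: "norm r \<le> 1" .
  have "z - star z = z * (?D' * star z) - (z * ?D) * star z" by (simp add: z sz)
  also have "\<dots> = z * (?D' - ?D) * star z" by (simp add: algebra_simps)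
  also have "?D' - ?D = (2 * \<i>) *\<^sub>C a" using scaleC_add_left[of \<i> \<i> a] by simp
  also have "z * ((2 * \<i>) *\<^sub>C a) * star z = (2 * \<i>) *\<^sub>C (z * a * star z)"
    by (simp add: scaleC_mult_left scaleC_mult_right)
  also have "z * a = a * z"
  proof -
    have "?D * a = a * ?D" by (simp add: algebra_simps scaleC_mult_left scaleC_mult_right)
    then have "z * (?D * a) * z = z * (a * ?D) * z" by simp
    then have "(z * ?D) * (a * z) = (z * a) * (?D * z)" by (simp only: mult.assoc)
    then show ?thesis by (simp add: z)
  qed
  finally have "norm (z - star z) = 2 * norm (a * r)"
    by (simp add: norm_scaleC norm_mult r_def mult.assoc)
  then have r4: "norm (2 *\<^sub>C (a * r)) \<le> 1" using nz(2) by (simp add: norm_scaleC)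
  have r5: "x * r = r * x" if "x * a = a * x" for x
  proof -
    have c: "x * (1 + a * a) = (1 + a * a) * x"
      using that by (simp add: distrib_left distrib_right) (metis mult.assoc)
    have "x * r = r * (1 + a * a) * x * r" by (simp add: r1)
    also have "\<dots> = r * x * ((1 + a * a) * r)" using c by (simp add: mult.assoc[symmetric]) (simp add: mult.assoc)
    finally show ?thesis by (simp add: r2)
  qed
  show ?thesis by (rule that[OF r1 r2 _ r3 r4 r5]) (simp_all add: r_def star_mult star_star)
qed

text \<open>A discrete maximum principle: the first index where a maximum above 1 is attained is
  interior and its left neighbour is strictly smaller, which contradicts \<open>conv\<close>
  there.\<close>

lemma log_convex_bounded:
  fixes g :: "nat \<Rightarrow> real"
  assumes conv: "\<And>j. 0 < j \<Longrightarrow> j < m \<Longrightarrow> (g j)\<^sup>2 \<le> g (j - 1) * g (j + 1)"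
    and nonneg: "\<And>j. 0 \<le> g j" and ends: "g 0 \<le> 1" "g m \<le> 1" and j: "j \<le> m"
  shows "g j \<le> 1"
proof (rule ccontr)
  assume "\<not> g j \<le> 1"
  define A where "A = Max (g ` {..m})"
  have A: "g i \<le> A" if "i \<le> m" for i unfolding A_def using that by (intro Max_ge) auto
  have "A \<in> g ` {..m}" unfolding A_def by (rule Max_in) auto
  then have ex: "\<exists>i. i \<le> m \<and> g i = A" by auto
  define i where "i = (LEAST i. i \<le> m \<and> g i = A)"
  have i: "i \<le> m" "g i = A" using LeastI_ex[OF ex] unfolding i_def by auto
  have A1: "A > 1" using A[OF j] \<open>\<not> g j \<le> 1\<close> by simp
  have "i \<noteq> 0" "i \<noteq> m" using i(2) ends A1 by (metis not_le)+
  then have i0: "0 < i" "i < m" using i(1) by auto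
  have "\<not> (i - 1 \<le> m \<and> g (i - 1) = A)"
    by (rule not_less_Least) (use i0 in \<open>simp add: i_def[symmetric]\<close>)
  then have "g (i - 1) \<noteq> A" using i0 by simp
  then have lt: "g (i - 1) < A" using A[of "i - 1"] i0 by (intro le_neq_trans) simp_all
  have "A\<^sup>2 \<le> g (i - 1) * g (i + 1)" using conv[OF i0] i(2) by simp
  also have "\<dots> \<le> g (i - 1) * A" using A[of "i + 1"] i0 nonneg by (intro mult_left_mono) auto
  also have "\<dots> < A * A" using lt A1 by simp
  finally show False by (simp add: power2_eq_square)
qed

text \<open>The scalar bounds |t^j / (1 + t^(2m))| <= 1 for j <= m are recovered without functional
  calculus: j = 0 and j = m come from \<open>one_plus_square_inverse\<close>, and the C*-identity
  makes the norms log-convex in j.\<close>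

lemma cutoff:
  fixes x :: "'a :: cstar_algebra"
  assumes x: "star x = x"
  obtains r where "r * (1 + x ^ m * x ^ m) = 1" "norm r \<le> 1" "x * r = r * x"
    "\<And>j. j \<le> m \<Longrightarrow> norm (x ^ j * r) \<le> 1"
proof -
  have sxm: "star (x ^ j) = x ^ j" for j by (simp add: star_power x)
  obtain r where r: "r * (1 + x ^ m * x ^ m) = 1" "(1 + x ^ m * x ^ m) * r = 1" "star r = r" "norm r \<le> 1"
    "norm (2 *\<^sub>C (x ^ m * r)) \<le> 1" "\<And>y. y * x ^ m = x ^ m * y \<Longrightarrow> y * r = r * y"
    using one_plus_square_inverse[OF sxm] by blast
  have xr: "x ^ j * r = r * x ^ j" for j
    by (rule r(6)) (simp add: power_add[symmetric] add.commute)
  have "norm (x ^ j * r) \<le> 1" if "j \<le> m" for j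
  proof (rule log_convex_bounded[where g = "\<lambda>j. norm (x ^ j * r)", OF _ _ _ _ that])
    show "norm (x ^ 0 * r) \<le> 1" using r(4) by simp
    show "norm (x ^ m * r) \<le> 1" using r(5) norm_ge_zero[of "x ^ m * r"] by (simp add: norm_scaleC)
    fix i assume i: "0 < i" "i < m"
    have "(norm (x ^ i * r))\<^sup>2 = norm (star (x ^ i * r) * (x ^ i * r))" by (rule cstar_identity[symmetric])
    also have "star (x ^ i * r) * (x ^ i * r) = r * (x ^ i * x ^ i) * r"
      by (simp add: star_mult sxm r(3) mult.assoc)
    also have "x ^ i * x ^ i = x ^ (i - 1) * x ^ (i + 1)" using i by (simp only: power_add[symmetric]) simp
    also have "r * (x ^ (i - 1) * x ^ (i + 1)) * r = (x ^ (i - 1) * r) * (x ^ (i + 1) * r)"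
      by (simp only: xr[of "i - 1"] mult.assoc)
    also have "norm \<dots> \<le> norm (x ^ (i - 1) * r) * norm (x ^ (i + 1) * r)" by (rule norm_mult_ineq)
    finally show "(norm (x ^ i * r))\<^sup>2 \<le> norm (x ^ (i - 1) * r) * norm (x ^ (i + 1) * r)" .
  qed simp
  then show ?thesis using that r(1,4) xr[of 1] by simp
qed

text \<open>With s = 1 - t the equation s^2 = 1 - c becomes t = (c + t^2) / 2. The radius p is the
  smaller root of the same equation with c replaced by its norm, so the map preserves the ball of
  radius p and contracts it by the factor p < 1. Uniqueness of the fixed point makes t
  self-adjoint.\<close>

lemma square_root_exists:
  fixes c :: "'a :: cstar_algebra"
  assumes c: "star c = c" "norm c < 1"
  obtains s w where "star s = s" "s * s = 1 - c" "s * w = 1" "w * s = 1" "star w = w"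
proof -
  define p where "p = 1 - sqrt (1 - norm c)"
  have p: "0 \<le> p" "p < 1" unfolding p_def using c by auto
  have "(1 - p)\<^sup>2 = 1 - norm c" unfolding p_def using c by simp
  then have pc: "norm c + p * p = 2 * p" by (simp add: power2_eq_square algebra_simps)
  define f where "f t = (1/2) *\<^sub>R (c + t * t)" for t
  have "\<exists>!t. t \<in> cball 0 p \<and> f t = t"
  proof (rule Banach_fix)
    show "f ` cball 0 p \<subseteq> cball 0 p"
    proof clarsimp
      fix t :: 'a assume t: "norm t \<le> p"
      have "norm (c + t * t) \<le> norm c + norm t * norm t"
        by (intro order.trans[OF norm_triangle_ineq] add_left_mono norm_mult_ineq)
      also have "\<dots> \<le> norm c + p * p" using t p by (intro add_left_mono mult_mono) auto
      finally show "norm (f t) \<le> p" unfolding f_def using pc by simp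
    qed
    fix t u :: 'a assume tu: "t \<in> cball 0 p" "u \<in> cball 0 p"
    have "f t - f u = (1/2) *\<^sub>R ((t - u) * t + u * (t - u))"
      unfolding f_def by (simp add: algebra_simps)
    also have "norm \<dots> \<le> (norm (t - u) * norm t + norm u * norm (t - u)) / 2"
      using norm_triangle_mono[OF norm_mult_ineq norm_mult_ineq, of "t - u" t u "t - u"] by simp
    also have "\<dots> \<le> (norm (t - u) * p + p * norm (t - u)) / 2"
      using tu by (intro divide_right_mono add_mono mult_left_mono mult_right_mono) auto
    finally show "dist (f t) (f u) \<le> p * dist t u" by (simp add: dist_norm mult.commute)
  qed (use p in \<open>auto simp: complete_eq_closed\<close>)
  then obtain t where "t \<in> cball 0 p \<and> f t = t" "\<forall>u. u \<in> cball 0 p \<and> f u = u \<longrightarrow> u = t"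
    by (rule ex1E)
  then have t: "norm t \<le> p" "f t = t" and uniq: "\<And>u. norm u \<le> p \<Longrightarrow> f u = u \<Longrightarrow> u = t"
    unfolding mem_cball_0 by blast+
  have "star (f t) = f (star t)"
    unfolding f_def by (simp add: scaleR_eq_scaleC star_scaleC star_add star_mult c)
  then have st: "star t = t" using uniq[of "star t"] t by (simp add: norm_star)
  have tt: "t + t = c + t * t"
  proof -
    have "t + t = f t + f t" by (simp add: t(2))
    also have "\<dots> = c + t * t" unfolding f_def by (simp add: scaleR_add_left[symmetric])
    finally show ?thesis .
  qed
  obtain w where w: "(1 - t) * w = 1" "w * (1 - t) = 1" using inverse_near_one[of t] t p by auto
  show ?thesis
  proof (rule that[of "1 - t" w])
    show "(1 - t) * (1 - t) = 1 - c" using tt by (simp add: algebra_simps)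
    have "star w * (1 - t) = 1" using arg_cong[OF w(1), of star] by (simp add: star_mult star_diff st)
    then have "star w = star w * ((1 - t) * w)" by (simp add: w)
    also have "\<dots> = w" by (simp only: mult.assoc[symmetric] \<open>star w * (1 - t) = 1\<close> mult_1_left)
    finally show "star w = w" .
  qed (simp_all add: star_diff st w)
qed

subsection \<open>The predual\<close>

lemma predual_functional:
  assumes "\<omega> \<in> (predual :: ('a :: wstar_algebra \<Rightarrow> complex) set)"
  shows "\<omega> (x + y) = \<omega> x + \<omega> y" "\<omega> (c *\<^sub>C x) = c * \<omega> x" "bounded_linear \<omega>"
    "\<omega> (x - y) = \<omega> x - \<omega> y" "\<omega> 0 = 0" "cmod (\<omega> x) \<le> onorm \<omega> * norm x" "0 \<le> onorm \<omega>"
proof -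
  have "bounded_clinear_functional \<omega>" using is_predual_predual assms unfolding is_predual_def by blast
  then obtain C where f: "\<And>x y. \<omega> (x + y) = \<omega> x + \<omega> y" "\<And>c x. \<omega> (c *\<^sub>C x) = c * \<omega> x"
    "\<And>x. cmod (\<omega> x) \<le> C * norm x"
    unfolding bounded_clinear_functional_def by blast
  show bl: "bounded_linear \<omega>"
    by (rule bounded_linear_intro[where K = C])
       (use f in \<open>simp_all add: scaleR_eq_scaleC scaleR_conv_of_real mult.commute\<close>)
  show "\<omega> (x + y) = \<omega> x + \<omega> y" "\<omega> (c *\<^sub>C x) = c * \<omega> x" by fact+
  show "\<omega> (x - y) = \<omega> x - \<omega> y" "\<omega> 0 = 0" using linear_simps[OF bl] by auto
  show "cmod (\<omega> x) \<le> onorm \<omega> * norm x" by (rule onorm[OF bl])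
  show "0 \<le> onorm \<omega>" by (rule onorm_pos_le[OF bl])
qed

lemma predual_zero: "(\<lambda>x. 0) \<in> predual"
  using is_predual_predual unfolding is_predual_def by blast

lemma predual_sum:
  assumes "\<omega> \<in> (predual :: ('a :: wstar_algebra \<Rightarrow> complex) set)"
  shows "\<omega> (\<Sum>i\<in>I. f i) = (\<Sum>i\<in>I. \<omega> (f i))"
  using predual_functional(3)[OF assms] by (simp add: linear_sum bounded_linear.linear)

lemma norm_le_of_predual:
  fixes a :: "'a :: wstar_algebra"
  assumes "\<And>\<omega>. \<omega> \<in> predual \<Longrightarrow> (\<And>x. cmod (\<omega> x) \<le> norm x) \<Longrightarrow> cmod (\<omega> a) \<le> C"
  shows "norm a \<le> C"
proof -
  have "norm a = (SUP f\<in>{f\<in>predual. \<forall>x. cmod (f x) \<le> norm x}. cmod (f a))"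
    using is_predual_predual unfolding is_predual_def by blast
  also have "\<dots> \<le> C" using assms predual_zero by (intro cSUP_least) (auto intro!: exI[of _ "\<lambda>x. 0"])
  finally show ?thesis .
qed

lemma predual_separates:
  fixes a :: "'a :: wstar_algebra"
  assumes "\<And>\<omega>. \<omega> \<in> predual \<Longrightarrow> \<omega> a = \<omega> b"
  shows "a = b"
proof -
  have "norm (a - b) \<le> 0"
    using assms by (intro norm_le_of_predual) (simp add: predual_functional)
  then show ?thesis by simp
qed

text \<open>Banach-Alaoglu in filter form. Evaluation at the predual sends the ball into a product
  of discs, where a cluster point \<open>L\<close> exists; it is linear and bounded on the predual,
  and the last clause of \<open>is_predual\<close> represents it by an element of the
  algebra.\<close>

lemma weak_star_compactness:
  fixes F :: "'a :: wstar_algebra filter"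
  assumes F: "F \<noteq> bot" "eventually (\<lambda>a. norm a \<le> C) F"
  obtains a G where "G \<le> F" "G \<noteq> bot" "\<And>\<omega>. \<omega> \<in> predual \<Longrightarrow> (\<omega> \<longlongrightarrow> \<omega> a) G"
proof -
  \<comment> \<open>Coordinates outside the predual are set to 0, so that the product may run over
    all functions on the algebra.\<close>
  define e :: "'a \<Rightarrow> ('a \<Rightarrow> complex) \<Rightarrow> complex" where "e a f = (if f \<in> predual then f a else 0)" for a f
  define S where "S = (\<Pi>\<^sub>E f\<in>UNIV. cball (0 :: complex) (if f \<in> (predual :: ('a \<Rightarrow> complex) set) then onorm f * C else 0))"
  have "compactin (product_topology (\<lambda>i. euclidean) UNIV) S"
    unfolding S_def compactin_PiE by (simp add: compactin_euclidean_iff)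
  then have "compact S" by (simp add: euclidean_product_topology compactin_euclidean_iff)
  have "cmod (f a) \<le> onorm f * C" if "f \<in> predual" "norm a \<le> C" for f and a :: 'a
    using order.trans[OF predual_functional(6) mult_left_mono] predual_functional(7) that by blast
  then have eS: "e a \<in> S" if "norm a \<le> C" for a
    unfolding S_def e_def using that by (auto simp: PiE_iff extensional_def)
  have "filtermap e F \<noteq> bot" using F by (simp add: filtermap_bot_iff)
  moreover have "eventually (\<lambda>x. x \<in> S) (filtermap e F)"
    using F(2) eS by (auto simp: eventually_filtermap elim: eventually_mono)
  ultimately obtain L where L: "inf (nhds L) (filtermap e F) \<noteq> bot"
    using \<open>compact S\<close> unfolding compact_filter by blast
  \<comment> \<open>A refinement of \<open>F\<close> along which the evaluations converge to
    \<open>L\<close>.\<close>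
  define G where "G = inf F (filtercomap e (nhds L))"
  have GF: "G \<le> F" unfolding G_def by simp
  have G: "G \<noteq> bot"
  proof
    assume "G = bot"
    then have "eventually (\<lambda>x. False) G" by simp
    then obtain P Q where PQ: "eventually P F" "eventually Q (nhds L)" "\<And>x. P x \<Longrightarrow> Q (e x) \<Longrightarrow> False"
      unfolding G_def eventually_inf eventually_filtercomap by metis
    have "eventually (\<lambda>y. \<exists>x. y = e x \<and> P x) (filtermap e F)"
      unfolding eventually_filtermap using PQ(1) by (auto elim: eventually_mono)
    then have "eventually (\<lambda>x. False) (inf (nhds L) (filtermap e F))"
      unfolding eventually_inf using PQ(2,3) by blast
    then show False using L by (simp add: trivial_limit_def)
  qed
  have eL: "filterlim e (nhds L) G"
    unfolding G_def filterlim_def filtermap_le_iff_le_filtercomap by simp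
  have lim: "(f \<longlongrightarrow> L f) G" if "f \<in> predual" for f
  proof -
    have "continuous_on UNIV (\<lambda>x :: ('a \<Rightarrow> complex) \<Rightarrow> complex. x f)" by (rule continuous_on_product_coordinates)
    from continuous_on_tendsto_compose[OF this eL] show ?thesis using that by (simp add: e_def)
  qed
  have FC: "eventually (\<lambda>a. norm a \<le> C) G" using F(2) GF filter_leD by blast
  have "\<exists>a. \<forall>f\<in>predual. L f = f a"
  proof -
    have cl: "\<forall>L C. (\<forall>f\<in>predual. \<forall>g\<in>predual. L (\<lambda>x. f x + g x) = L f + L g) \<and>
            (\<forall>c. \<forall>f\<in>predual. L (\<lambda>x. c * f x) = c * L f) \<and>
            (\<forall>f\<in>predual. \<forall>K\<ge>0. (\<forall>x :: 'a. cmod (f x) \<le> K * norm x) \<longrightarrow> cmod (L f) \<le> C * K)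
        \<longrightarrow> (\<exists>a. \<forall>f\<in>predual. L f = f a)"
      and add: "\<And>f g. f \<in> predual \<Longrightarrow> g \<in> predual \<Longrightarrow> (\<lambda>x :: 'a. f x + g x) \<in> predual"
      and scale: "\<And>c f. f \<in> predual \<Longrightarrow> (\<lambda>x :: 'a. c * f x) \<in> predual"
      using is_predual_predual unfolding is_predual_def by blast+
    have "L (\<lambda>x. f x + g x) = L f + L g" if "f \<in> predual" "g \<in> predual" for f g
      using lim[OF add[OF that]] tendsto_add[OF lim[OF that(1)] lim[OF that(2)]] G tendsto_unique by blast
    moreover have "L (\<lambda>x. c * f x) = c * L f" if "f \<in> predual" for c f
      using lim[OF scale[OF that]] tendsto_mult[OF tendsto_const lim[OF that]] G tendsto_unique by blast
    moreover have "cmod (L f) \<le> C * K" if f: "f \<in> predual" "K \<ge> 0" "\<forall>x. cmod (f x) \<le> K * norm x" for f K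
    proof (rule tendsto_upperbound[OF tendsto_norm[OF lim[OF f(1)]] _ G])
      show "eventually (\<lambda>a. cmod (f a) \<le> C * K) G"
        using FC
      proof (rule eventually_mono)
        fix a :: 'a assume "norm a \<le> C"
        then have "K * norm a \<le> K * C" using f(2) by (intro mult_left_mono)
        then have "K * norm a \<le> C * K" by (simp only: mult.commute)
        then show "cmod (f a) \<le> C * K" using f(3) order.trans by blast
      qed
    qed
    ultimately show ?thesis using cl[rule_format, of L C] by blast
  qed
  then obtain a where "\<And>f. f \<in> predual \<Longrightarrow> L f = f a" by blast
  then show ?thesis using that[OF GF G, of a] lim by simp
qed

subsection \<open>Normal representations\<close>

text \<open>For T : v i -> v (act a i), the index map of T*T is \<open>act (star a * a)\<close>. The
  bound on the diagonal coefficients makes its m-th iterate grow at most like the m-th power of the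
  norm of star a * a, and \<open>gram_inequality\<close> keeps only that rate. The three uses are
  \<open>\<pi>\<close>, the left action on each tensor power, and the left action on the Fock
  space.\<close>

lemma action_contractive:
  fixes v :: "'i \<Rightarrow> 'a :: chilbert_space" and act :: "'m :: cstar_algebra \<Rightarrow> 'i \<Rightarrow> 'i"
  assumes J: "\<And>a i. i \<in> J \<Longrightarrow> act a i \<in> J"
    and mult: "\<And>a b i. i \<in> J \<Longrightarrow> act (a * b) i = act a (act b i)"
    and one: "\<And>i. i \<in> J \<Longrightarrow> act 1 i = i"
    and adj: "\<And>a i j. i \<in> J \<Longrightarrow> j \<in> J \<Longrightarrow> cinner (v (act a i)) (v j) = cinner (v i) (v (act (star a) j))"
    and bound: "\<And>i. i \<in> J \<Longrightarrow> \<exists>D. \<forall>a. cmod (cinner (v i) (v (act a i))) \<le> D * norm a"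
    and I: "finite I" "I \<subseteq> J"
  shows "norm (\<Sum>i\<in>I. c i *\<^sub>C v (act a i)) \<le> norm a * norm (\<Sum>i\<in>I. c i *\<^sub>C v i)"
proof -
  let ?b = "star a * a"
  have "(norm (\<Sum>i\<in>I. c i *\<^sub>C v (act a i)))\<^sup>2 \<le> norm ?b * (norm (\<Sum>i\<in>I. c i *\<^sub>C v i))\<^sup>2"
  proof (rule gram_inequality[where q = "act ?b" and J = J])
    show "cinner (v (act a i)) (v (act a j)) = cinner (v (act ?b i)) (v j)" if "i \<in> J" "j \<in> J" for i j
      using adj[OF J[OF that(1), of a] that(2), of "star a"] that
      by (simp add: mult star_star)
    show "\<exists>D. \<forall>m. norm (v ((act ?b ^^ m) i)) \<le> D * norm ?b ^ m" if i: "i \<in> J" for i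
    proof -
      obtain D where D: "\<And>a. cmod (cinner (v i) (v (act a i))) \<le> D * norm a" using bound[OF i] by blast
      have "norm (v ((act ?b ^^ m) i)) \<le> sqrt \<bar>D\<bar> * norm ?b ^ m" for m
      proof -
        let ?p = "?b ^ m"
        have pm: "(act ?b ^^ m) i = act ?p i" using i by (induction m) (simp_all add: one mult[symmetric])
        have "(norm (v (act ?p i)))\<^sup>2 = cmod (cinner (v (act ?p i)) (v (act ?p i)))"
          by (rule cmod_cinner_self[symmetric])
        also have "\<dots> = cmod (cinner (v i) (v (act (star ?p * ?p) i)))"
          using adj[OF i J[OF i]] by (simp only: mult[OF i])
        also have "\<dots> \<le> D * norm (star ?p * ?p)" by (rule D)
        also have "\<dots> \<le> \<bar>D\<bar> * (norm ?b ^ m)\<^sup>2"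
          unfolding cstar_identity[of ?p] by (intro mult_mono power_mono norm_power_le) auto
        finally have "sqrt ((norm (v (act ?p i)))\<^sup>2) \<le> sqrt (\<bar>D\<bar> * (norm ?b ^ m)\<^sup>2)"
          by (rule real_sqrt_le_mono)
        then show ?thesis unfolding pm by (simp add: real_sqrt_mult)
      qed
      then show ?thesis by blast
    qed
  qed (use I J in auto)
  also have "\<dots> = (norm a * norm (\<Sum>i\<in>I. c i *\<^sub>C v i))\<^sup>2"
    by (simp add: cstar_identity power_mult_distrib)
  finally show ?thesis by (rule power2_le_imp_le) simp
qed

section \<open>Faithful normal representations are isometric\<close>

locale faithful_rep =
  fixes \<pi> :: "'m :: wstar_algebra \<Rightarrow> 'h \<Rightarrow> 'h :: chilbert_space"
  assumes normal: "normal_representation \<pi>" and faithful: "inj \<pi>"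
begin

lemma pi_simps:
  "bounded_clinear (\<pi> a)" "\<pi> (a + b) h = \<pi> a h + \<pi> b h" "\<pi> (c *\<^sub>C a) h = c *\<^sub>C \<pi> a h"
  "\<pi> (a * b) h = \<pi> a (\<pi> b h)"
  using normal by (simp_all add: normal_representation_def)

lemma pi_adjoint: "cinner (\<pi> (star a) h) k = cinner h (\<pi> a k)"
  using normal by (simp add: normal_representation_def)

lemma pi_adjoint': "cinner (\<pi> a h) k = cinner h (\<pi> (star a) k)"
  using pi_adjoint[of "star a" h k] by (simp add: star_star)

lemma pi_diff: "\<pi> (a - b) h = \<pi> a h - \<pi> b h"
  using pi_simps(2)[of "a - b" b h] by simp

lemma pi_zero: "\<pi> 0 h = 0"
  using pi_diff[of 0 0 h] by simp

lemma pi_one: "\<pi> 1 h = h"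
proof (rule bounded_clinear_eq_on_closure[where G = "{\<pi> a h | a h. True}"])
  show "\<pi> 1 x = x" if "x \<in> {\<pi> a h | a h. True}" for x
    using that by (auto simp: pi_simps(4)[symmetric])
  have "closure (cspan {\<pi> a h | a h. True}) = UNIV"
    using normal unfolding normal_representation_def by (elim conjE)
  then show "h \<in> closure (cspan {\<pi> a h | a h. True})" by simp
qed (rule pi_simps bounded_clinear_ident)+

lemma pi_sum: "\<pi> (\<Sum>i\<in>I. f i) h = (\<Sum>i\<in>I. \<pi> (f i) h)"
  by (induction I rule: infinite_finite_induct) (simp_all add: pi_simps pi_zero)

lemma vector_functional: "(\<lambda>a. cinner h (\<pi> a k)) \<in> predual"
proof -
  let ?f = "\<lambda>x n. if n = (0 :: nat) then x else (0 :: 'h)"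
  have "summable (\<lambda>n. (norm (?f x n))\<^sup>2)" for x
    by (rule summable_finite[of "{0}"]) auto
  moreover have "\<forall>h k :: nat \<Rightarrow> 'h. summable (\<lambda>n. (norm (h n))\<^sup>2) \<and> summable (\<lambda>n. (norm (k n))\<^sup>2)
        \<longrightarrow> (\<lambda>a. \<Sum>n. cinner (h n) (\<pi> a (k n))) \<in> predual"
    using normal unfolding normal_representation_def by (elim conjE)
  ultimately have "(\<lambda>a. \<Sum>n. cinner (?f h n) (\<pi> a (?f k n))) \<in> predual" by simp
  moreover have "(\<Sum>n. cinner (?f h n) (\<pi> a (?f k n))) = cinner h (\<pi> a k)" for a
    by (subst suminf_finite[of "{0}"]) auto
  ultimately show ?thesis by simp
qed

lemma pi_inject: "(\<And>h k. cinner h (\<pi> a k) = cinner h (\<pi> b k)) \<Longrightarrow> a = b"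
  by (rule injD[OF faithful], rule ext, rule cinner_ext) simp

lemma pi_contractive: "norm (\<pi> a h) \<le> norm a * norm h"
proof -
  have "norm (\<Sum>i\<in>{h}. 1 *\<^sub>C \<pi> a i) \<le> norm a * norm (\<Sum>i\<in>{h}. 1 *\<^sub>C i)"
  proof (rule action_contractive[where J = UNIV and act = \<pi> and v = "\<lambda>h. h"])
    show "\<exists>D. \<forall>a. cmod (cinner i (\<pi> a i)) \<le> D * norm a" for i
      using predual_functional(6)[OF vector_functional] by blast
  qed (simp_all add: pi_simps pi_one pi_adjoint')
  then show ?thesis by (simp add: scaleC_one)
qed

text \<open>Every subfilter has a weak* cluster point by compactness, and its matrix coefficients
  are the given limits; faithfulness then makes all cluster points equal, which forces
  convergence.\<close>

lemma weak_star_convergent: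
  fixes a :: "nat \<Rightarrow> 'm"
  assumes bound: "\<And>n. norm (a n) \<le> C"
    and conv: "\<And>h k. convergent (\<lambda>n. cinner h (\<pi> (a n) k))"
  shows "\<exists>c. \<forall>\<omega>\<in>predual. (\<lambda>n. \<omega> (a n)) \<longlonglongrightarrow> \<omega> c"
proof -
  obtain L where L: "\<And>h k. (\<lambda>n. cinner h (\<pi> (a n) k)) \<longlonglongrightarrow> L h k"
    using conv unfolding convergent_def by metis
  have cluster: "\<exists>c G. G \<noteq> bot \<and> G \<le> filtermap a F \<and> (\<forall>\<omega>\<in>predual. (\<omega> \<longlongrightarrow> \<omega> c) G) \<and>
      (\<forall>h k. cinner h (\<pi> c k) = L h k)" if F: "F \<noteq> bot" "F \<le> sequentially" for F
  proof -
    have "filtermap a F \<noteq> bot" "eventually (\<lambda>x. norm x \<le> C) (filtermap a F)"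
      using F(1) bound by (simp_all add: filtermap_bot_iff eventually_filtermap)
    then obtain c G where G: "G \<le> filtermap a F" "G \<noteq> bot" "\<And>\<omega>. \<omega> \<in> predual \<Longrightarrow> (\<omega> \<longlongrightarrow> \<omega> c) G"
      using weak_star_compactness by metis
    have "cinner h (\<pi> c k) = L h k" for h k
    proof (rule tendsto_unique[OF G(2) G(3)[OF vector_functional]])
      have "((\<lambda>n. cinner h (\<pi> (a n) k)) \<longlongrightarrow> L h k) F" using L F(2) tendsto_mono by blast
      then have "((\<lambda>x. cinner h (\<pi> x k)) \<longlongrightarrow> L h k) (filtermap a F)" by (simp add: filterlim_filtermap)
      then show "((\<lambda>x. cinner h (\<pi> x k)) \<longlongrightarrow> L h k) G" using G(1) tendsto_mono by blast
    qed
    then show ?thesis using G by blast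
  qed
  obtain c where c: "\<And>h k. cinner h (\<pi> c k) = L h k"
    using cluster[of sequentially] by auto
  have "(\<lambda>n. \<omega> (a n)) \<longlonglongrightarrow> \<omega> c" if \<omega>: "\<omega> \<in> predual" for \<omega>
  proof (rule ccontr)
    assume "\<not> (\<lambda>n. \<omega> (a n)) \<longlonglongrightarrow> \<omega> c"
    then obtain e where e: "e > 0" "\<not> eventually (\<lambda>n. dist (\<omega> (a n)) (\<omega> c) < e) sequentially"
      unfolding tendsto_iff by blast
    \<comment> \<open>The part of the sequence on which \<open>\<omega>\<close> stays away from its
      expected limit; a cluster point along it must again be \<open>c\<close>.\<close>
    define F where "F = inf sequentially (principal {n. dist (\<omega> (a n)) (\<omega> c) \<ge> e})"
    have "F \<noteq> bot"
    proof
      assume "F = bot"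
      then have "eventually (\<lambda>n. dist (\<omega> (a n)) (\<omega> c) \<ge> e \<longrightarrow> False) sequentially"
        unfolding F_def trivial_limit_def eventually_inf_principal by simp
      then show False using e(2) by (simp add: not_le)
    qed
    moreover have "F \<le> sequentially" unfolding F_def by simp
    ultimately obtain c' G where G: "G \<noteq> bot" "G \<le> filtermap a F"
      "\<And>\<omega>. \<omega> \<in> predual \<Longrightarrow> (\<omega> \<longlongrightarrow> \<omega> c') G" "\<And>h k. cinner h (\<pi> c' k) = L h k"
      using cluster by blast
    have "c' = c" by (rule pi_inject) (simp add: G c)
    then have "eventually (\<lambda>x. dist (\<omega> x) (\<omega> c) < e) G"
      using G(3)[OF \<omega>] e(1) tendstoD by blast
    moreover have "eventually (\<lambda>x. dist (\<omega> x) (\<omega> c) \<ge> e) (filtermap a F)"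
      unfolding eventually_filtermap F_def eventually_inf_principal by simp
    then have "eventually (\<lambda>x. dist (\<omega> x) (\<omega> c) \<ge> e) G" using G(2) filter_leD by blast
    ultimately have "eventually (\<lambda>x. False) G" by eventually_elim simp
    then show False using G(1) by (simp add: trivial_limit_def)
  qed
  then show ?thesis by blast
qed

text \<open>For self-adjoint \<open>b\<close> with \<open>\<parallel>\<pi>(b)\<parallel> < s\<close>, the cut-offs \<open>b(1 + (b/s)\<^sup>2\<^sup>m)\<^sup>-\<^sup>1\<close> have norm at
  most \<open>s\<close> and converge to \<open>b\<close> weak*.\<close>

lemma norm_le_pi_self_adjoint:
  assumes b: "star b = b" and \<rho>: "0 \<le> \<rho>" "\<And>h. norm (\<pi> b h) \<le> \<rho> * norm h" and s: "\<rho> < s"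
  shows "norm b \<le> s"
proof -
  have s0: "s > 0" using \<rho> s by simp
  define x where "x = complex_of_real (1 / s) *\<^sub>C b"
  have bx: "b = complex_of_real s *\<^sub>C x" unfolding x_def using s0 by (simp add: scaleC_scaleC scaleC_one)
  have "star x = x" unfolding x_def by (simp add: star_scaleC b)
  then have "\<exists>r. r * (1 + x ^ m * x ^ m) = 1 \<and> norm r \<le> 1 \<and> x * r = r * x \<and>
      (\<forall>j. j \<le> m \<longrightarrow> norm (x ^ j * r) \<le> 1)" for m
    using cutoff[of x m] by metis
  then obtain r where r: "\<And>m. r m * (1 + x ^ m * x ^ m) = 1" "\<And>m j. j \<le> m \<Longrightarrow> norm (x ^ j * r m) \<le> 1"
    by metis
  have pix: "norm (\<pi> (x ^ j) h) \<le> (\<rho> / s) ^ j * norm h" for j h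
  proof (induction j arbitrary: h)
    case (Suc j)
    have "\<pi> (x ^ Suc j) h = \<pi> (x ^ j) (\<pi> x h)" by (simp only: power_Suc2 pi_simps(4))
    also have "norm \<dots> \<le> (\<rho> / s) ^ j * norm (\<pi> x h)" by (rule Suc)
    also have "\<dots> \<le> (\<rho> / s) ^ j * (\<rho> / s * norm h)"
      using \<rho> s0 by (intro mult_left_mono)
        (simp_all add: x_def pi_simps norm_scaleC norm_divide divide_right_mono)
    finally show ?case by (simp add: mult_ac)
  qed (simp add: pi_one)
  \<comment> \<open>The cut-off has order \<open>Suc m\<close> so that the bound of
    \<open>cutoff\<close> for the exponent 1 is always available.\<close>
  define a where "a m = b * r (Suc m)" for m
  have na: "norm (a m) \<le> s" for m
    using r(2)[of 1 "Suc m"] s0 unfolding a_def bx by (simp add: scaleC_mult_left norm_scaleC)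
  have lim: "(\<lambda>m. cinner h (\<pi> (a m) k)) \<longlonglongrightarrow> cinner h (\<pi> b k)" for h k
  proof -
    have q: "0 \<le> \<rho> / s" "\<rho> / s < 1" using \<rho> s s0 by auto
    have "cmod (cinner h (\<pi> (a m) k) - cinner h (\<pi> b k)) \<le> (\<rho> / s) ^ m * (norm h * s * norm k)" for m
    proof -
      let ?c = "x ^ Suc m"
      \<comment> \<open>The error b - a m equals a m * ?c * ?c, and ?c is represented with norm at
        most (\<rho> / s)^(m + 1).\<close>
      have "b * (r (Suc m) * (1 + ?c * ?c)) = a m + a m * (?c * ?c)"
        unfolding a_def by (simp only: distrib_left mult_1_right mult.assoc)
      then have "b = a m + a m * (?c * ?c)" by (simp only: r(1) mult_1_right)
      then have "\<pi> b k = \<pi> (a m + a m * (?c * ?c)) k" by simp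
      then have "\<pi> b k - \<pi> (a m) k = \<pi> (a m) (\<pi> ?c (\<pi> ?c k))"
        by (simp only: pi_simps) simp
      then have "norm (\<pi> b k - \<pi> (a m) k) \<le> s * norm (\<pi> ?c (\<pi> ?c k))"
        using order.trans[OF pi_contractive mult_right_mono[OF na norm_ge_zero]] by simp
      also have "norm (\<pi> ?c (\<pi> ?c k)) \<le> (\<rho> / s) ^ Suc m * ((\<rho> / s) ^ Suc m * norm k)"
        using zero_le_power[OF q(1), of "Suc m"] by (intro order.trans[OF pix mult_left_mono] pix)
      also have "\<dots> \<le> (\<rho> / s) ^ m * (1 * norm k)"
        using q by (intro mult_mono power_decreasing power_le_one mult_right_mono mult_nonneg_nonneg
            zero_le_power norm_ge_zero) simp_all
      finally have "norm (\<pi> b k - \<pi> (a m) k) \<le> s * ((\<rho> / s) ^ m * norm k)" using s0 by simp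
      then have "norm h * norm (\<pi> b k - \<pi> (a m) k) \<le> norm h * (s * ((\<rho> / s) ^ m * norm k))"
        by (intro mult_left_mono) auto
      then have "cmod (cinner h (\<pi> b k - \<pi> (a m) k)) \<le> norm h * (s * ((\<rho> / s) ^ m * norm k))"
        using cauchy_schwarz order.trans by blast
      then show ?thesis by (simp add: cinner_diff norm_minus_commute mult_ac)
    qed
    then have "\<forall>\<^sub>F m in sequentially. norm (cinner h (\<pi> (a m) k) - cinner h (\<pi> b k))
        \<le> (\<rho> / s) ^ m * (norm h * s * norm k)" by simp
    moreover have "(\<lambda>m. (\<rho> / s) ^ m * (norm h * s * norm k)) \<longlonglongrightarrow> 0"
      using q by (intro tendsto_mult_left_zero LIMSEQ_power_zero) simp
    ultimately show ?thesis
      by (rule LIM_zero_cancel[OF Lim_null_comparison])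
  qed
  obtain c where c: "\<And>\<omega>. \<omega> \<in> predual \<Longrightarrow> (\<lambda>n. \<omega> (a n)) \<longlonglongrightarrow> \<omega> c"
    using weak_star_convergent[OF na convergentI[OF lim]] by blast
  have "c = b"
    using c[OF vector_functional] lim LIMSEQ_unique by (intro pi_inject) blast
  show ?thesis
  proof (rule norm_le_of_predual)
    fix \<omega> :: "'m \<Rightarrow> complex" assume \<omega>: "\<omega> \<in> predual" "\<And>x. cmod (\<omega> x) \<le> norm x"
    have "(\<lambda>n. cmod (\<omega> (a n))) \<longlonglongrightarrow> cmod (\<omega> b)" using c[OF \<omega>(1)] \<open>c = b\<close> tendsto_norm by blast
    then show "cmod (\<omega> b) \<le> s"
      by (rule LIMSEQ_le_const2) (use \<omega>(2) na order.trans in blast)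
  qed
qed

text \<open>The bound on the form passes to the operators of \<open>a\<close> and
  \<open>star a\<close>, so star a * a is represented with norm at most C^2, and the C*-identity
  finishes. With \<open>pi_contractive\<close> this lets every norm estimate in the algebra be made
  on the Hilbert space.\<close>

lemma norm_le_pi:
  assumes C: "0 \<le> C" "\<And>h k. cmod (cinner h (\<pi> a k)) \<le> C * norm h * norm k"
  shows "norm a \<le> C"
proof -
  have n1: "norm (\<pi> a k) \<le> C * norm k" for k
  proof (cases "\<pi> a k = 0")
    case False
    have "norm (\<pi> a k) * norm (\<pi> a k) \<le> C * norm (\<pi> a k) * norm k"
      using C(2)[of "\<pi> a k" k] by (simp add: cmod_cinner_self power2_eq_square)
    then show ?thesis using False by (simp add: mult_ac)
  qed (use C in simp)
  have n2: "norm (\<pi> (star a) k) \<le> C * norm k" for k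
  proof (cases "\<pi> (star a) k = 0")
    case False
    have "norm (\<pi> (star a) k) * norm (\<pi> (star a) k) = cmod (cinner k (\<pi> a (\<pi> (star a) k)))"
      by (simp only: pi_adjoint[of a k "\<pi> (star a) k", symmetric] cmod_cinner_self power2_eq_square)
    also have "\<dots> \<le> C * norm k * norm (\<pi> (star a) k)" by (rule C(2))
    finally show ?thesis using False by simp
  qed (use C in simp)
  let ?b = "star a * a"
  have "norm ?b \<le> s" if "C\<^sup>2 < s" for s
  proof (rule norm_le_pi_self_adjoint[OF _ _ _ that])
    show "norm (\<pi> ?b h) \<le> C\<^sup>2 * norm h" for h
      using order.trans[OF n2[of "\<pi> a h"] mult_left_mono[OF n1 C(1)]]
      by (simp add: pi_simps power2_eq_square mult.assoc)
  qed (simp_all add: star_mult star_star)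
  then have "norm ?b \<le> C\<^sup>2" by (rule dense_ge)
  then have "(norm a)\<^sup>2 \<le> C\<^sup>2" by (simp add: cstar_identity)
  then show ?thesis using C(1) by (rule power2_le_imp_le)
qed

end

lemma weakstar_lim_eq:
  assumes "\<And>\<omega>. \<omega> \<in> predual \<Longrightarrow> (\<lambda>n. \<omega> (s n)) \<longlonglongrightarrow> \<omega> c"
  shows "weakstar_lim s = c"
  unfolding weakstar_lim_def
proof (rule the_equality)
  fix d assume "\<forall>\<omega>\<in>predual. (\<lambda>n. \<omega> (s n)) \<longlonglongrightarrow> \<omega> d"
  then show "d = c" using assms LIMSEQ_unique by (intro predual_separates) blast
qed (use assms in blast)

subsection \<open>Hilbert modules\<close>

lemma bounded_bilinear_cinner: "bounded_bilinear (cinner :: 'a :: chilbert_space \<Rightarrow> 'a \<Rightarrow> complex)"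
proof
  show "\<exists>K. \<forall>a b :: 'a. norm (cinner a b) \<le> norm a * norm b * K"
    by (intro exI[of _ 1]) (simp add: cauchy_schwarz)
qed (simp_all add: cinner_linear scaleR_eq_scaleC scaleR_conv_of_real)

lemmas tendsto_cinner = bounded_bilinear.tendsto[OF bounded_bilinear_cinner]

lemma norm_sq_sum_orthogonal:
  fixes f :: "'i \<Rightarrow> 'a :: chilbert_space"
  assumes "\<And>i j. i \<noteq> j \<Longrightarrow> cinner (f i) (f j) = 0" "finite I"
  shows "(norm (\<Sum>i\<in>I. f i))\<^sup>2 = (\<Sum>i\<in>I. (norm (f i))\<^sup>2)"
proof -
  have "cinner (\<Sum>i\<in>I. f i) (\<Sum>i\<in>I. f i) = (\<Sum>i\<in>I. cinner (f i) (f i))"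
    unfolding cinner_sum
  proof (rule sum.cong[OF refl])
    fix i assume "i \<in> I"
    have "(\<Sum>j\<in>I. cinner (f j) (f i)) = (\<Sum>j\<in>I. if j = i then cinner (f i) (f i) else 0)"
      using assms(1) by (intro sum.cong) auto
    then show "(\<Sum>j\<in>I. cinner (f j) (f i)) = cinner (f i) (f i)" using \<open>i \<in> I\<close> assms(2) by simp
  qed
  then have "complex_of_real ((norm (\<Sum>i\<in>I. f i))\<^sup>2) = complex_of_real (\<Sum>i\<in>I. (norm (f i))\<^sup>2)"
    by (simp only: cinner_self of_real_sum)
  then show ?thesis by (simp only: of_real_eq_iff)
qed

lemma orthogonal_summable:
  fixes f :: "nat \<Rightarrow> 'a :: chilbert_space"
  assumes orth: "\<And>i j. i \<noteq> j \<Longrightarrow> cinner (f i) (f j) = 0"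
    and bound: "\<And>N. norm (\<Sum>i<N. f i) \<le> C"
  shows "summable f"
proof -
  have "(\<Sum>i<N. (norm (f i))\<^sup>2) \<le> C\<^sup>2" for N
    using power_mono[OF bound[of N] norm_ge_zero, of 2] norm_sq_sum_orthogonal[of f "{..<N}", OF orth] by simp
  then have sq: "summable (\<lambda>i. (norm (f i))\<^sup>2)"
    by (intro summableI_nonneg_bounded[where x = "C\<^sup>2"]) simp_all
  show ?thesis unfolding summable_Cauchy
  proof (intro allI impI)
    fix e :: real assume e: "e > 0"
    then obtain N where N: "\<And>m n. m \<ge> N \<Longrightarrow> norm (\<Sum>i=m..<n. (norm (f i))\<^sup>2) < e\<^sup>2"
      using sq[unfolded summable_Cauchy] by (metis zero_less_power)
    have "norm (\<Sum>i=m..<n. f i) < e" if "m \<ge> N" for m n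
    proof (rule power2_less_imp_less)
      show "(norm (\<Sum>i=m..<n. f i))\<^sup>2 < e\<^sup>2"
        using N[OF that, of n] norm_sq_sum_orthogonal[of f "{m..<n}", OF orth] by (simp add: sum_nonneg)
    qed (use e in simp)
    then show "\<exists>N. \<forall>m\<ge>N. \<forall>n. norm (sum f {m..<n}) < e" by blast
  qed
qed

locale hilbert_mod =
  fixes E :: "('e :: complex_vec, 'm :: wstar_algebra) hmodule"
  assumes hm: "hilbert_module E"
begin

lemmas carrier_subspace = hm[unfolded hilbert_module_def, THEN conjunct1, rule_format]
lemmas ract_closed = hm[unfolded hilbert_module_def, THEN conjunct2, THEN conjunct1, rule_format]
lemmas ip_add_right = hm[unfolded hilbert_module_def, THEN conjunct2, THEN conjunct2, THEN conjunct2, THEN conjunct2, THEN conjunct2, THEN conjunct2, THEN conjunct2, THEN conjunct1, rule_format]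
lemmas ip_scale_right = hm[unfolded hilbert_module_def, THEN conjunct2, THEN conjunct2, THEN conjunct2, THEN conjunct2, THEN conjunct2, THEN conjunct2, THEN conjunct2, THEN conjunct2, THEN conjunct1, rule_format]
lemmas ip_ract_right = hm[unfolded hilbert_module_def, THEN conjunct2, THEN conjunct2, THEN conjunct2, THEN conjunct2, THEN conjunct2, THEN conjunct2, THEN conjunct2, THEN conjunct2, THEN conjunct2, THEN conjunct1, rule_format]
lemmas ip_star = hm[unfolded hilbert_module_def, THEN conjunct2, THEN conjunct2, THEN conjunct2, THEN conjunct2, THEN conjunct2, THEN conjunct2, THEN conjunct2, THEN conjunct2, THEN conjunct2, THEN conjunct2, THEN conjunct1, rule_format]
lemmas ip_definite = hm[unfolded hilbert_module_def, THEN conjunct2, THEN conjunct2, THEN conjunct2, THEN conjunct2, THEN conjunct2, THEN conjunct2, THEN conjunct2, THEN conjunct2, THEN conjunct2, THEN conjunct2, THEN conjunct2, THEN conjunct2, THEN conjunct1, rule_format]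

lemma carrier_complete:
  assumes "\<And>n. s n \<in> carrier E" "\<And>e. e > 0 \<Longrightarrow> \<exists>N. \<forall>m\<ge>N. \<forall>n\<ge>N. hnorm E (s m - s n) < e"
  shows "\<exists>x\<in>carrier E. (\<lambda>n. hnorm E (s n - x)) \<longlonglongrightarrow> 0"
proof -
  have "\<forall>s. (\<forall>n. s n \<in> carrier E) \<and> (\<forall>e>0. \<exists>N. \<forall>m\<ge>N. \<forall>n\<ge>N. hnorm E (s m - s n) < e)
        \<longrightarrow> (\<exists>x\<in>carrier E. (\<lambda>n. hnorm E (s n - x)) \<longlonglongrightarrow> 0)"
    using hm unfolding hilbert_module_def by (elim conjE)
  then show ?thesis using assms by simp
qed

lemmas carrier_closed = complex_vec.subspace_0[OF carrier_subspace]
  complex_vec.subspace_add[OF carrier_subspace] complex_vec.subspace_diff[OF carrier_subspace]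
  complex_vec.subspace_scale[OF carrier_subspace] complex_vec.subspace_sum[OF carrier_subspace]

lemma ip_zero_right: "x \<in> carrier E \<Longrightarrow> ip E x 0 = 0"
  using ip_scale_right[of x 0 0] carrier_closed(1) by simp

lemma ip_zero_left: "x \<in> carrier E \<Longrightarrow> ip E 0 x = 0"
  using ip_star[of x 0] ip_zero_right[of x] carrier_closed(1) by simp

lemma ip_diff_right:
  "x \<in> carrier E \<Longrightarrow> y \<in> carrier E \<Longrightarrow> z \<in> carrier E \<Longrightarrow> ip E x (y - z) = ip E x y - ip E x z"
  using ip_add_right[of x "y - z" z] by (simp add: carrier_closed)

lemma module_ext:
  assumes "x \<in> carrier E" "y \<in> carrier E" "\<And>z. z \<in> carrier E \<Longrightarrow> ip E z x = ip E z y"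
  shows "x = y"
proof -
  have "ip E (x - y) (x - y) = 0" using assms by (simp add: ip_diff_right carrier_closed)
  then show ?thesis using ip_definite[of "x - y"] assms by (simp add: carrier_closed)
qed

end

section \<open>Topologies generated by functionals\<close>

lemma normal_functional_single:
  fixes E :: "('a :: complex_vec, 'b :: wstar_algebra) hmodule"
  assumes "\<omega> \<in> predual" "x \<in> carrier E" "y \<in> carrier E"
  shows "(\<lambda>T. \<omega> (ip E x (T y))) \<in> normal_functionals E"
proof -
  let ?\<omega> = "\<lambda>n :: nat. if n = 0 then \<omega> else (\<lambda>x. 0)"
  have "(\<lambda>T. \<omega> (ip E x (T y))) = (\<lambda>T. \<Sum>n. ?\<omega> n (ip E x (T y)))"
    by (rule ext, subst suminf_finite[of "{0}"]) auto
  moreover have "summable (\<lambda>n. onorm (?\<omega> n) * hnorm E x * hnorm E y)"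
    by (rule summable_finite[of "{0}"]) (auto simp: onorm_zero)
  ultimately show ?thesis
    unfolding normal_functionals_def mem_Collect_eq using assms predual_zero[where 'a = 'b]
    by - (rule exI[of _ ?\<omega>], rule exI[of _ "\<lambda>n. x"], rule exI[of _ "\<lambda>n. y"], simp)
qed

lemma sigma_functional_single:
  fixes E :: "('a :: complex_vec, 'b :: wstar_algebra) hmodule"
  assumes "\<omega> \<in> predual" "x \<in> carrier E"
  shows "(\<lambda>y. \<omega> (ip E x y)) \<in> sigma_functionals E"
proof -
  let ?\<omega> = "\<lambda>n :: nat. if n = 0 then \<omega> else (\<lambda>x. 0)"
  have "(\<lambda>y. \<omega> (ip E x y)) = (\<lambda>y. \<Sum>n. ?\<omega> n (ip E x y))"
    by (rule ext, subst suminf_finite[of "{0}"]) auto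
  moreover have "summable (\<lambda>n. onorm (?\<omega> n) * hnorm E x)"
    by (rule summable_finite[of "{0}"]) (auto simp: onorm_zero)
  ultimately show ?thesis
    unfolding sigma_functionals_def mem_Collect_eq using assms predual_zero[where 'a = 'b]
    by - (rule exI[of _ ?\<omega>], rule exI[of _ "\<lambda>n. x"], simp)
qed

lemma openin_initial_topology:
  "f \<in> \<Phi> \<Longrightarrow> open U \<Longrightarrow> openin (initial_topology A \<Phi>) {x \<in> A. f x \<in> U}"
  unfolding initial_topology_def by (rule topology_generated_by_Basis) blast

lemma topspace_initial_topology:
  assumes "\<Phi> \<noteq> {}"
  shows "topspace (initial_topology A \<Phi>) = A"
proof -
  obtain f where "f \<in> \<Phi>" using assms by blast
  then have "{x \<in> A. f x \<in> UNIV} \<in> {{x \<in> A. f x \<in> U} | f U. f \<in> \<Phi> \<and> open U}" by blast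
  then show ?thesis unfolding initial_topology_def topology_generated_by_topspace by auto
qed

text \<open>Both functionals belong to the generating family, so disjoint neighbourhoods of two
  different values would pull back to an open set that misses \<open>S\<close>. Every use of a
  \<sigma>-closure or ultraweak closure goes through this.\<close>

lemma closure_initial_topology_eq:
  fixes f g :: "'a \<Rightarrow> complex"
  assumes "f \<in> \<Phi>" "g \<in> \<Phi>" "x \<in> initial_topology A \<Phi> closure_of S"
    and "\<And>y. y \<in> S \<Longrightarrow> y \<in> A \<Longrightarrow> f y = g y"
  shows "f x = g x"
proof (rule ccontr)
  assume "f x \<noteq> g x"
  then obtain U V where UV: "open U" "open V" "f x \<in> U" "g x \<in> V" "U \<inter> V = {}"
    using hausdorff[OF \<open>f x \<noteq> g x\<close>] by blast
  have top: "topspace (initial_topology A \<Phi>) = A" using assms(1) by (intro topspace_initial_topology) auto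
  let ?W = "{x \<in> A. f x \<in> U} \<inter> {x \<in> A. g x \<in> V}"
  have "openin (initial_topology A \<Phi>) ?W"
    using assms(1,2) UV by (intro openin_Int openin_initial_topology)
  moreover have cl: "x \<in> A" "\<forall>T. x \<in> T \<and> openin (initial_topology A \<Phi>) T \<longrightarrow> (\<exists>y. y \<in> S \<and> y \<in> T)"
    using assms(3) unfolding in_closure_of top by simp_all
  moreover have "x \<in> ?W" using cl(1) UV by simp
  ultimately obtain y where y: "y \<in> S" "y \<in> ?W" by meson
  then have "f y = g y" by (intro assms(4)) simp_all
  then show False using y UV(5) by auto
qed

locale correspondence =
  fixes E :: "('e :: complex_vec, 'm :: wstar_algebra) hmodule" and \<phi> :: "'m \<Rightarrow> 'e \<Rightarrow> 'e"
  assumes corr: "wstar_correspondence E \<phi>"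
begin

sublocale hilbert_mod E
  by unfold_locales (use corr in \<open>simp add: wstar_correspondence_def hilbert_wmodule_def\<close>)

lemmas act_adjointable = corr[unfolded wstar_correspondence_def, THEN conjunct2, THEN conjunct1, rule_format]
lemmas act_add = corr[unfolded wstar_correspondence_def, THEN conjunct2, THEN conjunct2, THEN conjunct1, rule_format]
lemmas act_scale = corr[unfolded wstar_correspondence_def, THEN conjunct2, THEN conjunct2, THEN conjunct2, THEN conjunct1, rule_format]
lemmas act_mult = corr[unfolded wstar_correspondence_def, THEN conjunct2, THEN conjunct2, THEN conjunct2, THEN conjunct2, THEN conjunct1, rule_format]
lemmas act_star = corr[unfolded wstar_correspondence_def, THEN conjunct2, THEN conjunct2, THEN conjunct2, THEN conjunct2, THEN conjunct2, THEN conjunct1, rule_format]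
lemmas act_normal = corr[unfolded wstar_correspondence_def, THEN conjunct2, THEN conjunct2, THEN conjunct2, THEN conjunct2, THEN conjunct2, THEN conjunct2, THEN conjunct1, rule_format]
lemmas act_dense = corr[unfolded wstar_correspondence_def, THEN conjunct2, THEN conjunct2, THEN conjunct2, THEN conjunct2, THEN conjunct2, THEN conjunct2, THEN conjunct2, rule_format]

lemma act_closed: "x \<in> carrier E \<Longrightarrow> \<phi> a x \<in> carrier E"
  using act_adjointable[of a] unfolding adjointables_def by blast

lemma act_star': "x \<in> carrier E \<Longrightarrow> y \<in> carrier E \<Longrightarrow> ip E (\<phi> a x) y = ip E x (\<phi> (star a) y)"
  using act_star[of x y "star a"] by (simp add: star_star)

text \<open>Essentiality of the left action enters here: d = x - \<open>\<phi> 1 x\<close> satisfies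
  \<open>\<phi> 1 d = 0\<close>, hence is orthogonal to all vectors \<open>\<phi> a v\<close>, and
  these are \<sigma>-dense.\<close>

lemma act_one: 
  assumes x: "x \<in> carrier E"
  shows "\<phi> 1 x = x"
proof -
  define d where "d = x - \<phi> 1 x"
  have d: "d \<in> carrier E" unfolding d_def using x by (simp add: carrier_closed act_closed)
  \<comment> \<open>Additivity of \<open>\<phi> 1\<close> is obtained by pairing with z, since
    adjointable maps are not additive by definition.\<close>
  have "\<phi> 1 x + \<phi> 1 d = \<phi> 1 x"
  proof (rule module_ext)
    fix z assume z: "z \<in> carrier E"
    have "ip E z (\<phi> 1 d) = ip E (\<phi> 1 z) d" using act_star[of z d 1] z d by simp
    also have "\<dots> = ip E (\<phi> 1 z) x - ip E (\<phi> 1 z) (\<phi> 1 x)"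
      unfolding d_def by (intro ip_diff_right act_closed z x)
    also have "ip E (\<phi> 1 z) (\<phi> 1 x) = ip E z (\<phi> (1 * 1) x)"
      using act_star[of z "\<phi> 1 x" 1] act_mult[OF x, of 1 1] z x by (simp add: act_closed)
    also have "ip E (\<phi> 1 z) x = ip E z (\<phi> 1 x)" using act_star[of z x 1] z x by simp
    finally show "ip E z (\<phi> 1 x + \<phi> 1 d) = ip E z (\<phi> 1 x)"
      using z x d by (simp add: ip_add_right act_closed)
  qed (use x d in \<open>simp_all add: act_closed carrier_closed\<close>)
  then have d0: "\<phi> 1 d = 0" by simp
  have "ip E d y = 0" if y: "y \<in> carrier E" for y
  proof (rule predual_separates)
    fix \<omega> :: "'m \<Rightarrow> complex" assume \<omega>: "\<omega> \<in> predual"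
    have z: "(\<lambda>y. \<omega> (ip E 0 y)) \<in> sigma_functionals E"
      by (rule sigma_functional_single[OF \<omega> carrier_closed(1)])
    have "\<omega> (ip E d y) = \<omega> (ip E 0 y)"
    proof (rule closure_initial_topology_eq[OF sigma_functional_single[OF \<omega> d] z])
      show "y \<in> initial_topology (carrier E) (sigma_functionals E) closure_of {\<phi> a x | a x. x \<in> carrier E}"
        using act_dense y by (simp add: sigma_topology_def)
      fix w assume "w \<in> {\<phi> a x | a x. x \<in> carrier E}" and wc: "w \<in> carrier E"
      then obtain a v where w: "w = \<phi> a v" "v \<in> carrier E" by blast
      then have "w = \<phi> 1 w" by (simp add: act_mult[symmetric])
      then have "ip E d w = ip E (\<phi> 1 d) w" using act_star[of d w 1] d wc by simp
      then show "\<omega> (ip E d w) = \<omega> (ip E 0 w)" by (simp add: d0)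
    qed
    then show "\<omega> (ip E d y) = \<omega> 0" using y by (simp add: ip_zero_left)
  qed
  then have "d = 0" using d ip_definite by blast
  then show ?thesis by (simp add: d_def)
qed

end

subsection \<open>The Fock space and its Hilbert space tensor product\<close>

definition incl :: "nat \<Rightarrow> 'x :: zero \<Rightarrow> nat \<Rightarrow> 'x" where
  "incl n x = (\<lambda>m. if m = n then x else 0)"

locale fock_rep = faithful_rep \<pi> + correspondence E \<phi>
  for \<pi> :: "'m :: wstar_algebra \<Rightarrow> 'h \<Rightarrow> 'h :: chilbert_space"
    and E :: "('e :: complex_vec, 'm) hmodule" and \<phi> :: "'m \<Rightarrow> 'e \<Rightarrow> 'e" +
  fixes X :: "nat \<Rightarrow> ('x :: complex_vec, 'm) hmodule"
    and \<psi> :: "nat \<Rightarrow> 'm \<Rightarrow> 'x \<Rightarrow> 'x"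
    and \<iota> :: "'m \<Rightarrow> 'x"
    and tens :: "nat \<Rightarrow> 'e \<Rightarrow> 'x \<Rightarrow> 'x"
    and \<tau> :: "(nat \<Rightarrow> 'x) \<Rightarrow> 'h \<Rightarrow> 'k :: chilbert_space"
  assumes powers: "tensor_powers E \<phi> X \<psi> \<iota> tens"
    and tensor: "hilbert_tensor (ultraweak_sum X) \<pi> \<tau>"
begin

abbreviation "F \<equiv> ultraweak_sum X"

lemma X_correspondence: "correspondence (X n) (\<psi> n)"
  using powers unfolding tensor_powers_def trivial_correspondence_def internal_tensor_def
  by (cases n) (auto intro: correspondence.intro)

lemma X_mod: "hilbert_mod (X n)"
  using X_correspondence[of n] unfolding correspondence_def wstar_correspondence_def hilbert_wmodule_def
  by (simp add: hilbert_mod_def)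

lemmas X_closed = hilbert_mod.carrier_closed[OF X_mod] hilbert_mod.ract_closed[OF X_mod]
  correspondence.act_closed[OF X_correspondence]
lemmas X_ip = hilbert_mod.ip_add_right[OF X_mod] hilbert_mod.ip_scale_right[OF X_mod]
  hilbert_mod.ip_ract_right[OF X_mod] hilbert_mod.ip_zero_right[OF X_mod]
  hilbert_mod.ip_zero_left[OF X_mod] hilbert_mod.ip_diff_right[OF X_mod]

lemma F_simps:
  "ract F x a = (\<lambda>n. ract (X n) (x n) a)"
  "ip F x y = weakstar_lim (\<lambda>N. \<Sum>n<N. ip (X n) (x n) (y n))"
  by (simp_all add: ultraweak_sum_def)

lemma F_component: "x \<in> carrier F \<Longrightarrow> x n \<in> carrier (X n)"
  by (simp add: ultraweak_sum_def)

lemma incl_component: "x \<in> carrier (X n) \<Longrightarrow> incl n x m \<in> carrier (X m)"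
  by (simp add: incl_def X_closed)

lemma incl_in: 
  assumes x: "x \<in> carrier (X n)"
  shows "incl n x \<in> carrier F"
proof -
  have "norm (\<Sum>m<N. ip (X m) (incl n x m) (incl n x m)) \<le> norm (ip (X n) x x)" for N
  proof -
    have "(\<Sum>m<N. ip (X m) (incl n x m) (incl n x m)) = (\<Sum>m<N. if m = n then ip (X n) x x else 0)"
      by (rule sum.cong) (auto simp: incl_def X_ip X_closed)
    then show ?thesis by simp
  qed
  then show ?thesis using incl_component[OF x] by (auto simp: ultraweak_sum_def)
qed

lemma ip_incl:
  assumes x: "x \<in> carrier (X n)" and y: "y \<in> carrier F"
  shows "ip F (incl n x) y = ip (X n) x (y n)" "ip F y (incl n x) = ip (X n) (y n) x"
proof -
  have "(\<Sum>m<N. ip (X m) (incl n x m) (y m)) = ip (X n) x (y n)"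
    "(\<Sum>m<N. ip (X m) (y m) (incl n x m)) = ip (X n) (y n) x" if "N > n" for N
  proof -
    have "(\<Sum>m<N. ip (X m) (incl n x m) (y m)) = (\<Sum>m<N. if m = n then ip (X n) x (y n) else 0)"
      "(\<Sum>m<N. ip (X m) (y m) (incl n x m)) = (\<Sum>m<N. if m = n then ip (X n) (y n) x else 0)"
      by (rule sum.cong; auto simp: incl_def X_ip X_closed F_component[OF y])+
    then show "(\<Sum>m<N. ip (X m) (incl n x m) (y m)) = ip (X n) x (y n)"
      "(\<Sum>m<N. ip (X m) (y m) (incl n x m)) = ip (X n) (y n) x" using that by simp_all
  qed
  then show "ip F (incl n x) y = ip (X n) x (y n)" "ip F y (incl n x) = ip (X n) (y n) x"
    unfolding F_simps
    by (intro weakstar_lim_eq tendsto_eventually eventually_sequentiallyI[of "Suc n"]; simp)+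
qed

lemma tau_inner: "x \<in> carrier F \<Longrightarrow> y \<in> carrier F \<Longrightarrow> cinner (\<tau> x h) (\<tau> y k) = cinner h (\<pi> (ip F x y) k)"
  using tensor unfolding hilbert_tensor_def by blast

lemma tau_total: "closure (cspan {\<tau> x h | x h. x \<in> carrier F}) = UNIV"
  using tensor unfolding hilbert_tensor_def by blast

lemma tau_total_zero: "(\<And>x h. x \<in> carrier F \<Longrightarrow> cinner (\<tau> x h) u = 0) \<Longrightarrow> u = 0"
  by (rule total_zero[OF tau_total]) blast

lemma tau_total_ext:
  assumes "\<And>x h. x \<in> carrier F \<Longrightarrow> cinner (\<tau> x h) u = cinner (\<tau> x h) v"
  shows "u = v"
proof -
  have "u - v = 0" by (rule tau_total_zero) (simp add: cinner_diff assms)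
  then show ?thesis by simp
qed

definition tau :: "nat \<Rightarrow> 'x \<Rightarrow> 'h \<Rightarrow> 'k" where "tau n x h = \<tau> (incl n x) h"

lemma tau_tau:
  assumes z: "z \<in> carrier F" and x: "x \<in> carrier (X n)"
  shows "cinner (\<tau> z k) (tau n x h) = cinner k (\<pi> (ip (X n) (z n) x) h)"
    "cinner (tau n x h) (\<tau> z k) = cinner h (\<pi> (ip (X n) x (z n)) k)"
  unfolding tau_def by (simp_all add: tau_inner incl_in x z ip_incl)

lemma tau_inner_n:
  assumes x: "x \<in> carrier (X n)" and y: "y \<in> carrier (X m)"
  shows "cinner (tau n x h) (tau m y k) = (if n = m then cinner h (\<pi> (ip (X n) x y) k) else 0)"
  using tau_tau(1)[OF incl_in[OF x] y, of h k]
  by (auto simp: tau_def incl_def X_ip y pi_zero)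

text \<open>Bilinearity of \<open>\<tau>\<close> is no part of \<open>hilbert_tensor\<close>; it
  follows from the inner product formula by testing against the total set of elementary tensors. The
  next lemmas use the same device.\<close>

lemma tau_add: "x \<in> carrier (X n) \<Longrightarrow> y \<in> carrier (X n) \<Longrightarrow> tau n (x + y) h = tau n x h + tau n y h"
  by (rule tau_total_ext)
     (simp add: tau_tau X_closed X_ip F_component cinner_linear pi_simps)

lemma tau_scale: "x \<in> carrier (X n) \<Longrightarrow> tau n (c *\<^sub>C x) h = c *\<^sub>C tau n x h"
  by (rule tau_total_ext)
     (simp add: tau_tau X_closed X_ip F_component cinner_linear pi_simps)

lemma tau_ract: "x \<in> carrier (X n) \<Longrightarrow> tau n (ract (X n) x a) h = tau n x (\<pi> a h)"
  by (rule tau_total_ext)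
     (simp add: tau_tau X_closed X_ip F_component cinner_linear pi_simps)

lemma tau_zero: "tau n 0 h = 0"
  using tau_scale[of 0 n 0 h] by (simp add: X_closed)

lemma tau_sum: "(\<And>i. i \<in> I \<Longrightarrow> f i \<in> carrier (X n)) \<Longrightarrow> tau n (\<Sum>i\<in>I. f i) h = (\<Sum>i\<in>I. tau n (f i) h)"
  by (induction I rule: infinite_finite_induct) (simp_all add: tau_add tau_zero X_closed)

lemma tau_diff: "x \<in> carrier (X n) \<Longrightarrow> y \<in> carrier (X n) \<Longrightarrow> tau n (x - y) h = tau n x h - tau n y h"
  using tau_add[of "x - y" n y h] by (simp add: X_closed)

text \<open>Faithfulness of \<open>\<pi>\<close> is what makes x determined by the map h -> x
  \<otimes> h.\<close>

lemma tau_ext: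
  assumes "x \<in> carrier (X n)" "y \<in> carrier (X n)" "\<And>h. tau n x h = tau n y h"
  shows "x = y"
proof (rule hilbert_mod.module_ext[OF X_mod assms(1,2)])
  fix z assume z: "z \<in> carrier (X n)"
  show "ip (X n) z x = ip (X n) z y"
  proof (rule pi_inject)
    fix h k
    have "cinner (tau n z h) (tau n x k) = cinner (tau n z h) (tau n y k)" by (simp add: assms(3))
    then show "cinner h (\<pi> (ip (X n) z x) k) = cinner h (\<pi> (ip (X n) z y) k)"
      using assms(1,2) z by (simp add: tau_inner_n)
  qed
qed

definition part :: "nat \<Rightarrow> (nat \<Rightarrow> 'x) \<Rightarrow> 'h \<Rightarrow> 'k" where
  "part N x h = (\<Sum>n<N. tau n (x n) h)"

lemma part_inner:
  assumes "\<And>n. x n \<in> carrier (X n)" "\<And>n. y n \<in> carrier (X n)"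
  shows "cinner (part N x h) (part N y k) = cinner h (\<pi> (\<Sum>n<N. ip (X n) (x n) (y n)) k)"
proof -
  have "cinner (part N x h) (part N y k) =
      (\<Sum>m<N. \<Sum>n<N. if n = m then cinner h (\<pi> (ip (X m) (x m) (y m)) k) else 0)"
    unfolding part_def cinner_sum using assms by (intro sum.cong refl) (simp add: tau_inner_n)
  also have "\<dots> = (\<Sum>m<N. cinner h (\<pi> (ip (X m) (x m) (y m)) k))"
    by (intro sum.cong refl) simp
  finally show ?thesis by (simp add: pi_sum cinner_sum)
qed

text \<open>The boundedness condition in the algebra becomes one on vectors because
  \<open>\<pi>\<close> is isometric: \<open>pi_contractive\<close> gives one direction and
  \<open>norm_le_pi\<close> the other. In this form, closure under the module operations is a matter
  of the triangle inequality.\<close>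

lemma F_iff:
  "x \<in> carrier F \<longleftrightarrow> (\<forall>n. x n \<in> carrier (X n)) \<and> (\<exists>C\<ge>0. \<forall>N h. norm (part N x h) \<le> C * norm h)"
  (is "?L \<longleftrightarrow> ?R")
proof
  assume ?L
  then obtain C where x: "\<And>n. x n \<in> carrier (X n)"
    and C: "\<And>N. norm (\<Sum>n<N. ip (X n) (x n) (x n)) \<le> C"
    by (auto simp: ultraweak_sum_def)
  have C0: "C \<ge> 0" using C[of 0] by simp
  have "norm (part N x h) \<le> sqrt C * norm h" for N h
  proof -
    have "(norm (part N x h))\<^sup>2 = cmod (cinner h (\<pi> (\<Sum>n<N. ip (X n) (x n) (x n)) h))"
      by (simp only: part_inner[OF x x, symmetric] cmod_cinner_self)
    also have "\<dots> \<le> norm h * (C * norm h)"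
      by (intro order.trans[OF cauchy_schwarz] mult_left_mono order.trans[OF pi_contractive]
          mult_right_mono C) auto
    also have "\<dots> = (sqrt C * norm h)\<^sup>2" using C0 by (simp add: power_mult_distrib power2_eq_square)
    finally show ?thesis by (rule power2_le_imp_le) (simp add: C0)
  qed
  then show ?R using x C0 by (metis real_sqrt_ge_0_iff)
next
  assume ?R
  then obtain C where x: "\<And>n. x n \<in> carrier (X n)" and C: "C \<ge> 0" "\<And>N h. norm (part N x h) \<le> C * norm h"
    by blast
  have "norm (\<Sum>n<N. ip (X n) (x n) (x n)) \<le> C * C" for N
  proof (rule norm_le_pi)
    fix h k
    have "cmod (cinner (part N x h) (part N x k)) \<le> (C * norm h) * (C * norm k)"
      using C by (intro order.trans[OF cauchy_schwarz] mult_mono) auto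
    then show "cmod (cinner h (\<pi> (\<Sum>n<N. ip (X n) (x n) (x n)) k)) \<le> C * C * norm h * norm k"
      by (simp add: part_inner[OF x x] mult_ac)
  qed (use C in simp)
  then show ?L using x by (auto simp: ultraweak_sum_def)
qed

lemma tau_orthogonal:
  assumes "\<And>n. x n \<in> carrier (X n)" "i \<noteq> j"
  shows "cinner (tau i (x i) h) (tau j (x j) k) = 0"
  using assms by (simp add: tau_inner_n)

lemma tau_summable: "x \<in> carrier F \<Longrightarrow> summable (\<lambda>n. tau n (x n) h)"
  using orthogonal_summable[of "\<lambda>n. tau n (x n) h"] tau_orthogonal[of x] unfolding F_iff part_def
  by blast

lemma part_tendsto: "x \<in> carrier F \<Longrightarrow> (\<lambda>N. part N x h) \<longlonglongrightarrow> (\<Sum>n. tau n (x n) h)"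
  unfolding part_def using summable_LIMSEQ[OF tau_summable] by blast

text \<open>The inner product of the direct sum is a limit picked by \<open>THE\<close>, so the
  limit must be shown to exist. The partial sums are bounded by C * D and their matrix coefficients
  are inner products of convergent vectors, so \<open>weak_star_convergent\<close> applies.\<close>

lemma ip_tendsto:
  assumes x: "x \<in> carrier F" and y: "y \<in> carrier F" and \<omega>: "\<omega> \<in> predual"
  shows "(\<lambda>N. \<omega> (\<Sum>n<N. ip (X n) (x n) (y n))) \<longlonglongrightarrow> \<omega> (ip F x y)"
proof -
  obtain C D where C: "C \<ge> 0" "\<And>N h. norm (part N x h) \<le> C * norm h"
    and D: "D \<ge> 0" "\<And>N h. norm (part N y h) \<le> D * norm h"
    using x y unfolding F_iff by blast
  let ?s = "\<lambda>N. \<Sum>n<N. ip (X n) (x n) (y n)"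
  have inner: "cinner h (\<pi> (?s N) k) = cinner (part N x h) (part N y k)" for N h k
    by (rule part_inner[symmetric]) (use x y F_component in auto)
  have "norm (?s N) \<le> C * D" for N
  proof (rule norm_le_pi)
    fix h k
    have "cmod (cinner (part N x h) (part N y k)) \<le> (C * norm h) * (D * norm k)"
      using C D by (intro order.trans[OF cauchy_schwarz] mult_mono) auto
    then show "cmod (cinner h (\<pi> (?s N) k)) \<le> C * D * norm h * norm k"
      unfolding inner by (simp add: mult_ac)
  qed (use C D in simp)
  moreover have "convergent (\<lambda>N. cinner h (\<pi> (?s N) k))" for h k
    unfolding inner by (rule convergentI, rule tendsto_cinner; rule part_tendsto[OF x] part_tendsto[OF y])
  ultimately have "\<exists>c. \<forall>\<omega>\<in>predual. (\<lambda>N. \<omega> (?s N)) \<longlonglongrightarrow> \<omega> c"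
    by (rule weak_star_convergent)
  then obtain c where c: "\<And>\<omega>. \<omega> \<in> predual \<Longrightarrow> (\<lambda>N. \<omega> (?s N)) \<longlonglongrightarrow> \<omega> c"
    by blast
  then have "ip F x y = c" unfolding F_simps by (rule weakstar_lim_eq)
  then show ?thesis using c \<omega> by simp
qed

text \<open>The inner product of \<open>\<tau> x h\<close> with \<open>part N x h\<close> is the
  squared norm of the latter, so the squared error is |\<open>\<tau> x h\<close>|^2 -
  |\<open>part N x h\<close>|^2, which tends to 0 by \<open>ip_tendsto\<close>.\<close>

lemma tau_sums:
  assumes x: "x \<in> carrier F"
  shows "(\<lambda>n. tau n (x n) h) sums \<tau> x h"
proof -
  have xc: "x n \<in> carrier (X n)" for n using F_component[OF x] .
  have n2: "(\<lambda>N. cinner (part N x h) (part N x h)) \<longlonglongrightarrow> cinner (\<tau> x h) (\<tau> x h)"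
    unfolding tau_inner[OF x x] part_inner[OF xc xc] by (rule ip_tendsto[OF x x vector_functional])
  have cross: "cinner (\<tau> x h) (part N x h) = cinner (part N x h) (part N x h)" for N
  proof -
    have "cinner (\<tau> x h) (part N x h) = (\<Sum>n<N. cinner h (\<pi> (ip (X n) (x n) (x n)) h))"
      unfolding part_def by (simp add: cinner_sum tau_tau x xc)
    then show ?thesis by (simp add: part_inner xc pi_sum cinner_sum)
  qed
  have cross': "cinner (part N x h) (\<tau> x h) = cinner (part N x h) (part N x h)" for N
    using cross[of N] cinner_commute by metis
  have "(\<lambda>N. cinner (\<tau> x h - part N x h) (\<tau> x h - part N x h)) \<longlonglongrightarrow> cinner (\<tau> x h) (\<tau> x h) - cinner (\<tau> x h) (\<tau> x h)"
    unfolding cinner_diff cross cross' using n2 by (intro tendsto_eq_intros) auto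
  then have "(\<lambda>N. cmod (cinner (\<tau> x h - part N x h) (\<tau> x h - part N x h))) \<longlonglongrightarrow> 0"
    by (simp add: tendsto_norm_zero)
  then have "(\<lambda>N. sqrt ((norm (\<tau> x h - part N x h))\<^sup>2)) \<longlonglongrightarrow> sqrt 0"
    unfolding cmod_cinner_self by (rule tendsto_real_sqrt)
  then have "(\<lambda>N. norm (part N x h - \<tau> x h)) \<longlonglongrightarrow> 0" by (simp add: norm_minus_commute)
  then show ?thesis unfolding sums_def part_def[symmetric] using LIM_zero_cancel tendsto_norm_zero_iff by blast
qed

lemma tau_tendsto: "x \<in> carrier F \<Longrightarrow> (\<lambda>N. part N x h) \<longlonglongrightarrow> \<tau> x h"
  using tau_sums unfolding sums_def part_def by blast

lemma norm_component_le:
  assumes x: "x \<in> carrier F"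
  shows "norm (part N x h) \<le> norm (\<tau> x h)" "norm (tau n (x n) h) \<le> norm (\<tau> x h)"
proof -
  have orth: "i \<noteq> j \<Longrightarrow> cinner (tau i (x i) h) (tau j (x j) h) = 0" for i j
    by (rule tau_orthogonal) (use F_component[OF x] in auto)
  have sq: "(norm (\<Sum>n\<in>A. tau n (x n) h))\<^sup>2 = (\<Sum>n\<in>A. (norm (tau n (x n) h))\<^sup>2)" if "finite A" for A
    using that orth by (intro norm_sq_sum_orthogonal) auto
  have mono: "(\<Sum>n\<in>A. (norm (tau n (x n) h))\<^sup>2) \<le> (norm (\<tau> x h))\<^sup>2" if finA: "finite A" for A
  proof -
    obtain N where N: "A \<subseteq> {..<N}" using finite_nat_bounded[OF finA] by blast
    have "(\<Sum>n\<in>A. (norm (tau n (x n) h))\<^sup>2) \<le> (norm (part M x h))\<^sup>2" if "M \<ge> N" for M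
      unfolding part_def sq[OF finite_lessThan] using N that by (intro sum_mono2) auto
    moreover have "(\<lambda>N. (norm (part N x h))\<^sup>2) \<longlonglongrightarrow> (norm (\<tau> x h))\<^sup>2"
      by (intro tendsto_power tendsto_norm tau_tendsto x)
    ultimately show ?thesis by (intro LIMSEQ_le_const) auto
  qed
  have "(norm (part N x h))\<^sup>2 \<le> (norm (\<tau> x h))\<^sup>2"
    unfolding part_def sq[OF finite_lessThan] by (rule mono) simp
  then show "norm (part N x h) \<le> norm (\<tau> x h)" by (rule power2_le_imp_le) simp
  have "(norm (tau n (x n) h))\<^sup>2 \<le> (norm (\<tau> x h))\<^sup>2" using mono[of "{n}"] by simp
  then show "norm (tau n (x n) h) \<le> norm (\<tau> x h)" by (rule power2_le_imp_le) simp
qed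

lemma tau_n_total:
  assumes "\<And>n x h. x \<in> carrier (X n) \<Longrightarrow> cinner (tau n x h) u = 0"
  shows "u = 0"
proof (rule tau_total_zero)
  fix x h assume x: "x \<in> carrier F"
  have "(\<lambda>N. cinner (part N x h) u) \<longlonglongrightarrow> cinner (\<tau> x h) u"
    by (rule tendsto_cinner_left[OF tau_tendsto[OF x]])
  moreover have "cinner (part N x h) u = 0" for N
    unfolding part_def by (simp add: cinner_sum assms F_component[OF x])
  ultimately show "cinner (\<tau> x h) u = 0" by (simp add: LIMSEQ_const_iff)
qed

lemma F_ext:
  assumes x: "x \<in> carrier F" and y: "y \<in> carrier F" and eq: "\<And>h. \<tau> x h = \<tau> y h"
  shows "x = y"
proof
  fix n
  show "x n = y n"
  proof (rule hilbert_mod.module_ext[OF X_mod F_component[OF x] F_component[OF y]])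
    fix z assume z: "z \<in> carrier (X n)"
    show "ip (X n) z (x n) = ip (X n) z (y n)"
      using tau_tau(2)[OF x z] tau_tau(2)[OF y z] eq by (intro pi_inject) metis
  qed
qed

lemma F_add: 
  assumes "x \<in> carrier F" "y \<in> carrier F"
  shows "x + y \<in> carrier F" "\<tau> (x + y) h = \<tau> x h + \<tau> y h"
proof -
  obtain C D where C: "C \<ge> 0" "\<And>N h. norm (part N x h) \<le> C * norm h"
    and D: "D \<ge> 0" "\<And>N h. norm (part N y h) \<le> D * norm h"
    using assms unfolding F_iff by blast
  have part: "part N (x + y) h = part N x h + part N y h" for N h
    unfolding part_def using assms by (simp add: tau_add F_component sum.distrib)
  have "norm (part N (x + y) h) \<le> (C + D) * norm h" for N h
    unfolding part distrib_right using norm_triangle_mono[OF C(2) D(2)] .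
  then show xy: "x + y \<in> carrier F"
    unfolding F_iff using assms C(1) D(1) by (intro conjI allI exI[of _ "C + D"]) (auto simp: F_component X_closed)
  show "\<tau> (x + y) h = \<tau> x h + \<tau> y h"
    using LIMSEQ_unique[OF tau_tendsto[OF xy, of h]] tendsto_add[OF tau_tendsto[OF assms(1)] tau_tendsto[OF assms(2)]]
    unfolding part by blast
qed

lemma F_scale: 
  assumes "x \<in> carrier F"
  shows "c *\<^sub>C x \<in> carrier F" "\<tau> (c *\<^sub>C x) h = c *\<^sub>C \<tau> x h"
proof -
  obtain C where C: "C \<ge> 0" "\<And>N h. norm (part N x h) \<le> C * norm h"
    using assms unfolding F_iff by blast
  have part: "part N (c *\<^sub>C x) h = c *\<^sub>C part N x h" for N h
    unfolding part_def using assms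
    by (simp add: tau_scale F_component scaleC_fun_def complex_vec.scale_sum_right)
  have "norm (part N (c *\<^sub>C x) h) \<le> (cmod c * C) * norm h" for N h
    unfolding part norm_scaleC using mult_left_mono[OF C(2) norm_ge_zero] by (simp add: mult.assoc)
  then show cx: "c *\<^sub>C x \<in> carrier F"
    unfolding F_iff using assms C(1)
    by (intro conjI allI exI[of _ "cmod c * C"]) (auto simp: F_component X_closed scaleC_fun_def)
  show "\<tau> (c *\<^sub>C x) h = c *\<^sub>C \<tau> x h"
    using LIMSEQ_unique[OF tau_tendsto[OF cx, of h]] tendsto_scaleC[OF tau_tendsto[OF assms(1)]]
    unfolding part by blast
qed

lemma F_ract: 
  assumes "x \<in> carrier F"
  shows "ract F x a \<in> carrier F" "\<tau> (ract F x a) h = \<tau> x (\<pi> a h)"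
proof -
  obtain C where C: "C \<ge> 0" "\<And>N h. norm (part N x h) \<le> C * norm h"
    using assms unfolding F_iff by blast
  have part: "part N (ract F x a) h = part N x (\<pi> a h)" for N h
    unfolding part_def F_simps using assms by (simp add: tau_ract F_component)
  have "norm (part N (ract F x a) h) \<le> (C * norm a) * norm h" for N h
    unfolding part using order.trans[OF C(2) mult_left_mono[OF pi_contractive C(1)]] by (simp add: mult.assoc)
  then show ax: "ract F x a \<in> carrier F"
    unfolding F_iff using assms C(1)
    by (intro conjI allI exI[of _ "C * norm a"]) (auto simp: F_component X_closed F_simps)
  show "\<tau> (ract F x a) h = \<tau> x (\<pi> a h)"
    using LIMSEQ_unique[OF tau_tendsto[OF ax, of h]] tau_tendsto[OF assms(1)]
    unfolding part by blast
qed

lemma F_subspace: "csubspace (carrier F)"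
proof -
  have "(\<lambda>n. 0) = incl 0 (0 :: 'x)" by (simp add: incl_def fun_eq_iff)
  then have "0 \<in> carrier F" using incl_in[of 0 0] by (simp add: zero_fun_def X_closed)
  then show ?thesis by (simp add: complex_vec.subspace_def F_add F_scale)
qed

lemmas F_closed = complex_vec.subspace_0[OF F_subspace]
  complex_vec.subspace_add[OF F_subspace] complex_vec.subspace_diff[OF F_subspace]
  complex_vec.subspace_scale[OF F_subspace] complex_vec.subspace_sum[OF F_subspace]

lemma F_zero: "\<tau> 0 h = 0"
  using F_scale(2)[OF F_closed(1), of 0 h] by simp

lemma F_diff: "x \<in> carrier F \<Longrightarrow> y \<in> carrier F \<Longrightarrow> \<tau> (x - y) h = \<tau> x h - \<tau> y h"
  using F_add(2)[of "x - y" y h] by (simp add: F_closed)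

lemma hnorm_nonneg: "0 \<le> hnorm E' x"
  by (simp add: hnorm_def)

lemma norm_tau_le: 
  assumes x: "x \<in> carrier F"
  shows "norm (\<tau> x h) \<le> hnorm F x * norm h"
proof -
  have "(norm (\<tau> x h))\<^sup>2 = cmod (cinner h (\<pi> (ip F x x) h))"
    by (simp only: tau_inner[OF x x, symmetric] cmod_cinner_self)
  also have "\<dots> \<le> norm h * (norm (ip F x x) * norm h)"
    by (intro order.trans[OF cauchy_schwarz] mult_left_mono pi_contractive) auto
  also have "\<dots> = (hnorm F x * norm h)\<^sup>2"
    by (simp add: hnorm_def power_mult_distrib power2_eq_square)
  finally show ?thesis by (rule power2_le_imp_le) (simp add: hnorm_nonneg)
qed

lemma norm_ip_le_tau:
  assumes x: "x \<in> carrier F" and y: "y \<in> carrier F"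
    and "C \<ge> 0" "D \<ge> 0" "\<And>h. norm (\<tau> x h) \<le> C * norm h" "\<And>h. norm (\<tau> y h) \<le> D * norm h"
  shows "norm (ip F x y) \<le> C * D"
proof (rule norm_le_pi)
  fix h k
  have "cmod (cinner (\<tau> x h) (\<tau> y k)) \<le> (C * norm h) * (D * norm k)"
    using assms by (intro order.trans[OF cauchy_schwarz] mult_mono) auto
  then show "cmod (cinner h (\<pi> (ip F x y) k)) \<le> C * D * norm h * norm k"
    by (simp add: tau_inner x y mult_ac)
qed (use assms in simp)

text \<open>Together with \<open>norm_tau_le\<close> this identifies \<open>hnorm F x\<close> as the
  operator norm of h -> x \<otimes> h.\<close>

lemma hnorm_le: 
  assumes x: "x \<in> carrier F" and C: "C \<ge> 0" "\<And>h. norm (\<tau> x h) \<le> C * norm h"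
  shows "hnorm F x \<le> C"
  using real_sqrt_le_mono[OF norm_ip_le_tau[OF x x C(1) C(1) C(2) C(2)]] C(1)
  by (simp add: hnorm_def)

lemma norm_ip_le:
  assumes x: "x \<in> carrier F" and y: "y \<in> carrier F"
  shows "norm (ip F x y) \<le> hnorm F x * hnorm F y"
  by (intro norm_ip_le_tau norm_tau_le hnorm_nonneg x y)

lemma hnorm_incl: "x \<in> carrier (X n) \<Longrightarrow> hnorm F (incl n x) = hnorm (X n) x"
  unfolding hnorm_def using ip_incl(1)[of x n "incl n x"] by (simp add: incl_in) (simp add: incl_def)

lemma ip_F_eqI:
  assumes "x \<in> carrier F" "y \<in> carrier F" "x' \<in> carrier F" "y' \<in> carrier F"
    "\<And>h k. cinner (\<tau> x h) (\<tau> y k) = cinner (\<tau> x' h) (\<tau> y' k)"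
  shows "ip F x y = ip F x' y'"
  using assms by (intro pi_inject) (simp add: tau_inner)

lemma ip_F_add: "x \<in> carrier F \<Longrightarrow> y \<in> carrier F \<Longrightarrow> z \<in> carrier F \<Longrightarrow> ip F x (y + z) = ip F x y + ip F x z"
  by (rule pi_inject) (simp add: tau_inner[symmetric] F_add cinner_linear pi_simps)

lemma ip_F_scale: "x \<in> carrier F \<Longrightarrow> y \<in> carrier F \<Longrightarrow> ip F x (c *\<^sub>C y) = c *\<^sub>C ip F x y"
  by (rule pi_inject) (simp add: tau_inner[symmetric] F_scale cinner_linear pi_simps)

lemma ip_F_diff: "x \<in> carrier F \<Longrightarrow> y \<in> carrier F \<Longrightarrow> z \<in> carrier F \<Longrightarrow> ip F x (y - z) = ip F x y - ip F x z"
  using ip_F_add[of x "y - z" z] by (simp add: F_closed)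

lemma F_module_ext:
  assumes x: "x \<in> carrier F" and y: "y \<in> carrier F" and eq: "\<And>z. z \<in> carrier F \<Longrightarrow> ip F z x = ip F z y"
  shows "x = y"
  by (rule F_ext[OF x y], rule tau_total_ext) (simp add: tau_inner x y eq)

end

lemma dense_eq_sesquilinear:
  fixes A B :: "'a :: complex_banach \<Rightarrow> 'c :: chilbert_space" and A' B' :: "'b :: complex_banach \<Rightarrow> 'c"
  assumes bl: "bounded_clinear A" "bounded_clinear B" "bounded_clinear A'" "bounded_clinear B'"
    and G: "closure (cspan G) = UNIV" "closure (cspan G') = UNIV"
    and eq: "\<And>u v. u \<in> G \<Longrightarrow> v \<in> G' \<Longrightarrow> cinner (A u) (A' v) = cinner (B u) (B' v)"
  shows "cinner (A u) (A' v) = cinner (B u) (B' v)"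
proof -
  note simps = bounded_clinear_simps[OF bl(1)] bounded_clinear_simps[OF bl(2)]
    bounded_clinear_simps[OF bl(3)] bounded_clinear_simps[OF bl(4)]
  have right: "cinner (A u) (A' v) = cinner (B u) (B' v)" if u: "u \<in> G" for u v
  proof -
    let ?S = "{v. cinner (A u) (A' v) = cinner (B u) (B' v)}"
    have "csubspace ?S" by (simp add: complex_vec.subspace_def cinner_linear simps)
    then have "cspan G' \<subseteq> ?S" using eq[OF u] by (intro complex_vec.span_minimal) auto
    moreover have "closed ?S"
      by (intro closed_Collect_eq linear_continuous_on bounded_linear_compose[OF bounded_linear_cinner_right]
          bounded_clinear_simps(1)[OF bl(3)] bounded_clinear_simps(1)[OF bl(4)])
    ultimately have "closure (cspan G') \<subseteq> ?S" by (rule closure_minimal)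
    then show ?thesis using G(2) by auto
  qed
  let ?S = "{u. cinner (A u) (A' v) = cinner (B u) (B' v)}"
  have "csubspace ?S" by (simp add: complex_vec.subspace_def cinner_linear simps)
  then have "cspan G \<subseteq> ?S" using right by (intro complex_vec.span_minimal) auto
  moreover have "closed ?S"
    by (intro closed_Collect_eq linear_continuous_on bounded_linear_compose[OF bounded_linear_cinner_left]
        bounded_clinear_simps(1)[OF bl(1)] bounded_clinear_simps(1)[OF bl(2)])
  ultimately have "closure (cspan G) \<subseteq> ?S" by (rule closure_minimal)
  then show ?thesis using G(1) by auto
qed

context fock_rep
begin

lemma norm_tau_n_le: "x \<in> carrier (X n) \<Longrightarrow> norm (tau n x h) \<le> hnorm (X n) x * norm h"
  using norm_tau_le[OF incl_in, of x n h] by (simp add: tau_def hnorm_incl)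

lemma hnorm_n_le:
  assumes "x \<in> carrier (X n)" "C \<ge> 0" "\<And>h. norm (tau n x h) \<le> C * norm h"
  shows "hnorm (X n) x \<le> C"
  using hnorm_le[OF incl_in[OF assms(1)] assms(2)] assms(3) by (simp add: tau_def hnorm_incl assms(1))

text \<open>Completeness of the direct sum for absolutely convergent series, assembled degree by
  degree: each tensor power is complete, and the uniform bound \<open>S\<close> puts the sequence of
  limits into the direct sum. The gliding hump argument below relies on it.\<close>

lemma F_series:
  assumes xs: "\<And>j. xs j \<in> carrier F" and sum: "summable (\<lambda>j. hnorm F (xs j))"
  obtains z where "z \<in> carrier F" "\<And>h. (\<lambda>j. \<tau> (xs j) h) sums \<tau> z h"
proof -
  define S where "S = (\<Sum>j. hnorm F (xs j))"
  have S: "(\<Sum>j<J. hnorm F (xs j)) \<le> S" for J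
    unfolding S_def by (rule sum_le_suminf[OF sum]) (simp_all add: hnorm_nonneg)
  have S0: "S \<ge> 0" using S[of 0] by simp
  have "\<exists>z\<in>carrier (X n). \<forall>h. (\<lambda>j. tau n (xs j n) h) sums tau n z h" for n
  proof -
    define s where "s J = (\<Sum>j<J. xs j n)" for J
    have sc: "s J \<in> carrier (X n)" for J
      unfolding s_def by (intro X_closed F_component xs)
    have bnd: "norm (tau n (s M) h - tau n (s N) h) \<le> (\<Sum>j=N..<M. hnorm F (xs j)) * norm h"
      if NM: "N \<le> M" for N M h
    proof -
      have "tau n (s M) h - tau n (s N) h = (\<Sum>j=N..<M. tau n (xs j n) h)"
        unfolding s_def using sum_diff_nat_ivl[of 0 N M "\<lambda>j. tau n (xs j n) h"] NM
        by (simp add: tau_sum F_component xs atLeast0LessThan)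
      also have "norm \<dots> \<le> (\<Sum>j=N..<M. hnorm F (xs j) * norm h)"
        by (intro sum_norm_le order.trans[OF norm_component_le(2)] norm_tau_le xs)
      finally show ?thesis by (simp add: sum_distrib_right)
    qed
    have "\<exists>z\<in>carrier (X n). (\<lambda>J. hnorm (X n) (s J - z)) \<longlonglongrightarrow> 0"
    proof (rule hilbert_mod.carrier_complete[OF X_mod sc])
      fix e :: real assume e: "e > 0"
      then obtain N where N: "\<And>m k. m \<ge> N \<Longrightarrow> norm (\<Sum>j=m..<k. hnorm F (xs j)) < e / 2"
        using sum[unfolded summable_Cauchy] by (metis half_gt_zero)
      have "hnorm (X n) (s m - s k) < e" if mk: "m \<ge> N" "k \<ge> N" for m k
      proof -
        have "norm (tau n (s m - s k) h) \<le> e / 2 * norm h" for h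
        proof (cases "k \<le> m")
          case True
          show ?thesis
            using order.trans[OF bnd[OF True] mult_right_mono[of _ "e/2"]] N[OF mk(2), of m]
            by (simp add: tau_diff sc)
        next
          case False
          then show ?thesis
            using order.trans[OF bnd[of m k] mult_right_mono[of _ "e/2"]] N[OF mk(1), of k]
            by (simp add: tau_diff sc norm_minus_commute)
        qed
        then have "hnorm (X n) (s m - s k) \<le> e / 2"
          using e sc by (intro hnorm_n_le) (simp_all add: X_closed)
        then show ?thesis using e by simp
      qed
      then show "\<exists>N. \<forall>m\<ge>N. \<forall>k\<ge>N. hnorm (X n) (s m - s k) < e" by blast
    qed
    then obtain z where z: "z \<in> carrier (X n)" "(\<lambda>J. hnorm (X n) (s J - z)) \<longlonglongrightarrow> 0" by blast
    have "(\<lambda>J. tau n (s J) h) \<longlonglongrightarrow> tau n z h" for h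
    proof (rule LIM_zero_cancel, rule Lim_null_comparison)
      show "\<forall>\<^sub>F J in sequentially. norm (tau n (s J) h - tau n z h) \<le> hnorm (X n) (s J - z) * norm h"
        using norm_tau_n_le[of "s _ - z" n h] sc z(1) by (simp add: X_closed tau_diff)
      show "(\<lambda>J. hnorm (X n) (s J - z) * norm h) \<longlonglongrightarrow> 0" by (rule tendsto_mult_left_zero[OF z(2)])
    qed
    then show ?thesis using z(1)
      unfolding sums_def s_def by (intro bexI[of _ z]) (simp_all add: tau_sum F_component xs)
  qed
  then obtain z where z: "\<And>n. z n \<in> carrier (X n)" "\<And>n h. (\<lambda>j. tau n (xs j n) h) sums tau n (z n) h"
    by metis
  have "norm (part N z h) \<le> S * norm h" for N h
  proof (rule LIMSEQ_le_const2)
    have "(\<lambda>J. \<Sum>n<N. \<Sum>j<J. tau n (xs j n) h) \<longlonglongrightarrow> part N z h"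
      unfolding part_def using z(2) by (intro tendsto_sum) (simp add: sums_def)
    then show "(\<lambda>J. norm (\<Sum>n<N. \<Sum>j<J. tau n (xs j n) h)) \<longlonglongrightarrow> norm (part N z h)"
      by (rule tendsto_norm)
    have "norm (\<Sum>n<N. \<Sum>j<J. tau n (xs j n) h) \<le> S * norm h" for J
    proof -
      have "(\<Sum>n<N. \<Sum>j<J. tau n (xs j n) h) = (\<Sum>j<J. part N (xs j) h)"
        unfolding part_def by (rule sum.swap)
      also have "norm \<dots> \<le> (\<Sum>j<J. hnorm F (xs j) * norm h)"
        by (intro sum_norm_le order.trans[OF norm_component_le(1)] norm_tau_le xs)
      also have "\<dots> \<le> S * norm h"
        unfolding sum_distrib_right[symmetric] by (intro mult_right_mono S) simp
      finally show ?thesis .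
    qed
    then show "\<exists>M. \<forall>J\<ge>M. norm (\<Sum>n<N. \<Sum>j<J. tau n (xs j n) h) \<le> S * norm h" by blast
  qed
  then have zF: "z \<in> carrier F" unfolding F_iff using z(1) S0 by blast
  have "(\<lambda>j. \<tau> (xs j) h) sums \<tau> z h" for h
  proof -
    have "summable (\<lambda>j. \<tau> (xs j) h)"
      by (rule summable_comparison_test'[OF summable_mult2[OF sum, of "norm h"]]) (rule norm_tau_le[OF xs])
    then have u: "(\<lambda>j. \<tau> (xs j) h) sums (\<Sum>j. \<tau> (xs j) h)" by (rule summable_sums)
    \<comment> \<open>The limit in the Hilbert space and the degreewise limit agree because each
      degree tests them separately.\<close>
    have "(\<Sum>j. \<tau> (xs j) h) - \<tau> z h = 0"
    proof (rule tau_n_total)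
      fix n y k assume y: "y \<in> carrier (X n)"
      have "(\<lambda>j. cinner (tau n y k) (\<tau> (xs j) h)) sums cinner (tau n y k) (\<Sum>j. \<tau> (xs j) h)"
        by (rule bounded_linear.sums[OF bounded_linear_cinner_right u])
      moreover have "(\<lambda>j. cinner (tau n y k) (tau n (xs j n) h)) sums cinner (tau n y k) (tau n (z n) h)"
        by (rule bounded_linear.sums[OF bounded_linear_cinner_right z(2)])
      moreover have "cinner (tau n y k) (\<tau> x h) = cinner (tau n y k) (tau n (x n) h)" if "x \<in> carrier F" for x
        using that y by (simp add: tau_tau tau_inner_n F_component)
      ultimately show "cinner (tau n y k) ((\<Sum>j. \<tau> (xs j) h) - \<tau> z h) = 0"
        using xs zF sums_unique2 by (simp add: cinner_diff) blast
    qed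
    then show ?thesis using u by simp
  qed
  then show ?thesis using that zF by blast
qed

subsection \<open>Adjointable operators\<close>

text \<open>The second operator has the first as adjoint on the carrier. Values elsewhere are left
  free, which makes the relation symmetric.\<close>

definition adj_pair :: "((nat \<Rightarrow> 'x) \<Rightarrow> nat \<Rightarrow> 'x) \<Rightarrow> ((nat \<Rightarrow> 'x) \<Rightarrow> nat \<Rightarrow> 'x) \<Rightarrow> bool" where
  "adj_pair S T \<longleftrightarrow> (\<forall>x\<in>carrier F. S x \<in> carrier F \<and> T x \<in> carrier F) \<and>
     (\<forall>x\<in>carrier F. \<forall>y\<in>carrier F. ip F (S x) y = ip F x (T y))"

lemma adj_pairD:
  assumes "adj_pair S T"
  shows "x \<in> carrier F \<Longrightarrow> S x \<in> carrier F" "x \<in> carrier F \<Longrightarrow> T x \<in> carrier F"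
    "x \<in> carrier F \<Longrightarrow> y \<in> carrier F \<Longrightarrow> ip F (S x) y = ip F x (T y)"
    "x \<in> carrier F \<Longrightarrow> y \<in> carrier F \<Longrightarrow> cinner (\<tau> (S x) h) (\<tau> y k) = cinner (\<tau> x h) (\<tau> (T y) k)"
  using assms unfolding adj_pair_def by (simp_all add: tau_inner)

lemma adj_pairI:
  assumes "\<And>x. x \<in> carrier F \<Longrightarrow> S x \<in> carrier F" "\<And>x. x \<in> carrier F \<Longrightarrow> T x \<in> carrier F"
    "\<And>x y h k. x \<in> carrier F \<Longrightarrow> y \<in> carrier F \<Longrightarrow> cinner (\<tau> (S x) h) (\<tau> y k) = cinner (\<tau> x h) (\<tau> (T y) k)"
  shows "adj_pair S T"
  unfolding adj_pair_def using assms by (auto intro!: ip_F_eqI)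

lemma adj_pair_sym:
  assumes "adj_pair S T"
  shows "adj_pair T S"
proof (rule adj_pairI)
  fix x y h k assume "x \<in> carrier F" "y \<in> carrier F"
  then show "cinner (\<tau> (T x) h) (\<tau> y k) = cinner (\<tau> x h) (\<tau> (S y) k)"
    using adj_pairD(4)[OF assms, of y x k h] cinner_commute by metis
qed (use adj_pairD[OF assms] in auto)

lemma adjointable_pair:
  assumes "T \<in> adjointables F"
  shows "\<exists>S. adj_pair S T"
proof -
  have T: "T ` carrier F \<subseteq> carrier F"
    and ex: "\<exists>S. S ` carrier F \<subseteq> carrier F \<and> (\<forall>x\<in>carrier F. \<forall>y\<in>carrier F. ip F (S x) y = ip F x (T y))"
    using assms by (simp_all only: adjointables_def mem_Collect_eq)
  obtain S where "S ` carrier F \<subseteq> carrier F" "\<forall>x\<in>carrier F. \<forall>y\<in>carrier F. ip F (S x) y = ip F x (T y)"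
    using ex by (elim exE conjE)
  then have "adj_pair S T" using T by (simp only: adj_pair_def image_subset_iff) simp
  then show ?thesis by (rule exI[of _ S])
qed

lemma adjointableI:
  assumes ST: "adj_pair S T" and zero: "\<And>x. x \<notin> carrier F \<Longrightarrow> T x = 0"
  shows "T \<in> adjointables F"
proof -
  have "S ` carrier F \<subseteq> carrier F \<and> (\<forall>x\<in>carrier F. \<forall>y\<in>carrier F. ip F (S x) y = ip F x (T y))"
    using adj_pairD(1,3)[OF ST] by (simp only: image_subset_iff) simp
  moreover have "T ` carrier F \<subseteq> carrier F" using adj_pairD(2)[OF ST] by (simp only: image_subset_iff) simp
  ultimately show ?thesis using zero unfolding adjointables_def mem_Collect_eq by (intro conjI exI[of _ S]) simp_all
qed

text \<open>Uniform boundedness by Sokal's gliding hump: an unbounded \<open>S\<close> yields \<open>z\<close> with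
  \<open>\<parallel>\<langle>S y\<^sub>j, z\<rangle>\<parallel>\<close> too large for \<open>\<langle>y\<^sub>j, T z\<rangle>\<close>.\<close>

lemma adj_pair_bounded:
  assumes ST: "adj_pair S T"
  shows "\<exists>C\<ge>0. \<forall>x\<in>carrier F. hnorm F (S x) \<le> C * hnorm F x"
proof (rule ccontr)
    assume "\<not> ?thesis"
    then have "\<exists>y\<in>carrier F. 4 ^ j * hnorm F y < hnorm F (S y)" for j :: nat
      by (metis not_less zero_le_numeral zero_le_power)
    then obtain y where y: "\<And>j. y j \<in> carrier F" "\<And>j. 4 ^ j * hnorm F (y j) < hnorm F (S (y j))"
      by metis
    define v where "v j = S (y j)" for j
    define N where "N j = hnorm F (v j)" for j
    have v: "v j \<in> carrier F" for j unfolding v_def by (rule adj_pairD(1)[OF ST y(1)])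
    have N: "N j > 0" for j
      unfolding N_def v_def by (rule le_less_trans[OF _ y(2)]) (simp add: hnorm_nonneg)
    have hv: "norm (ip F (v j) (v j)) = (N j)\<^sup>2" for j unfolding N_def hnorm_def by simp
    \<comment> \<open>Against the factor 4^j in the choice of \<open>y j\<close>, steps of size
      3^(-j) still leave the unbounded quantity (4/3)^j at the end.\<close>
    define q where "q j = (1 / 3 :: real) ^ j" for j
    have q0: "q j > 0" for j unfolding q_def by simp
    let ?Q = "\<lambda>j x x'. hnorm F (x' - x) \<le> q j \<and> q j * N j \<le> norm (ip F (v j) x')"
    have "\<exists>f. \<forall>j. f j \<in> carrier F \<and> ?Q j (f j) (f (Suc j))"
    proof (rule dependent_nat_choice)
      show "\<exists>x. x \<in> carrier F" using F_closed(1) by blast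
      fix x j assume x: "x \<in> carrier F"
      \<comment> \<open>A step of norm at most \<open>q j\<close> along \<open>v j\<close>. The
        pairings of \<open>v j\<close> with x + w and x - w differ by an element of norm 2 * q j * N
        j, so one of them has norm at least q j * N j.\<close>
      define w where "w = complex_of_real (q j / N j) *\<^sub>C v j"
      have w: "w \<in> carrier F" unfolding w_def by (intro F_closed v)
      have nw: "hnorm F w \<le> q j" "hnorm F (- w) \<le> q j"
      proof -
        have "norm (\<tau> w h) \<le> q j * norm h" for h
        proof -
          have "norm (\<tau> w h) = q j / N j * norm (\<tau> (v j) h)"
            unfolding w_def using q0[of j] N[of j] by (simp add: F_scale v norm_scaleC norm_divide)
          also have "\<dots> \<le> q j / N j * (N j * norm h)"
            unfolding N_def using q0[of j] by (intro mult_left_mono norm_tau_le v) (simp add: hnorm_nonneg)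
          finally show ?thesis using N[of j] by simp
        qed
        then show "hnorm F w \<le> q j" "hnorm F (- w) \<le> q j"
          using q0[of j] F_diff[OF F_closed(1) w] F_closed(3)[OF F_closed(1) w]
          by (auto intro!: hnorm_le w simp: F_zero less_imp_le)
      qed
      have "ip F (v j) (x + w) - ip F (v j) (x - w) = 2 *\<^sub>C ip F (v j) w"
        using scaleC_add_left[of 1 1 "ip F (v j) w"]
        by (simp add: ip_F_add ip_F_diff v x w scaleC_one)
      also have "\<dots> = (2 * complex_of_real (q j / N j)) *\<^sub>C ip F (v j) (v j)"
        unfolding w_def by (simp add: ip_F_scale v scaleC_scaleC)
      finally have "norm (ip F (v j) (x + w) - ip F (v j) (x - w)) = 2 * (q j / N j) * (N j)\<^sup>2"
        using q0[of j] N[of j] by (simp add: norm_scaleC hv norm_mult norm_divide)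
      then have "2 * (q j * N j) \<le> norm (ip F (v j) (x + w)) + norm (ip F (v j) (x - w))"
        using norm_triangle_ineq4[of "ip F (v j) (x + w)" "ip F (v j) (x - w)"] N[of j]
        by (simp add: power2_eq_square)
      then consider "q j * N j \<le> norm (ip F (v j) (x + w))" | "q j * N j \<le> norm (ip F (v j) (x - w))"
        by linarith
      then show "\<exists>x'. x' \<in> carrier F \<and> ?Q j x x'"
      proof cases
        case 1
        then show ?thesis using nw(1) w x by (intro exI[of _ "x + w"]) (simp add: F_closed)
      next
        case 2
        then show ?thesis using nw(2) w x by (intro exI[of _ "x - w"]) (simp add: F_closed)
      qed
    qed
    then obtain f where f: "\<And>j. f j \<in> carrier F" "\<And>j. ?Q j (f j) (f (Suc j))" by blast
    define g where "g j = f (Suc j) - f j" for j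
    have gF: "g j \<in> carrier F" for j unfolding g_def by (intro F_closed f)
    have gq: "hnorm F (g j) \<le> q j" for j unfolding g_def using f(2) by blast
    have sumq: "summable q" unfolding q_def by (rule summable_geometric) simp
    have sumg: "summable (\<lambda>j. hnorm F (g j))"
      by (rule summable_comparison_test'[OF sumq]) (simp add: gq hnorm_nonneg)
    obtain z0 where z0: "z0 \<in> carrier F" "\<And>h. (\<lambda>j. \<tau> (g j) h) sums \<tau> z0 h"
      using F_series[OF gF sumg] by blast
    define z where "z = f 0 + z0"
    have z: "z \<in> carrier F" unfolding z_def by (intro F_closed f z0)
    \<comment> \<open>The steps after the j-th sum to 3^(-j) / 2, half of what the j-th step
      secured, so half of the pairing with \<open>v j\<close> survives in the limit.\<close>
    have tail: "norm (\<tau> (z - f (Suc j)) h) \<le> q j / 2 * norm h" for j h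
    proof -
      have "\<tau> (f (Suc j)) h = \<tau> (f 0) h + (\<Sum>i<Suc j. \<tau> (g i) h)"
        using sum_lessThan_telescope[of "\<lambda>j. \<tau> (f j) h" "Suc j"]
        by (simp only: g_def F_diff[OF f(1) f(1)]) simp
      then have "\<tau> (z - f (Suc j)) h = \<tau> z0 h - (\<Sum>i<Suc j. \<tau> (g i) h)"
        unfolding z_def by (simp add: F_diff F_add f z0 F_closed)
      also have "\<dots> = (\<Sum>i. \<tau> (g (i + Suc j)) h)"
        using suminf_minus_initial_segment[OF sums_summable[OF z0(2)[of h]], of "Suc j"] sums_unique[OF z0(2)[of h]]
        by simp
      also have "norm \<dots> \<le> (\<Sum>i. q (i + Suc j) * norm h)"
      proof (rule norm_suminf_le)
        show "norm (\<tau> (g (i + Suc j)) h) \<le> q (i + Suc j) * norm h" for i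
          by (rule order.trans[OF norm_tau_le[OF gF] mult_right_mono[OF gq]]) simp
        show "summable (\<lambda>i. q (i + Suc j) * norm h)"
          by (intro summable_mult2 summable_ignore_initial_segment sumq)
      qed
      also have "(\<Sum>i. q (i + Suc j) * norm h) = q j / 2 * norm h"
      proof -
        have "(\<lambda>i. (1/3 :: real) ^ i) sums (1 / (1 - 1/3))" by (rule geometric_sums) simp
        then have "(\<lambda>i. (1/3) ^ i * (q (Suc j) * norm h)) sums (1 / (1 - 1/3) * (q (Suc j) * norm h))"
          by (rule sums_mult2)
        then have "(\<lambda>i. q (i + Suc j) * norm h) sums (q j / 2 * norm h)"
          unfolding q_def by (simp add: power_add mult_ac)
        then show ?thesis by (rule sums_unique[symmetric])
      qed
      finally show ?thesis .
    qed
    have main: "q j / 2 * 4 ^ j \<le> hnorm F (T z)" for j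
    proof -
      have zf: "z - f (Suc j) \<in> carrier F" by (intro F_closed z f)
      have "norm (ip F (v j) (z - f (Suc j))) \<le> N j * (q j / 2)"
        unfolding N_def using q0[of j]
        by (intro norm_ip_le_tau v zf norm_tau_le tail) (simp_all add: hnorm_nonneg)
      moreover have "ip F (v j) (f (Suc j)) = ip F (v j) z - ip F (v j) (z - f (Suc j))"
        by (simp add: ip_F_diff v z f)
      then have "norm (ip F (v j) (f (Suc j))) \<le> norm (ip F (v j) z) + norm (ip F (v j) (z - f (Suc j)))"
        using norm_triangle_ineq4 by simp
      moreover have "q j * N j \<le> norm (ip F (v j) (f (Suc j)))" using f(2) by blast
      ultimately have "q j / 2 * N j \<le> norm (ip F (v j) z)" by (simp add: mult.commute)
      also have "ip F (v j) z = ip F (y j) (T z)" unfolding v_def by (rule adj_pairD(3)[OF ST y(1) z])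
      also have "norm \<dots> \<le> hnorm F (y j) * hnorm F (T z)"
        by (rule norm_ip_le[OF y(1) adj_pairD(2)[OF ST z]])
      finally have a: "q j / 2 * N j \<le> hnorm F (y j) * hnorm F (T z)" .
      have "4 ^ j * (q j / 2 * N j) \<le> 4 ^ j * (hnorm F (y j) * hnorm F (T z))"
        using a by (intro mult_left_mono) auto
      also have "\<dots> \<le> N j * hnorm F (T z)"
        using mult_right_mono[OF less_imp_le[OF y(2)[of j]] hnorm_nonneg[of F "T z"]]
        unfolding N_def v_def by (simp add: mult.assoc)
      finally have "N j * (q j / 2 * 4 ^ j) \<le> N j * hnorm F (T z)" by (simp add: mult_ac)
      then show ?thesis using N[of j] by simp
    qed
    have "(4 / 3 :: real) ^ j \<le> 2 * hnorm F (T z)" for j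
      using main[of j] unfolding q_def by (simp add: power_divide field_simps)
    moreover obtain j where "2 * hnorm F (T z) < (4 / 3 :: real) ^ j"
      using real_arch_pow[of "4/3"] by auto
    ultimately show False using not_less by blast
qed

text \<open>In \<open>operator_from_gram\<close> the composite of \<open>S\<close> after
  \<open>T\<close> plays T*T. Its iterates grow at most like (C * D)^m in the module norm, and
  \<open>norm_tau_le\<close> carries this to elementary tensors.\<close>

lemma adj_pair_operator:
  assumes ST: "adj_pair S T"
  shows "\<exists>B. bounded_clinear B \<and> (\<forall>x\<in>carrier F. \<forall>h. B (\<tau> x h) = \<tau> (T x) h)"
proof -
  obtain C where C: "C \<ge> 0" "\<And>x. x \<in> carrier F \<Longrightarrow> hnorm F (S x) \<le> C * hnorm F x"
    using adj_pair_bounded[OF ST] by blast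
  obtain D where D: "D \<ge> 0" "\<And>x. x \<in> carrier F \<Longrightarrow> hnorm F (T x) \<le> D * hnorm F x"
    using adj_pair_bounded[OF adj_pair_sym[OF ST]] by blast
  define q where "q p = (S (T (fst p)), snd p)" for p :: "(nat \<Rightarrow> 'x) \<times> 'h"
  let ?J = "{p :: (nat \<Rightarrow> 'x) \<times> 'h. fst p \<in> carrier F}"
  show ?thesis
  proof (rule operator_from_gram[where J = ?J and q = q and C = "C * D" and
        v = "\<lambda>p. \<tau> (fst p) (snd p)" and w = "\<lambda>p. \<tau> (T (fst p)) (snd p)"])
    show "cinner (\<tau> (T (fst i)) (snd i)) (\<tau> (T (fst j)) (snd j)) = cinner (\<tau> (fst (q i)) (snd (q i))) (\<tau> (fst j) (snd j))"
      if "i \<in> ?J" "j \<in> ?J" for i j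
      using that adj_pairD[OF ST] by (simp add: q_def)
    show "q i \<in> ?J" if "i \<in> ?J" for i using that adj_pairD[OF ST] by (simp add: q_def)
    show "\<exists>E. \<forall>m. norm (\<tau> (fst ((q ^^ m) i)) (snd ((q ^^ m) i))) \<le> E * (C * D) ^ m" if i: "i \<in> ?J" for i
    proof -
      have iter: "fst ((q ^^ m) i) \<in> carrier F \<and> snd ((q ^^ m) i) = snd i \<and>
          hnorm F (fst ((q ^^ m) i)) \<le> (C * D) ^ m * hnorm F (fst i)" for m
      proof (induction m)
        case (Suc m)
        let ?x = "fst ((q ^^ m) i)"
        have x: "?x \<in> carrier F" "snd ((q ^^ m) i) = snd i" "hnorm F ?x \<le> (C * D) ^ m * hnorm F (fst i)"
          using Suc by blast+
        have "hnorm F (S (T ?x)) \<le> C * (D * hnorm F ?x)"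
          using C(1) by (intro order.trans[OF C(2) mult_left_mono] D x adj_pairD(2)[OF ST])
        also have "\<dots> \<le> C * (D * ((C * D) ^ m * hnorm F (fst i)))"
          using C(1) D(1) x(3) by (intro mult_left_mono)
        finally have "hnorm F (S (T ?x)) \<le> (C * D) ^ Suc m * hnorm F (fst i)" by (simp add: mult_ac)
        moreover have "(q ^^ Suc m) i = (S (T ?x), snd i)" by (simp add: q_def x(2))
        ultimately show ?case using adj_pairD(1)[OF ST adj_pairD(2)[OF ST x(1)]] by simp
      qed (use i in simp)
      have "norm (\<tau> (fst ((q ^^ m) i)) (snd ((q ^^ m) i))) \<le> (hnorm F (fst i) * norm (snd i)) * (C * D) ^ m" for m
      proof -
        have it: "fst ((q ^^ m) i) \<in> carrier F" "snd ((q ^^ m) i) = snd i"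
          "hnorm F (fst ((q ^^ m) i)) \<le> (C * D) ^ m * hnorm F (fst i)" using iter[of m] by blast+
        show ?thesis
          using order.trans[OF norm_tau_le[OF it(1)] mult_right_mono[OF it(3) norm_ge_zero], of "snd i"]
          unfolding it(2) by (simp add: mult_ac)
      qed
      then show ?thesis by blast
    qed
  next
    fix B assume "bounded_clinear B" "\<And>p. p \<in> ?J \<Longrightarrow> B (\<tau> (fst p) (snd p)) = \<tau> (T (fst p)) (snd p)"
    then show ?thesis by (intro exI[of _ B]) auto
  qed (use C(1) D(1) in auto)
qed

lemma eq_on_tau:
  assumes "bounded_clinear A" "bounded_clinear B" "\<And>x h. x \<in> carrier F \<Longrightarrow> A (\<tau> x h) = B (\<tau> x h)"
  shows "A u = B u"
  by (rule bounded_clinear_eq_on_closure[OF assms(1,2), of "{\<tau> x h | x h. x \<in> carrier F}"])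
     (use assms(3) tau_total in auto)

abbreviation amp :: "((nat \<Rightarrow> 'x) \<Rightarrow> nat \<Rightarrow> 'x) \<Rightarrow> 'k \<Rightarrow> 'k" where "amp \<equiv> ampliation F \<tau>"

lemma amp_eq:
  assumes "bounded_clinear B" "\<And>x h. x \<in> carrier F \<Longrightarrow> B (\<tau> x h) = \<tau> (T x) h"
  shows "amp T = B"
  unfolding ampliation_def
proof (rule the_equality)
  fix B' assume B': "bounded_clinear B' \<and> (\<forall>x\<in>carrier F. \<forall>h. B' (\<tau> x h) = \<tau> (T x) h)"
  show "B' = B" by (rule ext, rule eq_on_tau) (use assms B' in auto)
qed (use assms in blast)

lemma amp_spec:
  assumes "adj_pair S T"
  shows "bounded_clinear (amp T)" "x \<in> carrier F \<Longrightarrow> amp T (\<tau> x h) = \<tau> (T x) h"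
proof -
  obtain B where B: "bounded_clinear B" "\<And>x h. x \<in> carrier F \<Longrightarrow> B (\<tau> x h) = \<tau> (T x) h"
    using adj_pair_operator[OF assms] by blast
  then show "bounded_clinear (amp T)" "x \<in> carrier F \<Longrightarrow> amp T (\<tau> x h) = \<tau> (T x) h"
    using amp_eq[OF B] by auto
qed

lemma amp_adjoint:
  assumes ST: "adj_pair S T"
  shows "cinner (amp S u) v = cinner u (amp T v)"
proof (rule dense_eq_sesquilinear[where A = "amp S" and A' = "\<lambda>v. v" and B = "\<lambda>u. u" and B' = "amp T",
      OF _ _ _ _ tau_total tau_total])
  fix u v assume "u \<in> {\<tau> x h | x h. x \<in> carrier F}" "v \<in> {\<tau> x h | x h. x \<in> carrier F}"
  then show "cinner (amp S u) v = cinner u (amp T v)"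
    using adj_pairD[OF ST] amp_spec(2)[OF ST] amp_spec(2)[OF adj_pair_sym[OF ST]] by auto
qed (use amp_spec(1)[OF ST] amp_spec(1)[OF adj_pair_sym[OF ST]] bounded_clinear_ident in auto)

end

context fock_rep
begin

subsection \<open>The left action and the creation operators\<close>

abbreviation "fl \<equiv> fock_left X \<psi>"
abbreviation "cr \<equiv> creation X tens"

lemma fl_apply: "x \<in> carrier F \<Longrightarrow> fl a x = (\<lambda>n. \<psi> n a (x n))"
  by (simp add: fock_left_def op_on_def)

lemma cr_apply: "x \<in> carrier F \<Longrightarrow> cr \<xi> x = (\<lambda>n. case n of 0 \<Rightarrow> 0 | Suc m \<Rightarrow> tens m \<xi> (x m))"
  by (simp add: creation_def op_on_def)

lemmas psi_simps = correspondence.act_mult[OF X_correspondence] correspondence.act_one[OF X_correspondence]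
  correspondence.act_star'[OF X_correspondence] correspondence.act_add[OF X_correspondence]
  correspondence.act_scale[OF X_correspondence]

text \<open>Normality of the left action makes its diagonal coefficients bounded functionals of
  \<open>a\<close>, as \<open>action_contractive\<close> requires.\<close>

lemma norm_psi_le:
  assumes x: "x \<in> carrier (X n)"
  shows "norm (tau n (\<psi> n a x) h) \<le> norm a * norm (tau n x h)"
proof -
  let ?v = "\<lambda>p :: 'x \<times> 'h. tau n (fst p) (snd p)"
  let ?act = "\<lambda>a (p :: 'x \<times> 'h). (\<psi> n a (fst p), snd p)"
  have "norm (\<Sum>p\<in>{(x, h)}. 1 *\<^sub>C ?v (?act a p)) \<le> norm a * norm (\<Sum>p\<in>{(x, h)}. 1 *\<^sub>C ?v p)"
  proof (rule action_contractive[where J = "{p. fst p \<in> carrier (X n)}" and act = ?act and v = ?v])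
    fix i :: "'x \<times> 'h" assume i: "i \<in> {p. fst p \<in> carrier (X n)}"
    have "(\<lambda>T. cinner (snd i) (\<pi> (ip (X n) (fst i) (T (fst i))) (snd i))) \<in> normal_functionals (X n)"
      by (rule normal_functional_single[OF vector_functional]) (use i in auto)
    then have "(\<lambda>a. cinner (snd i) (\<pi> (ip (X n) (fst i) (\<psi> n a (fst i))) (snd i))) \<in> predual"
      by (rule correspondence.act_normal[OF X_correspondence])
    from predual_functional(6)[OF this] i
    show "\<exists>D. \<forall>a. cmod (cinner (?v i) (?v (?act a i))) \<le> D * norm a"
      by (auto simp: tau_inner_n X_closed)
  qed (use x in \<open>auto simp: X_closed psi_simps tau_inner_n star_star\<close>)
  then show ?thesis by (simp add: scaleC_one)
qed

lemma norm_part_fl_le: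
  assumes x: "x \<in> carrier F"
  shows "norm (part N (\<lambda>n. \<psi> n a (x n)) h) \<le> norm a * norm (part N x h)"
proof -
  have xc: "x n \<in> carrier (X n)" "\<psi> n a (x n) \<in> carrier (X n)" for n
    using F_component[OF x] by (auto intro: X_closed)
  have sq: "(norm (part N y h))\<^sup>2 = (\<Sum>n<N. (norm (tau n (y n) h))\<^sup>2)" if "\<And>n. y n \<in> carrier (X n)" for y
    unfolding part_def using tau_orthogonal[of y] that by (intro norm_sq_sum_orthogonal) auto
  have "(norm (part N (\<lambda>n. \<psi> n a (x n)) h))\<^sup>2 \<le> (\<Sum>n<N. (norm a * norm (tau n (x n) h))\<^sup>2)"
    unfolding sq[OF xc(2)] by (intro sum_mono power_mono norm_psi_le xc) auto
  also have "\<dots> = (norm a * norm (part N x h))\<^sup>2"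
    by (simp only: power_mult_distrib sq[OF xc(1)] sum_distrib_left)
  finally show ?thesis by (rule power2_le_imp_le) simp
qed

lemma fl_in:
  assumes x: "x \<in> carrier F"
  shows "fl a x \<in> carrier F"
proof -
  obtain C where C: "C \<ge> 0" "\<And>N h. norm (part N x h) \<le> C * norm h"
    using x unfolding F_iff by blast
  have "norm (part N (\<lambda>n. \<psi> n a (x n)) h) \<le> (norm a * C) * norm h" for N h
    using order.trans[OF norm_part_fl_le[OF x] mult_left_mono[OF C(2) norm_ge_zero]] by (simp add: mult.assoc)
  then show ?thesis
    unfolding F_iff fl_apply[OF x] using C(1) F_component[OF x]
    by (intro conjI exI[of _ "norm a * C"]) (auto intro: X_closed)
qed

lemma inner_sums:
  assumes "x \<in> carrier F" "y \<in> carrier F"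
  shows "(\<lambda>n. cinner h (\<pi> (ip (X n) (x n) (y n)) k)) sums cinner (\<tau> x h) (\<tau> y k)"
  using ip_tendsto[OF assms vector_functional, of h k]
  unfolding sums_def tau_inner[OF assms] by (simp add: pi_sum cinner_sum)

lemma fl_pair: "adj_pair (fl (star a)) (fl a)"
proof (rule adj_pairI)
  fix x y h k assume xy: "x \<in> carrier F" "y \<in> carrier F"
  have "cinner h (\<pi> (ip (X n) (fl (star a) x n) (y n)) k) = cinner h (\<pi> (ip (X n) (x n) (fl a y n)) k)" for n
    using F_component[OF xy(1)] F_component[OF xy(2)]
    by (simp add: fl_apply xy psi_simps star_star)
  then show "cinner (\<tau> (fl (star a) x) h) (\<tau> y k) = cinner (\<tau> x h) (\<tau> (fl a y) k)"
    using inner_sums[OF fl_in[OF xy(1)] xy(2), of h "star a" k] inner_sums[OF xy(1) fl_in[OF xy(2)], of h a k]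
      sums_unique2 by simp
qed (rule fl_in; assumption)+

lemma fl_adjointable: "fl a \<in> adjointables F"
  by (rule adjointableI[OF fl_pair]) (simp add: fock_left_def op_on_def)

definition rho :: "'m \<Rightarrow> 'k \<Rightarrow> 'k" where "rho a = amp (fl a)"

lemma rho_bounded: "bounded_clinear (rho a)"
  unfolding rho_def by (rule amp_spec(1)[OF fl_pair])

lemma rho_tau: "x \<in> carrier F \<Longrightarrow> rho a (\<tau> x h) = \<tau> (fl a x) h"
  unfolding rho_def by (rule amp_spec(2)[OF fl_pair])

lemma rho_adjoint: "cinner (rho (star a) u) v = cinner u (rho a v)"
  unfolding rho_def by (rule amp_adjoint[OF fl_pair])

lemma rho_adjoint': "cinner (rho a u) v = cinner u (rho (star a) v)"
  using rho_adjoint[of "star a" u v] by (simp add: star_star)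

lemma fl_add: "x \<in> carrier F \<Longrightarrow> fl (a + b) x = fl a x + fl b x"
  by (simp add: fl_apply psi_simps F_component fun_eq_iff)

lemma fl_scale: "x \<in> carrier F \<Longrightarrow> fl (c *\<^sub>C a) x = c *\<^sub>C fl a x"
  by (simp add: fl_apply psi_simps F_component fun_eq_iff scaleC_fun_def)

lemma fl_mult: "x \<in> carrier F \<Longrightarrow> fl (a * b) x = fl a (fl b x)"
  using fl_apply[OF fl_in, of x a b] by (simp add: fl_apply psi_simps F_component)

lemma fl_one: "x \<in> carrier F \<Longrightarrow> fl 1 x = x"
  by (simp add: fl_apply psi_simps F_component fun_eq_iff)

lemma rho_add: "rho (a + b) u = rho a u + rho b u"
  by (rule eq_on_tau[of _ "\<lambda>u. rho a u + rho b u"])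
     (auto intro: rho_bounded bounded_clinear_add simp: rho_tau fl_add F_add fl_in)

lemma rho_scale: "rho (c *\<^sub>C a) u = c *\<^sub>C rho a u"
  by (rule eq_on_tau[of _ "\<lambda>u. c *\<^sub>C rho a u"])
     (auto intro: rho_bounded bounded_clinear_compose[OF bounded_clinear_scaleC] simp: rho_tau fl_scale F_scale fl_in)

lemma rho_mult: "rho (a * b) u = rho a (rho b u)"
  by (rule eq_on_tau[of _ "\<lambda>u. rho a (rho b u)"])
     (auto intro: rho_bounded bounded_clinear_compose[OF rho_bounded] simp: rho_tau fl_mult fl_in)

lemma rho_one: "rho 1 u = u"
  by (rule eq_on_tau[of _ "\<lambda>u. u"])
     (auto intro: rho_bounded bounded_clinear_ident simp: rho_tau fl_one)

lemma rho_diff: "rho (a - b) u = rho a u - rho b u"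
  using rho_add[of "a - b" b u] by simp

lemmas rho_linear = bounded_clinear_simps(2-6)[OF rho_bounded]

text \<open>The degreewise estimate first gives contractivity on single elementary tensors. This
  provides the diagonal bounds with which \<open>action_contractive\<close> handles finite sums, and
  density does the rest.\<close>

lemma norm_rho_le: "norm (rho a u) \<le> norm a * norm u"
proof -
  let ?J = "{p :: (nat \<Rightarrow> 'x) \<times> 'h. fst p \<in> carrier F}"
  let ?v = "\<lambda>p :: (nat \<Rightarrow> 'x) \<times> 'h. \<tau> (fst p) (snd p)"
  let ?act = "\<lambda>a (p :: (nat \<Rightarrow> 'x) \<times> 'h). (fl a (fst p), snd p)"
  have fl: "norm (\<tau> (fl a x) h) \<le> norm a * norm (\<tau> x h)" if x: "x \<in> carrier F" for x h a
  proof (rule LIMSEQ_le)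
    show "(\<lambda>N. norm (part N (fl a x) h)) \<longlonglongrightarrow> norm (\<tau> (fl a x) h)"
      by (intro tendsto_norm tau_tendsto fl_in x)
    show "(\<lambda>N. norm a * norm (part N x h)) \<longlonglongrightarrow> norm a * norm (\<tau> x h)"
      by (intro tendsto_mult_left tendsto_norm tau_tendsto x)
  qed (use norm_part_fl_le[OF x] in \<open>simp add: fl_apply x\<close>)
  have sum: "norm (\<Sum>p\<in>I. c p *\<^sub>C ?v (?act a p)) \<le> norm a * norm (\<Sum>p\<in>I. c p *\<^sub>C ?v p)"
    if I: "finite I" "I \<subseteq> ?J" for I c
  proof (rule action_contractive[where J = ?J and act = ?act and v = ?v, OF _ _ _ _ _ I])
    fix i assume i: "i \<in> ?J"
    then have i': "fst i \<in> carrier F" by simp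
    have "cmod (cinner (?v i) (?v (?act a i))) \<le> (norm (?v i) * norm (?v i)) * norm a" for a
      using order.trans[OF cauchy_schwarz mult_left_mono[OF fl[OF i'] norm_ge_zero], of "?v i" a "snd i"]
      by (simp add: mult_ac)
    then show "\<exists>D. \<forall>a. cmod (cinner (?v i) (?v (?act a i))) \<le> D * norm a" by blast
  qed (use adj_pairD(4)[OF fl_pair] in \<open>auto simp: fl_in fl_mult fl_one rho_tau[symmetric] rho_adjoint'\<close>)
  have "cspan (?v ` ?J) \<subseteq> {u. norm (rho a u) \<le> norm a * norm u}"
  proof
    fix u assume "u \<in> cspan (?v ` ?J)"
    then obtain I c where I: "finite I" "I \<subseteq> ?J" "u = (\<Sum>p\<in>I. c p *\<^sub>C ?v p)" by (rule cspan_range_sum)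
    have "rho a u = (\<Sum>p\<in>I. c p *\<^sub>C ?v (?act a p))"
      unfolding I(3) bounded_clinear_sum[OF rho_bounded] rho_linear
      using I(2) by (intro sum.cong refl) (auto simp: rho_tau)
    then show "u \<in> {u. norm (rho a u) \<le> norm a * norm u}" using sum[OF I(1,2)] I(3) by simp
  qed
  moreover have "closed {u. norm (rho a u) \<le> norm a * norm u}"
    by (intro closed_Collect_le continuous_intros linear_continuous_on bounded_clinear_simps(1)[OF rho_bounded])
  ultimately have "closure (cspan (?v ` ?J)) \<subseteq> {u. norm (rho a u) \<le> norm a * norm u}"
    by (rule closure_minimal)
  moreover have "?v ` ?J = {\<tau> x h | x h. x \<in> carrier F}" by (auto simp: image_def)
  ultimately show ?thesis using tau_total by auto
qed

lemma tens_simps: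
  assumes "\<xi> \<in> carrier E" "x \<in> carrier (X n)"
  shows "tens n \<xi> x \<in> carrier (X (Suc n))"
    "\<zeta> \<in> carrier E \<Longrightarrow> y \<in> carrier (X n) \<Longrightarrow>
      ip (X (Suc n)) (tens n \<xi> x) (tens n \<zeta> y) = ip (X n) x (\<psi> n (ip E \<xi> \<zeta>) y)"
    "\<psi> (Suc n) a (tens n \<xi> x) = tens n (\<phi> a \<xi>) x"
proof -
  have T: "internal_tensor E \<phi> (X n) (\<psi> n) (X (Suc n)) (\<psi> (Suc n)) (tens n)"
    using powers by (simp add: tensor_powers_def)
  show "tens n \<xi> x \<in> carrier (X (Suc n))"
    "\<zeta> \<in> carrier E \<Longrightarrow> y \<in> carrier (X n) \<Longrightarrow>
      ip (X (Suc n)) (tens n \<xi> x) (tens n \<zeta> y) = ip (X n) x (\<psi> n (ip E \<xi> \<zeta>) y)"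
    "\<psi> (Suc n) a (tens n \<xi> x) = tens n (\<phi> a \<xi>) x"
    using T assms by (simp_all add: internal_tensor_def)
qed

lemma tens_zero: 
  assumes \<xi>: "\<xi> \<in> carrier E"
  shows "tens n \<xi> 0 = 0"
proof (rule hilbert_mod.ip_definite[OF X_mod])
  show "tens n \<xi> 0 \<in> carrier (X (Suc n))" by (rule tens_simps(1)[OF \<xi> X_closed(1)])
  show "ip (X (Suc n)) (tens n \<xi> 0) (tens n \<xi> 0) = 0"
    using \<xi> by (simp add: tens_simps X_closed X_ip)
qed

lemma psi_zero: "\<psi> n a 0 = 0"
proof (rule hilbert_mod.module_ext[OF X_mod])
  fix z assume "z \<in> carrier (X n)"
  then show "ip (X n) z (\<psi> n a 0) = ip (X n) z 0"
    using correspondence.act_star[OF X_correspondence, of z n 0 a] by (simp add: X_ip X_closed)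
qed (intro X_closed)+

lemma fl_incl: "x \<in> carrier (X n) \<Longrightarrow> fl a (incl n x) = incl n (\<psi> n a x)"
  by (simp add: fl_apply incl_in) (auto simp: incl_def psi_zero)

lemma cr_component:
  assumes "\<xi> \<in> carrier E" "x \<in> carrier F"
  shows "cr \<xi> x n \<in> carrier (X n)" "cr \<xi> x 0 = 0" "cr \<xi> x (Suc m) = tens m \<xi> (x m)"
proof -
  show c: "cr \<xi> x 0 = 0" "cr \<xi> x (Suc m) = tens m \<xi> (x m)" for m using assms(2) by (simp_all add: cr_apply)
  show "cr \<xi> x n \<in> carrier (X n)"
    by (cases n) (use assms in \<open>simp_all add: c X_closed tens_simps F_component\<close>)
qed

text \<open>Creation raises degrees by one and leaves 0 in degree 0, hence \<open>Suc N\<close> on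
  one side and \<open>N\<close> on the other.\<close>

lemma part_cr_inner:
  assumes "\<xi> \<in> carrier E" "\<zeta> \<in> carrier E" "x \<in> carrier F" "y \<in> carrier F"
  shows "cinner (part (Suc N) (cr \<xi> x) h) (part (Suc N) (cr \<zeta> y) k) =
    cinner (part N x h) (part N (fl (ip E \<xi> \<zeta>) y) k)"
proof -
  have "ip (X (Suc n)) (cr \<xi> x (Suc n)) (cr \<zeta> y (Suc n)) = ip (X n) (x n) (fl (ip E \<xi> \<zeta>) y n)" for n
    using assms by (simp add: cr_component tens_simps F_component fl_apply)
  then have "(\<Sum>n<Suc N. ip (X n) (cr \<xi> x n) (cr \<zeta> y n)) = (\<Sum>n<N. ip (X n) (x n) (fl (ip E \<xi> \<zeta>) y n))"
    unfolding sum.lessThan_Suc_shift using assms(1,3) assms(2,4)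
    by (simp add: cr_component(2) X_ip X_closed)
  then show ?thesis
    using assms F_component[OF fl_in] F_component by (simp add: part_inner cr_component)
qed

lemma cr_in:
  assumes \<xi>: "\<xi> \<in> carrier E" and x: "x \<in> carrier F"
  shows "cr \<xi> x \<in> carrier F"
proof -
  obtain C where C: "C \<ge> 0" "\<And>N h. norm (part N x h) \<le> C * norm h" using x unfolding F_iff by blast
  let ?b = "ip E \<xi> \<xi>"
  have "norm (part N (cr \<xi> x) h) \<le> sqrt (norm ?b) * C * norm h" for N h
  proof (cases N)
    case (Suc M)
    have "(norm (part N (cr \<xi> x) h))\<^sup>2 = cmod (cinner (part M x h) (part M (fl ?b x) h))"
      unfolding Suc by (simp only: part_cr_inner[OF \<xi> \<xi> x x, symmetric] cmod_cinner_self)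
    also have "\<dots> \<le> (C * norm h) * (norm ?b * (C * norm h))"
      using C by (intro order.trans[OF cauchy_schwarz] mult_mono order.trans[OF norm_part_fl_le[OF x, folded fl_apply[OF x]]]
          mult_left_mono) auto
    also have "\<dots> = (sqrt (norm ?b) * C * norm h)\<^sup>2" by (simp add: power_mult_distrib power2_eq_square)
    finally show ?thesis by (rule power2_le_imp_le) (simp add: C)
  qed (simp add: part_def C)
  then show ?thesis
    unfolding F_iff using C(1) cr_component[OF \<xi> x] by (intro conjI exI[of _ "sqrt (norm ?b) * C"]) auto
qed

lemma cr_inner:
  assumes \<xi>: "\<xi> \<in> carrier E" and \<zeta>: "\<zeta> \<in> carrier E" and x: "x \<in> carrier F" and y: "y \<in> carrier F"
  shows "cinner (\<tau> (cr \<xi> x) h) (\<tau> (cr \<zeta> y) k) = cinner (\<tau> x h) (\<tau> (fl (ip E \<xi> \<zeta>) y) k)"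
proof (rule LIMSEQ_unique)
  show "(\<lambda>N. cinner (part (Suc N) (cr \<xi> x) h) (part (Suc N) (cr \<zeta> y) k)) \<longlonglongrightarrow>
      cinner (\<tau> (cr \<xi> x) h) (\<tau> (cr \<zeta> y) k)"
    by (intro tendsto_cinner LIMSEQ_Suc tau_tendsto cr_in \<xi> \<zeta> x y)
  show "(\<lambda>N. cinner (part (Suc N) (cr \<xi> x) h) (part (Suc N) (cr \<zeta> y) k)) \<longlonglongrightarrow>
      cinner (\<tau> x h) (\<tau> (fl (ip E \<xi> \<zeta>) y) k)"
    unfolding part_cr_inner[OF \<xi> \<zeta> x y] by (intro tendsto_cinner tau_tendsto fl_in x y)
qed

text \<open>Here T*T is the left action of \<open>ip E \<xi> \<xi>\<close>, whose powers
  \<open>norm_rho_le\<close> controls. The operator is built directly rather than by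
  \<open>amp_spec\<close>, which would ask for an adjoint of \<open>cr \<xi>\<close> on the
  module.\<close>

lemma creation_operator_exists:
  assumes \<xi>: "\<xi> \<in> carrier E"
  shows "\<exists>B. bounded_clinear B \<and> (\<forall>x\<in>carrier F. \<forall>h. B (\<tau> x h) = \<tau> (cr \<xi> x) h)"
proof -
  let ?b = "ip E \<xi> \<xi>"
  let ?J = "{p :: (nat \<Rightarrow> 'x) \<times> 'h. fst p \<in> carrier F}"
  define q where "q p = (fl ?b (fst p), snd p)" for p :: "(nat \<Rightarrow> 'x) \<times> 'h"
  show ?thesis
  proof (rule operator_from_gram[where J = ?J and q = q and C = "norm ?b" and
        v = "\<lambda>p. \<tau> (fst p) (snd p)" and w = "\<lambda>p. \<tau> (cr \<xi> (fst p)) (snd p)"])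
    show "cinner (\<tau> (cr \<xi> (fst i)) (snd i)) (\<tau> (cr \<xi> (fst j)) (snd j)) =
        cinner (\<tau> (fst (q i)) (snd (q i))) (\<tau> (fst j) (snd j))" if "i \<in> ?J" "j \<in> ?J" for i j
      using that \<xi> ip_star[OF \<xi> \<xi>] rho_adjoint[of ?b "\<tau> (fst i) (snd i)" "\<tau> (fst j) (snd j)"]
      by (simp add: q_def cr_inner rho_tau[symmetric])
    show "q i \<in> ?J" if "i \<in> ?J" for i using that by (simp add: q_def fl_in)
    show "\<exists>D. \<forall>m. norm (\<tau> (fst ((q ^^ m) i)) (snd ((q ^^ m) i))) \<le> D * norm ?b ^ m" if i: "i \<in> ?J" for i
    proof -
      have iter: "fst ((q ^^ m) i) \<in> carrier F \<and>
          norm (\<tau> (fst ((q ^^ m) i)) (snd ((q ^^ m) i))) \<le> norm (\<tau> (fst i) (snd i)) * norm ?b ^ m" for m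
      proof (induction m)
        case (Suc m)
        then have x: "fst ((q ^^ m) i) \<in> carrier F"
          "norm (\<tau> (fst ((q ^^ m) i)) (snd ((q ^^ m) i))) \<le> norm (\<tau> (fst i) (snd i)) * norm ?b ^ m" by blast+
        have "norm (\<tau> (fl ?b (fst ((q ^^ m) i))) (snd ((q ^^ m) i))) \<le>
            norm ?b * (norm (\<tau> (fst i) (snd i)) * norm ?b ^ m)"
          using order.trans[OF norm_rho_le mult_left_mono[OF x(2) norm_ge_zero], of ?b] x(1) by (simp add: rho_tau)
        then show ?case using x(1) by (simp add: q_def[of "(q ^^ m) i"] fl_in mult_ac)
      qed (use i in simp)
      then show ?thesis by blast
    qed
  next
    fix B assume "bounded_clinear B" "\<And>p. p \<in> ?J \<Longrightarrow> B (\<tau> (fst p) (snd p)) = \<tau> (cr \<xi> (fst p)) (snd p)"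
    then show ?thesis by (intro exI[of _ B]) auto
  qed simp
qed

definition Cop :: "'e \<Rightarrow> 'k \<Rightarrow> 'k" where
  "Cop \<xi> = (SOME B. bounded_clinear B \<and> (\<forall>x\<in>carrier F. \<forall>h. B (\<tau> x h) = \<tau> (cr \<xi> x) h))"

lemma Cop:
  assumes "\<xi> \<in> carrier E"
  shows "bounded_clinear (Cop \<xi>)" "x \<in> carrier F \<Longrightarrow> Cop \<xi> (\<tau> x h) = \<tau> (cr \<xi> x) h"
  using someI_ex[OF creation_operator_exists[OF assms]] unfolding Cop_def by blast+

lemma Cop_inner:
  assumes \<xi>: "\<xi> \<in> carrier E" and \<zeta>: "\<zeta> \<in> carrier E"
  shows "cinner (Cop \<xi> u) (Cop \<zeta> v) = cinner u (rho (ip E \<xi> \<zeta>) v)"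
proof (rule dense_eq_sesquilinear[where B = "\<lambda>u. u" and G = "{\<tau> x h | x h. x \<in> carrier F}"
      and G' = "{\<tau> x h | x h. x \<in> carrier F}", OF Cop(1)[OF \<xi>] _ Cop(1)[OF \<zeta>] rho_bounded tau_total tau_total])
  fix u v assume "u \<in> {\<tau> x h | x h. x \<in> carrier F}" "v \<in> {\<tau> x h | x h. x \<in> carrier F}"
  then show "cinner (Cop \<xi> u) (Cop \<zeta> v) = cinner u (rho (ip E \<xi> \<zeta>) v)"
    using Cop(2)[OF \<xi>] Cop(2)[OF \<zeta>] by (auto simp: cr_inner \<xi> \<zeta> rho_tau)
qed (rule bounded_clinear_ident)

lemma rho_Cop:
  assumes \<xi>: "\<xi> \<in> carrier E"
  shows "rho a (Cop \<xi> u) = Cop (\<phi> a \<xi>) u"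
proof (rule eq_on_tau[of "\<lambda>u. rho a (Cop \<xi> u)"])
  have a\<xi>: "\<phi> a \<xi> \<in> carrier E" using \<xi> by (rule act_closed)
  then show "bounded_clinear (Cop (\<phi> a \<xi>))" by (rule Cop(1))
  fix x h assume x: "x \<in> carrier F"
  have "fl a (cr \<xi> x) n = cr (\<phi> a \<xi>) x n" for n
  proof (cases n)
    case 0
    show ?thesis by (simp add: psi_zero 0 fl_apply cr_in \<xi> x cr_component a\<xi>)
  next
    case (Suc m)
    then show ?thesis by (simp add: fl_apply cr_in \<xi> x cr_component a\<xi> tens_simps F_component)
  qed
  then have "fl a (cr \<xi> x) = cr (\<phi> a \<xi>) x" by (rule ext)
  then show "rho a (Cop \<xi> (\<tau> x h)) = Cop (\<phi> a \<xi>) (\<tau> x h)"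
    by (simp add: Cop \<xi> a\<xi> x rho_tau cr_in)
qed (rule bounded_clinear_compose[OF rho_bounded Cop(1)[OF \<xi>]])

subsection \<open>The grading\<close>

definition level :: "nat \<Rightarrow> 'k set" where
  "level n = closure (cspan {tau n x h | x h. x \<in> carrier (X n)})"

definition P :: "nat \<Rightarrow> 'k \<Rightarrow> 'k" where "P n = orth_proj (level n)"

lemma level_closed: "csubspace (level n)" "closed (level n)"
  unfolding level_def by (rule csubspace_closure_cspan) simp

lemma P_bounded: "bounded_clinear (P n)"
  unfolding P_def by (rule bounded_clinear_orth_proj[OF level_closed])

lemma P_tau:
  assumes x: "x \<in> carrier F"
  shows "P n (\<tau> x h) = tau n (x n) h"
  unfolding P_def
proof (rule orth_proj_unique[OF level_closed])
  show "tau n (x n) h \<in> level n"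
    unfolding level_def by (rule in_closure_cspan) (use F_component[OF x] in blast)
  fix s assume "s \<in> level n"
  then show "cinner (\<tau> x h - tau n (x n) h) s = 0"
    unfolding level_def
    by (rule orthogonal_closure_cspan[rotated])
       (auto simp: cinner_diff tau_tau x tau_inner_n F_component[OF x])
qed

lemma P_tau_n:
  assumes x: "x \<in> carrier (X n)"
  shows "P m (tau n x h) = (if m = n then tau n x h else 0)"
proof -
  have "tau m (incl n x m) h = (if m = n then tau n x h else 0)"
    by (simp add: incl_def tau_zero)
  then show ?thesis using P_tau[OF incl_in[OF x], of m h] by (simp add: tau_def)
qed

lemma P_selfadjoint: "cinner (P n u) v = cinner u (P n v)"
  unfolding P_def by (rule orth_proj_selfadjoint[OF level_closed])

lemma P_in: "P n u \<in> level n"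
  unfolding P_def by (rule orth_proj_in[OF level_closed])

lemma P_P: "P m (P n u) = (if m = n then P n u else 0)"
proof (rule eq_on_tau[of "\<lambda>u. P m (P n u)"])
  show "bounded_clinear (\<lambda>u. if m = n then P n u else 0)"
    by (cases "m = n") (simp_all add: P_bounded bounded_clinear_zero)
  show "P m (P n (\<tau> x h)) = (if m = n then P n (\<tau> x h) else 0)" if "x \<in> carrier F" for x h
    using that F_component[OF that] by (simp add: P_tau P_tau_n)
qed (rule bounded_clinear_compose[OF P_bounded P_bounded])

lemmas P_linear = bounded_clinear_simps(2-6)[OF P_bounded]

lemma P_rho: "P n (rho a u) = rho a (P n u)"
proof (rule eq_on_tau[of "\<lambda>u. P n (rho a u)" "\<lambda>u. rho a (P n u)"])
  fix x h assume x: "x \<in> carrier F"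
  have xn: "x n \<in> carrier (X n)" by (rule F_component[OF x])
  then show "P n (rho a (\<tau> x h)) = rho a (P n (\<tau> x h))"
    by (simp add: rho_tau P_tau fl_in x tau_def incl_in fl_incl) (simp add: fl_apply x)
qed (rule bounded_clinear_compose[OF P_bounded rho_bounded] bounded_clinear_compose[OF rho_bounded P_bounded])+

lemma rho_tau_n: "x \<in> carrier (X n) \<Longrightarrow> rho a (tau n x h) = tau n (\<psi> n a x) h"
  by (simp add: tau_def rho_tau incl_in fl_incl)

lemma P_Cop:
  assumes \<xi>: "\<xi> \<in> carrier E"
  shows "P (Suc n) (Cop \<xi> u) = Cop \<xi> (P n u)" "P 0 (Cop \<xi> u) = 0"
proof -
  show "P (Suc n) (Cop \<xi> u) = Cop \<xi> (P n u)"
  proof (rule eq_on_tau[of "\<lambda>u. P (Suc n) (Cop \<xi> u)" "\<lambda>u. Cop \<xi> (P n u)"])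
    fix x h assume x: "x \<in> carrier F"
    have xn: "x n \<in> carrier (X n)" by (rule F_component[OF x])
    have "cr \<xi> (incl n (x n)) m = incl (Suc n) (tens n \<xi> (x n)) m" for m
      by (cases m) (simp_all add: cr_component \<xi> incl_in xn, simp_all add: incl_def tens_zero \<xi>)
    then have "cr \<xi> (incl n (x n)) = incl (Suc n) (tens n \<xi> (x n))" by (rule ext)
    then show "P (Suc n) (Cop \<xi> (\<tau> x h)) = Cop \<xi> (P n (\<tau> x h))"
      by (simp add: Cop \<xi> x P_tau cr_in cr_component tau_def incl_in xn)
  qed (rule bounded_clinear_compose[OF P_bounded Cop(1)[OF \<xi>]] bounded_clinear_compose[OF Cop(1)[OF \<xi>] P_bounded])+
  show "P 0 (Cop \<xi> u) = 0"
  proof (rule eq_on_tau[of "\<lambda>u. P 0 (Cop \<xi> u)" "\<lambda>u. 0"])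
    fix x h assume "x \<in> carrier F"
    then show "P 0 (Cop \<xi> (\<tau> x h)) = 0" by (simp add: Cop \<xi> P_tau cr_in cr_component tau_zero)
  qed (rule bounded_clinear_compose[OF P_bounded Cop(1)[OF \<xi>]] bounded_clinear_zero)+
qed

end

context fock_rep
begin

subsection \<open>Normality of vector functionals\<close>

text \<open>Elementary tensors can be rescaled: with \<open>s = (\<epsilon>\<^sup>2 + \<langle>x, x\<rangle>)\<^sup>1\<^sup>/\<^sup>2\<close> one has
  \<open>x \<otimes> h = x s\<^sup>-\<^sup>1 \<otimes> s h\<close>, where \<open>\<parallel>x s\<^sup>-\<^sup>1\<parallel> \<le> 1\<close> and \<open>\<parallel>s h\<parallel>\<close> is close to \<open>\<parallel>x \<otimes> h\<parallel>\<close>.\<close>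

lemma elementary_tensor_rescale:
  assumes x: "x \<in> carrier F" and e: "e > 0"
  shows "\<exists>y\<in>carrier F. \<exists>k. \<tau> x h = \<tau> y k \<and> hnorm F y \<le> 1 \<and> norm k \<le> norm (\<tau> x h) + e"
proof -
  define a where "a = ip F x x"
  \<comment> \<open>Plays \<epsilon>^2; it is scaled so that sqrt e0 * norm h <= e, which bounds the
    excess in the norm of the new vector.\<close>
  define e0 where "e0 = (e / (norm h + 1))\<^sup>2"
  define t where "t = norm a + 1"
  define \<kappa> where "\<kappa> = e0 + t"
  have nh: "norm h + 1 > 0" using norm_ge_zero[of h] by linarith
  have "e0 > 0" unfolding e0_def using e nh by (intro zero_less_power divide_pos_pos)
  moreover have "t > 0" unfolding t_def using norm_ge_zero[of a] by linarith
  ultimately have pos: "e0 > 0" "t > 0" "\<kappa> > 0" unfolding \<kappa>_def by simp_all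
  have sa: "star a = a"
  proof (rule pi_inject)
    fix h k
    have "cinner h (\<pi> (star a) k) = cnj (cinner k (\<pi> a h))"
      using pi_adjoint'[of a h k] cinner_commute[of "\<pi> a h" k] by simp
    also have "\<dots> = cinner h (\<pi> a k)"
      unfolding a_def tau_inner[OF x x, symmetric] by (rule cinner_commute[symmetric])
    finally show "cinner h (\<pi> (star a) k) = cinner h (\<pi> a k)" .
  qed
  have quad: "cinner k (\<pi> a k) = complex_of_real ((norm (\<tau> x k))\<^sup>2)" for k
    unfolding a_def tau_inner[OF x x, symmetric] by (rule cinner_self)
  \<comment> \<open>The operator inequality a^2 <= norm a * a, written with the form <k, \<pi> a k>
    = |x \<otimes> k|^2.\<close>
  have square: "(norm (\<pi> a k))\<^sup>2 \<le> norm a * (norm (\<tau> x k))\<^sup>2" for k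
  proof -
    have "hnorm F x = sqrt (norm a)" by (simp add: hnorm_def a_def)
    then have bound: "norm (\<tau> x (\<pi> a k)) \<le> sqrt (norm a) * norm (\<pi> a k)"
      using norm_tau_le[OF x] by metis
    have "(norm (\<pi> a k))\<^sup>2 = cmod (cinner (\<pi> a k) (\<pi> a k))" by (rule cmod_cinner_self[symmetric])
    also have "\<dots> = cmod (cinner (\<tau> x (\<pi> a k)) (\<tau> x k))" unfolding tau_inner[OF x x] a_def ..
    also have "\<dots> \<le> (sqrt (norm a) * norm (\<pi> a k)) * norm (\<tau> x k)"
      by (intro order.trans[OF cauchy_schwarz] mult_right_mono bound) simp
    finally have "norm (\<pi> a k) * norm (\<pi> a k) \<le> norm (\<pi> a k) * (sqrt (norm a) * norm (\<tau> x k))"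
      by (simp add: power2_eq_square mult_ac)
    then have "norm (\<pi> a k) \<le> sqrt (norm a) * norm (\<tau> x k)"
      by (cases "norm (\<pi> a k) = 0") auto
    then have "(norm (\<pi> a k))\<^sup>2 \<le> (sqrt (norm a) * norm (\<tau> x k))\<^sup>2" by (rule power_mono) simp
    then show ?thesis by (simp add: power_mult_distrib)
  qed
  \<comment> \<open>A contraction because 0 <= a <= t; the contractivity is checked on vectors
    through \<open>square\<close>, and \<open>norm_le_pi\<close> brings it back to the
    algebra.\<close>
  define d where "d = 1 - complex_of_real (1 / t) *\<^sub>C a"
  have pid: "norm (\<pi> d k) \<le> norm k" for k
  proof (rule power2_le_imp_le)
    have "\<pi> d k = k + (- complex_of_real (1 / t)) *\<^sub>C \<pi> a k"
      unfolding d_def by (simp add: pi_diff pi_one pi_simps)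
    then have "(norm (\<pi> d k))\<^sup>2 = (norm k)\<^sup>2 + (1 / t)\<^sup>2 * (norm (\<pi> a k))\<^sup>2 - 2 / t * (norm (\<tau> x k))\<^sup>2"
      using pos(2) by (simp only: norm_add_sq norm_scaleC cinner_linear quad)
        (simp add: norm_divide power_mult_distrib power_divide)
    also have "(1 / t)\<^sup>2 * (norm (\<pi> a k))\<^sup>2 \<le> (1 / t)\<^sup>2 * (t * (norm (\<tau> x k))\<^sup>2)"
      by (intro mult_left_mono order.trans[OF square] mult_right_mono) (auto simp: t_def)
    also have "(1 / t)\<^sup>2 * (t * (norm (\<tau> x k))\<^sup>2) = 1 / t * (norm (\<tau> x k))\<^sup>2"
      using pos(2) by (simp add: power2_eq_square)
    finally have "(norm (\<pi> d k))\<^sup>2 \<le> (norm k)\<^sup>2 - 1 / t * (norm (\<tau> x k))\<^sup>2" by simp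
    then show "(norm (\<pi> d k))\<^sup>2 \<le> (norm k)\<^sup>2" using pos(2) by (smt (verit) divide_nonneg_pos mult_nonneg_nonneg zero_le_power2)
  qed simp
  have nd: "norm d \<le> 1"
    by (rule norm_le_pi) (auto intro!: order.trans[OF cauchy_schwarz] mult_left_mono pid)
  \<comment> \<open>Chosen so that \<kappa> (1 - c) = e0 + a with norm c < 1: the square root of e0
    + a is then sqrt \<kappa> times the one supplied by \<open>square_root_exists\<close>.\<close>
  define c where "c = complex_of_real (t / \<kappa>) *\<^sub>C d"
  have "norm c \<le> t / \<kappa>" unfolding c_def using nd pos by (simp add: norm_scaleC norm_divide divide_le_cancel mult_left_le)
  also have "\<dots> < 1" using pos by (simp add: \<kappa>_def)
  finally have c1: "norm c < 1" .
  have sc: "star c = c" unfolding c_def d_def by (simp add: star_scaleC star_diff sa)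
  obtain s w where s: "star s = s" "s * s = 1 - c" "s * w = 1" "w * s = 1" "star w = w"
    using square_root_exists[OF sc c1] by blast
  define r where "r = complex_of_real (sqrt \<kappa>) *\<^sub>C s"
  define v where "v = complex_of_real (1 / sqrt \<kappa>) *\<^sub>C w"
  have sk: "complex_of_real (sqrt \<kappa>) * complex_of_real (sqrt \<kappa>) = complex_of_real \<kappa>"
    "sqrt \<kappa> > 0" using pos(3) by (simp_all add: of_real_mult[symmetric] del: of_real_mult)
  have "complex_of_real \<kappa> *\<^sub>C (1 - c) = complex_of_real \<kappa> *\<^sub>C 1 - complex_of_real t *\<^sub>C d"
    unfolding c_def using pos(3) by (simp add: scaleC_diff scaleC_scaleC)
  also have "\<dots> = complex_of_real e0 *\<^sub>C 1 + a"
    unfolding d_def \<kappa>_def using pos(2) by (simp add: scaleC_diff scaleC_scaleC scaleC_add_left scaleC_one)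
  finally have "r * r = complex_of_real e0 *\<^sub>C 1 + a"
    unfolding r_def by (simp add: scaleC_mult_left scaleC_mult_right scaleC_scaleC sk s(2))
  then have rr: "cinner (\<pi> r k) (\<pi> r k) = complex_of_real (e0 * (norm k)\<^sup>2 + (norm (\<tau> x k))\<^sup>2)" for k
  proof -
    have "star r = r" unfolding r_def by (simp add: star_scaleC s(1))
    then have "cinner (\<pi> r k) (\<pi> r k) = cinner k (\<pi> (r * r) k)"
      using pi_adjoint'[of r k] by (simp add: pi_simps)
    then show ?thesis
      using \<open>r * r = _\<close> by (simp add: pi_simps pi_one cinner_linear quad cinner_self)
  qed
  have rr': "(norm (\<pi> r k))\<^sup>2 = e0 * (norm k)\<^sup>2 + (norm (\<tau> x k))\<^sup>2" for k
    using rr[of k] unfolding cinner_self by (simp only: of_real_eq_iff)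
  have "v * r = 1" "r * v = 1"
    unfolding r_def v_def using sk(2)
    by (simp_all add: scaleC_mult_left scaleC_mult_right scaleC_scaleC s scaleC_one)
  then have vr: "\<pi> v (\<pi> r k) = k" "\<pi> r (\<pi> v k) = k" for k
    by (metis pi_simps(4) pi_one)+
  define y where "y = ract F x v"
  have y: "y \<in> carrier F" "\<And>k. \<tau> y k = \<tau> x (\<pi> v k)" unfolding y_def by (rule F_ract[OF x])+
  show ?thesis
  proof (intro bexI[OF _ y(1)] exI[of _ "\<pi> r h"] conjI)
    show "\<tau> x h = \<tau> y (\<pi> r h)" by (simp add: y vr)
    show "hnorm F y \<le> 1"
    proof (rule hnorm_le[OF y(1)])
      fix k
      have "(norm (\<tau> y k))\<^sup>2 \<le> (norm (\<pi> r (\<pi> v k)))\<^sup>2"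
        unfolding y rr' using pos(1) by simp
      then have "norm (\<tau> y k) \<le> norm (\<pi> r (\<pi> v k))" by (rule power2_le_imp_le) simp
      then show "norm (\<tau> y k) \<le> 1 * norm k" by (simp add: vr)
    qed simp
    show "norm (\<pi> r h) \<le> norm (\<tau> x h) + e"
    proof (rule power2_le_imp_le)
      have "sqrt (e0 * (norm h)\<^sup>2) \<le> e"
        unfolding e0_def using e nh
        by (simp add: real_sqrt_mult pos_divide_le_eq distrib_left)
      then have "e0 * (norm h)\<^sup>2 \<le> e\<^sup>2"
        using e by (metis less_imp_le real_sqrt_le_iff real_sqrt_unique)
      then show "(norm (\<pi> r h))\<^sup>2 \<le> (norm (\<tau> x h) + e)\<^sup>2"
        unfolding rr' using mult_nonneg_nonneg[OF norm_ge_zero less_imp_le[OF e], of "\<tau> x h"]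
        by (simp add: power2_sum)
    qed (use e in simp)
  qed
qed

text \<open>Normal functionals allow only module elements with summable norms, while z is an
  arbitrary vector. Tested against tensors with the fixed right factor h, z may be replaced by its
  projection onto their closed span; a telescoping series approximates that, and rescaling each term
  moves the geometric decay into \<open>hs\<close>.\<close>

lemma series_decomposition:
  shows "\<exists>ys hs D. (\<forall>j. ys j \<in> carrier F \<and> hnorm F (ys j) \<le> 1 \<and> norm (hs j) \<le> D * (1/2) ^ j) \<and>
    (\<forall>y\<in>carrier F. (\<lambda>j. cinner (\<tau> y h) (\<tau> (ys j) (hs j))) sums cinner (\<tau> y h) z)"
proof -
  \<comment> \<open>With h fixed the elementary tensors already form a subspace, so no span is
    taken.\<close>
  define V where "V = closure {\<tau> y h | y. y \<in> carrier F}"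
  have "csubspace {\<tau> y h | y. y \<in> carrier F}"
    unfolding complex_vec.subspace_def
    by (auto intro: exI[of _ 0] simp: F_closed F_zero)
      (metis F_add, metis F_scale)
  then have V: "csubspace V" "closed V" unfolding V_def by (auto intro: csubspace_closure)
  define p where "p = orth_proj V z"
  have pV: "p \<in> V" unfolding p_def by (rule orth_proj_in[OF V])
  have pz: "cinner (\<tau> y h) p = cinner (\<tau> y h) z" if "y \<in> carrier F" for y
  proof -
    have "\<tau> y h \<in> V" unfolding V_def by (rule subsetD[OF closure_subset]) (use that in blast)
    then have "cinner (z - p) (\<tau> y h) = 0" unfolding p_def by (rule orth_proj_orth[OF V])
    then have "cinner (\<tau> y h) (z - p) = 0" by (subst cinner_commute) simp
    then show ?thesis by (simp add: cinner_diff)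
  qed
  have "\<exists>y\<in>carrier F. norm (\<tau> y h - p) < (1/2) ^ j" for j :: nat
  proof -
    have "\<exists>v\<in>{\<tau> y h | y. y \<in> carrier F}. dist v p < (1/2) ^ j"
      using pV[unfolded V_def closure_approachable, rule_format, of "(1/2) ^ j"] by simp
    then show ?thesis by (auto simp: dist_norm)
  qed
  then obtain y where y: "\<And>j. y j \<in> carrier F" "\<And>j. norm (\<tau> (y j) h - p) < (1/2) ^ j" by metis
  define d where "d j = (if j = 0 then y 0 else y j - y (j - 1))" for j
  have d: "d j \<in> carrier F" for j unfolding d_def using y F_closed by simp
  \<comment> \<open>For j > 0, |d j \<otimes> h| <= (1/2)^j + (1/2)^(j - 1) = 3 (1/2)^j, and
    rescaling adds one more (1/2)^j; the norm term covers j = 0.\<close>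
  define D where "D = norm (\<tau> (y 0) h) + 4"
  have nd: "norm (\<tau> (d j) h) + (1/2) ^ j \<le> D * (1/2) ^ j" for j
  proof (cases j)
    case (Suc i)
    have "norm (\<tau> (d j) h) \<le> norm (\<tau> (y j) h - p) + norm (\<tau> (y i) h - p)"
      unfolding d_def Suc using norm_triangle_ineq4[of "\<tau> (y (Suc i)) h - p" "\<tau> (y i) h - p"] y
      by (simp add: F_diff)
    also have "\<dots> \<le> (1/2) ^ j + (1/2) ^ i" using y(2)[of j] y(2)[of i] by simp
    also have "\<dots> = 3 * (1/2) ^ j" unfolding Suc by simp
    finally have "norm (\<tau> (d j) h) + (1/2) ^ j \<le> 4 * (1/2) ^ j" by simp
    also have "\<dots> \<le> D * (1/2) ^ j" unfolding D_def by (intro mult_right_mono) auto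
    finally show ?thesis .
  qed (simp add: d_def D_def)
  have "\<exists>y'\<in>carrier F. \<exists>k. \<tau> (d j) h = \<tau> y' k \<and> hnorm F y' \<le> 1 \<and> norm k \<le> norm (\<tau> (d j) h) + (1/2) ^ j" for j
    by (rule elementary_tensor_rescale[OF d]) simp
  then obtain ys hs where ys: "\<And>j. ys j \<in> carrier F" "\<And>j. \<tau> (d j) h = \<tau> (ys j) (hs j)"
    "\<And>j. hnorm F (ys j) \<le> 1" "\<And>j. norm (hs j) \<le> norm (\<tau> (d j) h) + (1/2) ^ j"
    by metis
  have tele: "(\<Sum>j<Suc n. \<tau> (d j) h) = \<tau> (y n) h" for n
  proof (induction n)
    case (Suc n)
    then show ?case by (simp add: d_def F_diff y)
  qed (simp add: d_def)
  have "(\<lambda>n. \<tau> (y n) h) \<longlonglongrightarrow> p"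
  proof (rule LIM_zero_cancel, rule Lim_null_comparison)
    show "\<forall>\<^sub>F n in sequentially. norm (\<tau> (y n) h - p) \<le> (1/2) ^ n" using y(2) by (simp add: less_imp_le)
    show "(\<lambda>n. (1/2 :: real) ^ n) \<longlonglongrightarrow> 0" by (rule LIMSEQ_power_zero) simp
  qed
  then have "(\<lambda>n. \<Sum>j<Suc n. \<tau> (d j) h) \<longlonglongrightarrow> p" by (simp only: tele)
  then have "(\<lambda>j. \<tau> (ys j) (hs j)) sums p"
    unfolding sums_def ys(2)[symmetric] by (rule LIMSEQ_imp_Suc)
  then have "(\<lambda>j. cinner (\<tau> y h) (\<tau> (ys j) (hs j))) sums cinner (\<tau> y h) z" if "y \<in> carrier F" for y
    using bounded_linear.sums[OF bounded_linear_cinner_right] pz[OF that] by metis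
  then show ?thesis using ys nd order.trans[OF ys(4) nd] by blast
qed

lemma onorm_vector_functional: "onorm (\<lambda>a. cinner h (\<pi> a k)) \<le> norm h * norm k"
proof (rule onorm_bound)
  show "norm (cinner h (\<pi> a k)) \<le> norm h * norm k * norm a" for a
    using order.trans[OF cauchy_schwarz mult_left_mono[OF pi_contractive norm_ge_zero], of h a k]
    by (simp add: mult_ac)
qed simp

text \<open>With an adjoint S of T, <x \<otimes> h, T z> = <S x \<otimes> h, z>, and
  \<open>series_decomposition\<close> expands z against tensors with right factor h. The elementary
  vector x \<otimes> h is what provides this fixed right factor.\<close>

lemma normal_functional_right:
  assumes x: "x \<in> carrier F"
  shows "\<exists>f\<in>normal_functionals F. \<forall>T\<in>adjointables F. f T = cinner (\<tau> x h) (amp T z)"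
proof -
  have "\<exists>ys hs D. (\<forall>j. ys j \<in> carrier F \<and> hnorm F (ys j) \<le> 1 \<and> norm (hs j) \<le> D * (1/2) ^ j) \<and>
    (\<forall>y\<in>carrier F. (\<lambda>j. cinner (\<tau> y h) (\<tau> (ys j) (hs j))) sums cinner (\<tau> y h) z)"
    by (rule series_decomposition)
  then obtain ys hs D where ys: "\<And>j. ys j \<in> carrier F" "\<And>j. hnorm F (ys j) \<le> 1"
      "\<And>j. norm (hs j) \<le> D * (1/2) ^ j"
    and sums: "\<And>y. y \<in> carrier F \<Longrightarrow> (\<lambda>j. cinner (\<tau> y h) (\<tau> (ys j) (hs j))) sums cinner (\<tau> y h) z"
    by blast
  let ?\<omega> = "\<lambda>j a. cinner h (\<pi> a (hs j))"
  let ?f = "\<lambda>T. \<Sum>j. ?\<omega> j (ip F x (T (ys j)))"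
  have "summable (\<lambda>j. onorm (?\<omega> j) * hnorm F x * hnorm F (ys j))"
  proof (rule summable_comparison_test')
    show "summable (\<lambda>j. norm h * D * hnorm F x * (1/2) ^ j)"
      by (intro summable_mult summable_geometric) simp
    fix j
    have o: "0 \<le> onorm (?\<omega> j)" by (rule predual_functional(7)[OF vector_functional])
    have "onorm (?\<omega> j) * hnorm F x * hnorm F (ys j) \<le> (norm h * (D * (1/2) ^ j)) * hnorm F x * 1"
      by (intro mult_mono order.trans[OF onorm_vector_functional] mult_left_mono ys mult_nonneg_nonneg
          hnorm_nonneg o order.trans[OF norm_ge_zero ys(3)]) auto
    then show "norm (onorm (?\<omega> j) * hnorm F x * hnorm F (ys j)) \<le> norm h * D * hnorm F x * (1/2) ^ j"
      using o hnorm_nonneg[of F] by (simp add: mult_ac)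
  qed
  then have mem: "?f \<in> normal_functionals F"
    unfolding normal_functionals_def mem_Collect_eq using x ys(1) vector_functional
    by - (rule exI[of _ ?\<omega>], rule exI[of _ "\<lambda>j. x"], rule exI[of _ ys], simp)
  have eq: "?f T = cinner (\<tau> x h) (amp T z)" if T: "T \<in> adjointables F" for T
  proof -
    obtain S where S: "adj_pair S T" using adjointable_pair[OF T] by blast
    have "?\<omega> j (ip F x (T (ys j))) = cinner (\<tau> (S x) h) (\<tau> (ys j) (hs j))" for j
      using adj_pairD[OF S] by (simp add: tau_inner x ys)
    then have "?f T = cinner (\<tau> (S x) h) z"
      using sums[OF adj_pairD(1)[OF S x]] by (simp add: sums_iff)
    also have "\<dots> = cinner (amp S (\<tau> x h)) z" by (simp add: amp_spec(2)[OF adj_pair_sym[OF S] x])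
    finally show ?thesis by (simp add: amp_adjoint[OF S])
  qed
  show ?thesis by (rule bexI[of _ ?f], rule ballI, erule eq, rule mem)
qed

lemma normal_functional_left:
  assumes x: "x \<in> carrier F"
  shows "\<exists>f\<in>normal_functionals F. \<forall>T\<in>adjointables F. f T = cinner z (amp T (\<tau> x h))"
proof -
  have "\<exists>ys hs D. (\<forall>j. ys j \<in> carrier F \<and> hnorm F (ys j) \<le> 1 \<and> norm (hs j) \<le> D * (1/2) ^ j) \<and>
    (\<forall>y\<in>carrier F. (\<lambda>j. cinner (\<tau> y h) (\<tau> (ys j) (hs j))) sums cinner (\<tau> y h) z)"
    by (rule series_decomposition)
  then obtain ys hs D where ys: "\<And>j. ys j \<in> carrier F" "\<And>j. hnorm F (ys j) \<le> 1"
      "\<And>j. norm (hs j) \<le> D * (1/2) ^ j"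
    and sums: "\<And>y. y \<in> carrier F \<Longrightarrow> (\<lambda>j. cinner (\<tau> y h) (\<tau> (ys j) (hs j))) sums cinner (\<tau> y h) z"
    by blast
  have sums': "(\<lambda>j. cinner (\<tau> (ys j) (hs j)) (\<tau> y h)) sums cinner z (\<tau> y h)" if "y \<in> carrier F" for y
    using sums_cnj[THEN iffD2, OF sums[OF that]] by (simp only: cinner_commute[symmetric])
  let ?\<omega> = "\<lambda>j a. cinner (hs j) (\<pi> a h)"
  let ?f = "\<lambda>T. \<Sum>j. ?\<omega> j (ip F (ys j) (T x))"
  have "summable (\<lambda>j. onorm (?\<omega> j) * hnorm F (ys j) * hnorm F x)"
  proof (rule summable_comparison_test')
    show "summable (\<lambda>j. norm h * D * hnorm F x * (1/2) ^ j)"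
      by (intro summable_mult summable_geometric) simp
    fix j
    have o: "0 \<le> onorm (?\<omega> j)" by (rule predual_functional(7)[OF vector_functional])
    have "onorm (?\<omega> j) * hnorm F (ys j) * hnorm F x \<le> ((D * (1/2) ^ j) * norm h) * 1 * hnorm F x"
      by (intro mult_mono order.trans[OF onorm_vector_functional] mult_right_mono ys mult_nonneg_nonneg
          hnorm_nonneg o order.trans[OF norm_ge_zero ys(3)]) auto
    then show "norm (onorm (?\<omega> j) * hnorm F (ys j) * hnorm F x) \<le> norm h * D * hnorm F x * (1/2) ^ j"
      using o hnorm_nonneg[of F] by (simp add: mult_ac)
  qed
  then have mem: "?f \<in> normal_functionals F"
    unfolding normal_functionals_def mem_Collect_eq using x ys(1) vector_functional
    by - (rule exI[of _ ?\<omega>], rule exI[of _ ys], rule exI[of _ "\<lambda>j. x"], simp)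
  have eq: "?f T = cinner z (amp T (\<tau> x h))" if T: "T \<in> adjointables F" for T
  proof -
    obtain S where S: "adj_pair S T" using adjointable_pair[OF T] by blast
    have Tx: "T x \<in> carrier F" by (rule adj_pairD(2)[OF S x])
    have "?\<omega> j (ip F (ys j) (T x)) = cinner (\<tau> (ys j) (hs j)) (\<tau> (T x) h)" for j
      by (simp add: tau_inner Tx ys)
    then have "?f T = cinner z (\<tau> (T x) h)" using sums'[OF Tx] by (simp add: sums_iff)
    then show ?thesis by (simp add: amp_spec(2)[OF S x])
  qed
  show ?thesis by (rule bexI[of _ ?f], rule ballI, erule eq, rule mem)
qed

subsection \<open>Invariant subspaces of the Hardy algebra\<close>

abbreviation "hardy_generators \<equiv> creation X tens ` carrier E \<union> range (fock_left X \<psi>)"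

lemma normal_functionals_nonempty: "(\<lambda>T. 0) \<in> normal_functionals F"
  using normal_functional_single[OF predual_zero F_closed(1) F_closed(1)] by simp

lemma hardy_adjointable:
  assumes T: "T \<in> hardy_algebra E X \<psi> tens"
  shows "T \<in> adjointables F"
proof -
  have "normal_functionals F \<noteq> {}"
    by (rule notI) (use normal_functionals_nonempty in simp)
  then have top: "topspace (initial_topology (adjointables F) (normal_functionals F)) = adjointables F"
    by (rule topspace_initial_topology)
  have "hardy_algebra E X \<psi> tens \<subseteq> topspace (initial_topology (adjointables F) (normal_functionals F))"
    unfolding hardy_algebra_def ultraweak_topology_def by (rule closure_of_subset_topspace)
  then show ?thesis using subsetD[OF _ T] top by simp
qed

lemma hardy_functional_eq:
  assumes "T \<in> hardy_algebra E X \<psi> tens" "f \<in> normal_functionals F" "g \<in> normal_functionals F"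
    and "\<And>T. T \<in> generated_algebra hardy_generators \<Longrightarrow> T \<in> adjointables F \<Longrightarrow> f T = g T"
  shows "f T = g T"
  by (rule closure_initial_topology_eq[OF assms(2,3) assms(1)[unfolded hardy_algebra_def ultraweak_topology_def]])
     (rule assms(4))

text \<open>The operator A is built along the induction instead of being written
  \<open>amp T\<close>: a generated T comes here without an adjoint, so \<open>amp_spec\<close> does
  not apply to it.\<close>

lemma generated_algebra_intertwines:
  assumes S: "bounded_clinear S"
    and L: "csubspace L"
    and C: "\<And>\<xi> u. \<xi> \<in> carrier E \<Longrightarrow> u \<in> L \<Longrightarrow> Cop \<xi> u \<in> L \<and> S (Cop \<xi> u) = Cop \<xi> (S u)"
    and R: "\<And>a u. u \<in> L \<Longrightarrow> rho a u \<in> L \<and> S (rho a u) = rho a (S u)"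
    and T: "T \<in> generated_algebra hardy_generators"
  shows "\<exists>A. bounded_clinear A \<and> (\<forall>x\<in>carrier F. T x \<in> carrier F \<and> (\<forall>h. A (\<tau> x h) = \<tau> (T x) h)) \<and>
    (\<forall>u\<in>L. A u \<in> L \<and> S (A u) = A (S u))"
  using T
proof induction
  case (generator T)
  then consider \<xi> where "\<xi> \<in> carrier E" "T = cr \<xi>" | a where "T = fl a" by blast
  then show ?case
  proof cases
    case 1
    then show ?thesis using Cop[OF 1(1)] C[OF 1(1)] cr_in[OF 1(1)] by (intro exI[of _ "Cop \<xi>"]) auto
  next
    case 2
    then show ?thesis using R rho_bounded rho_tau fl_in by (intro exI[of _ "rho a"]) auto
  qed
next
  case (add T U)
  obtain A where A: "bounded_clinear A" "\<forall>x\<in>carrier F. T x \<in> carrier F \<and> (\<forall>h. A (\<tau> x h) = \<tau> (T x) h)"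
    "\<forall>u\<in>L. A u \<in> L \<and> S (A u) = A (S u)" using add.IH(1) by blast
  obtain B where B: "bounded_clinear B" "\<forall>x\<in>carrier F. U x \<in> carrier F \<and> (\<forall>h. B (\<tau> x h) = \<tau> (U x) h)"
    "\<forall>u\<in>L. B u \<in> L \<and> S (B u) = B (S u)" using add.IH(2) by blast
  show ?case
    by (rule exI[of _ "\<lambda>u. A u + B u"])
       (use A B in \<open>simp add: bounded_clinear_add F_add F_add[unfolded plus_fun_def] complex_vec.subspace_add[OF L] bounded_clinear_simps[OF S]\<close>)
next
  case (scale T c)
  obtain A where A: "bounded_clinear A" "\<forall>x\<in>carrier F. T x \<in> carrier F \<and> (\<forall>h. A (\<tau> x h) = \<tau> (T x) h)"
    "\<forall>u\<in>L. A u \<in> L \<and> S (A u) = A (S u)" using scale.IH by blast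
  show ?case
    by (rule exI[of _ "\<lambda>u. c *\<^sub>C A u"])
       (use A in \<open>simp add: bounded_clinear_compose[OF bounded_clinear_scaleC] F_scale F_scale[unfolded scaleC_fun_def]
          complex_vec.subspace_scale[OF L] bounded_clinear_simps[OF S]\<close>)
next
  case (mult T U)
  obtain A where A: "bounded_clinear A" "\<forall>x\<in>carrier F. T x \<in> carrier F \<and> (\<forall>h. A (\<tau> x h) = \<tau> (T x) h)"
    "\<forall>u\<in>L. A u \<in> L \<and> S (A u) = A (S u)" using mult.IH(1) by blast
  obtain B where B: "bounded_clinear B" "\<forall>x\<in>carrier F. U x \<in> carrier F \<and> (\<forall>h. B (\<tau> x h) = \<tau> (U x) h)"
    "\<forall>u\<in>L. B u \<in> L \<and> S (B u) = B (S u)" using mult.IH(2) by blast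
  show ?case
    by (rule exI[of _ "\<lambda>u. A (B u)"]) (use A B in \<open>simp add: bounded_clinear_compose\<close>)
qed

text \<open>Passage to the ultraweak closure. Membership in \<open>L\<close> and commutation with
  \<open>S\<close> become equalities of vector functionals, which are normal if one vector is
  elementary; hence the condition that \<open>L\<close> is spanned by elementary tensors.\<close>

lemma hardy_intertwines:
  assumes S: "bounded_clinear S"
    and L: "L = closure (cspan G)" and G: "\<And>g. g \<in> G \<Longrightarrow> \<exists>x\<in>carrier F. \<exists>h. g = \<tau> x h"
    and C: "\<And>\<xi> u. \<xi> \<in> carrier E \<Longrightarrow> u \<in> L \<Longrightarrow> Cop \<xi> u \<in> L \<and> S (Cop \<xi> u) = Cop \<xi> (S u)"
    and R: "\<And>a u. u \<in> L \<Longrightarrow> rho a u \<in> L \<and> S (rho a u) = rho a (S u)"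
    and T: "T \<in> hardy_algebra E X \<psi> tens" and u: "u \<in> L"
  shows "amp T u \<in> L" "S (amp T u) = amp T (S u)"
proof -
  have Lc: "csubspace L" "closed L" unfolding L by (rule csubspace_closure_cspan) simp
  have Tadj: "T \<in> adjointables F" by (rule hardy_adjointable[OF T])
  obtain T' where T': "adj_pair T' T" using adjointable_pair[OF Tadj] by blast
  note bT = amp_spec(1)[OF T']
  have gen: "v \<in> L \<Longrightarrow> amp U v \<in> L \<and> S (amp U v) = amp U (S v)"
    if Ugen: "U \<in> generated_algebra hardy_generators" for U v
  proof -
    assume v: "v \<in> L"
    obtain A where A: "bounded_clinear A" "\<forall>x\<in>carrier F. U x \<in> carrier F \<and> (\<forall>h. A (\<tau> x h) = \<tau> (U x) h)"
      "\<forall>u\<in>L. A u \<in> L \<and> S (A u) = A (S u)"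
      using generated_algebra_intertwines[OF S Lc(1) C R Ugen] by blast
    have "amp U = A" by (rule amp_eq) (use A in auto)
    then show ?thesis using A(3) v by simp
  qed
  have GL: "g \<in> L" if "g \<in> G" for g unfolding L using that by (rule in_closure_cspan)
  have inG: "amp T g \<in> L" if g: "g \<in> G" for g
  proof -
    obtain x h where x: "x \<in> carrier F" "g = \<tau> x h" using G[OF g] by blast
    \<comment> \<open>The part of \<open>amp T g\<close> orthogonal to \<open>L\<close>. The normal
      functional T -> <w, T g> vanishes on the generated algebra, hence at T.\<close>
    define w where "w = amp T g - orth_proj L (amp T g)"
    have w: "cinner w s = 0" if "s \<in> L" for s
      unfolding w_def by (rule orth_proj_orth[OF Lc that])
    obtain f where f: "f \<in> normal_functionals F" "\<And>T. T \<in> adjointables F \<Longrightarrow> f T = cinner w (amp T (\<tau> x h))"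
      using normal_functional_left[OF x(1)] by blast
    have "f T = 0"
      by (rule hardy_functional_eq[OF T f(1) normal_functionals_nonempty])
         (use f(2) gen GL[OF g] w x(2) in auto)
    then have "cinner w (amp T g) = 0" using f(2)[OF Tadj] x(2) by simp
    moreover have "cinner w (orth_proj L (amp T g)) = 0" by (rule w, rule orth_proj_in[OF Lc])
    ultimately have "cinner w w = 0" by (simp add: w_def cinner_diff(2))
    then have "amp T g = orth_proj L (amp T g)" by (simp add: cinner_self w_def)
    then show ?thesis using orth_proj_in[OF Lc] by metis
  qed
  show "amp T u \<in> L"
    by (rule bounded_clinear_image_closure_cspan[OF bT inG Lc]) (use u L in auto)
  have SG: "S (amp T g) = amp T (S g)" if g: "g \<in> G" for g
  proof (rule tau_total_ext)
    fix y k assume y: "y \<in> carrier F"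
    obtain x h where x: "x \<in> carrier F" "g = \<tau> x h" using G[OF g] by blast
    \<comment> \<open>The adjoint moves S to the left vector, so that the right vector stays
      elementary and \<open>normal_functional_left\<close> applies.\<close>
    obtain S' where S': "\<And>x y. cinner (S' x) y = cinner x (S y)" using adjoint_exists[OF S] by blast
    obtain f1 where f1: "f1 \<in> normal_functionals F" "\<And>T. T \<in> adjointables F \<Longrightarrow> f1 T = cinner (S' (\<tau> y k)) (amp T (\<tau> x h))"
      using normal_functional_left[OF x(1)] by blast
    obtain f2 where f2: "f2 \<in> normal_functionals F" "\<And>T. T \<in> adjointables F \<Longrightarrow> f2 T = cinner (\<tau> y k) (amp T (S g))"
      using normal_functional_right[OF y] by blast
    have "f1 T = f2 T"
      by (rule hardy_functional_eq[OF T f1(1) f2(1)])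
         (use f1(2) f2(2) gen GL[OF g] x(2) S' in auto)
    then show "cinner (\<tau> y k) (S (amp T g)) = cinner (\<tau> y k) (amp T (S g))"
      using f1(2)[OF Tadj] f2(2)[OF Tadj] S' x(2) by simp
  qed
  show "S (amp T u) = amp T (S u)"
    by (rule bounded_clinear_eq_on_closure[OF bounded_clinear_compose[OF S bT] bounded_clinear_compose[OF bT S] SG])
       (use u L in auto)
qed

end

context fock_rep
begin

subsection \<open>Intertwiners between the levels\<close>

definition Cops :: "'e list \<Rightarrow> 'k \<Rightarrow> 'k" where "Cops \<xi>s u = foldr Cop \<xi>s u"

lemma Cops_simps: "Cops [] u = u" "Cops (\<xi> # \<xi>s) u = Cop \<xi> (Cops \<xi>s u)"
  by (simp_all add: Cops_def)

lemma Cops_bounded: "set \<xi>s \<subseteq> carrier E \<Longrightarrow> bounded_clinear (Cops \<xi>s)"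
proof (induction \<xi>s)
  case Nil
  then show ?case using bounded_clinear_ident by (simp add: Cops_simps[abs_def])
next
  case (Cons \<xi> \<xi>s)
  then show ?case
    using bounded_clinear_compose[OF Cop(1)[of \<xi>], of "Cops \<xi>s"] by (simp add: Cops_simps[abs_def])
qed

lemma P_Cops: "set \<xi>s \<subseteq> carrier E \<Longrightarrow> P (length \<xi>s + n) (Cops \<xi>s u) = Cops \<xi>s (P n u)"
  by (induction \<xi>s) (simp_all add: Cops_simps P_Cop)

lemma rho_Cops: "\<xi> \<in> carrier E \<Longrightarrow> rho a (Cops (\<xi> # \<xi>s) u) = Cops (\<phi> a \<xi> # \<xi>s) u"
  by (simp add: Cops_simps rho_Cop)

text \<open>Stripping the first letters leaves the coefficient \<open>ip E \<xi> \<zeta>\<close>,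
  which is absorbed into the next letter of the second word through the left action; only an algebra
  element remains at the end.\<close>

lemma Cops_inner:
  assumes "set \<xi>s \<subseteq> carrier E" "set \<zeta>s \<subseteq> carrier E" "length \<xi>s = length \<zeta>s"
  shows "\<exists>a. \<forall>u v. cinner (Cops \<xi>s u) (Cops \<zeta>s v) = cinner u (rho a v)"
  using assms
proof (induction \<xi>s arbitrary: \<zeta>s)
  case Nil
  then show ?case by (intro exI[of _ 1]) (simp add: Cops_simps rho_one)
next
  case (Cons \<xi> \<xi>s)
  obtain \<zeta> \<zeta>s' where \<zeta>: "\<zeta>s = \<zeta> # \<zeta>s'" using Cons.prems by (cases \<zeta>s) auto
  have step: "cinner (Cops (\<xi> # \<xi>s) u) (Cops \<zeta>s v) = cinner (Cops \<xi>s u) (rho (ip E \<xi> \<zeta>) (Cops \<zeta>s' v))" for u v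
    using Cons.prems unfolding \<zeta> by (simp add: Cops_simps Cop_inner)
  show ?case
  proof (cases \<zeta>s')
    case Nil
    then have "\<xi>s = []" using Cons.prems \<zeta> by simp
    then show ?thesis using step Nil by (intro exI[of _ "ip E \<xi> \<zeta>"]) (simp add: Cops_simps)
  next
    case (Cons \<zeta>' r)
    let ?z = "\<phi> (ip E \<xi> \<zeta>) \<zeta>' # r"
    have "\<exists>a. \<forall>u v. cinner (Cops \<xi>s u) (Cops ?z v) = cinner u (rho a v)"
      by (rule Cons.IH) (use Cons.prems \<zeta> Cons act_closed in auto)
    moreover have "\<zeta>' \<in> carrier E" using Cons.prems \<zeta> Cons by simp
    ultimately show ?thesis using step Cons by (simp add: rho_Cops)
  qed
qed

lemma P_orthogonal: "m \<noteq> n \<Longrightarrow> cinner (P m u) (P n v) = 0"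
  by (simp add: P_selfadjoint P_P)

lemma Cops_elementary:
  assumes "set \<xi>s \<subseteq> carrier E" "x \<in> carrier F"
  shows "\<exists>y\<in>carrier F. Cops \<xi>s (\<tau> x h) = \<tau> y h"
  using assms
proof (induction \<xi>s)
  case (Cons \<xi> \<xi>s)
  then obtain y where "y \<in> carrier F" "Cops \<xi>s (\<tau> x h) = \<tau> y h" by auto
  then show ?case using Cons.prems by (intro bexI[of _ "cr \<xi> y"]) (simp_all add: Cops_simps Cop cr_in)
qed (auto simp: Cops_simps)

text \<open>An intertwiner \<open>S\<^sub>0\<close> from level \<open>k\<close> to level \<open>0\<close> extends to all higher levels as
  \<open>1 \<otimes> S\<^sub>0\<close>, which commutes with the creation operators.\<close>

lemma intertwiner_extension:
  assumes S0: "bounded_clinear S0" "\<And>u. S0 (P k u) = S0 u" "\<And>u. P 0 (S0 u) = S0 u"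
    and S0R: "\<And>a u. S0 (rho a u) = rho a (S0 u)"
  shows "\<exists>S. bounded_clinear S \<and> (\<forall>\<xi>s u. set \<xi>s \<subseteq> carrier E \<longrightarrow> S (Cops \<xi>s (P k u)) = Cops \<xi>s (S0 u))"
proof -
  obtain S0' where S0': "bounded_clinear S0'" "\<And>x y. cinner (S0' x) y = cinner x (S0 y)"
    using adjoint_exists[OF S0(1)] by blast
  have PS0': "cinner (P k (S0' x)) y = cinner (S0' x) y" for x y
    by (simp add: P_selfadjoint S0' S0)
  \<comment> \<open>S0* S0 on level k. It acts on the second component of an index, so that
    \<open>q\<close> represents 1 \<otimes> S0* S0.\<close>
  define Q where "Q u = S0' (S0 u)" for u
  have Q: "bounded_clinear Q" unfolding Q_def by (rule bounded_clinear_compose[OF S0'(1) S0(1)])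
  obtain C where C: "C \<ge> 0" "\<And>u. norm (Q u) \<le> norm u * C"
    using bounded_linear.nonneg_bounded[OF bounded_clinear_simps(1)[OF Q]] by blast
  define q where "q p = (fst p, Q (snd p))" for p :: "'e list \<times> 'k"
  let ?J = "{p :: 'e list \<times> 'k. set (fst p) \<subseteq> carrier E}"
  let ?v = "\<lambda>p :: 'e list \<times> 'k. Cops (fst p) (P k (snd p))"
  let ?w = "\<lambda>p :: 'e list \<times> 'k. Cops (fst p) (S0 (snd p))"
  show ?thesis
  proof (rule operator_from_gram[where J = ?J and v = ?v and w = ?w and q = q and C = C])
    fix i j assume "i \<in> ?J" "j \<in> ?J"
    then have ij: "set (fst i) \<subseteq> carrier E" "set (fst j) \<subseteq> carrier E" by simp_all
    show "cinner (?w i) (?w j) = cinner (?v (q i)) (?v j)"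
    proof (cases "length (fst i) = length (fst j)")
      case True
      obtain a where a: "\<And>u v. cinner (Cops (fst i) u) (Cops (fst j) v) = cinner u (rho a v)"
        using Cops_inner[OF ij True] by blast
      have "cinner (?v (q i)) (?v j) = cinner (P k (Q (snd i))) (P k (rho a (snd j)))"
        by (simp add: a q_def P_rho)
      also have "\<dots> = cinner (P k (Q (snd i))) (rho a (snd j))" by (simp add: P_selfadjoint P_P)
      also have "\<dots> = cinner (S0 (snd i)) (rho a (S0 (snd j)))" unfolding Q_def by (simp add: PS0' S0' S0R)
      finally show ?thesis by (simp add: a)
    next
      \<comment> \<open>Words of different lengths give vectors in different levels, with length + 0
        on one side and length + k on the other, so both inner products vanish.\<close>
      case False
      have w: "?w p = P (length (fst p) + 0) (?w p)" if "set (fst p) \<subseteq> carrier E" for p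
        unfolding P_Cops[OF that] S0(3) ..
      have v: "?v p = P (length (fst p) + k) (Cops (fst p) (snd p))" if "set (fst p) \<subseteq> carrier E" for p
        unfolding P_Cops[OF that] ..
      have "cinner (?w i) (?w j) = 0"
        using w[OF ij(1)] w[OF ij(2)] False P_orthogonal by (metis add_right_cancel)
      moreover have "cinner (?v (q i)) (?v j) = 0"
        using v[of "q i"] v[OF ij(2)] ij(1) False P_orthogonal by (simp add: q_def)
      ultimately show ?thesis by simp
    qed
  next
    fix i assume i: "i \<in> ?J"
    then show "q i \<in> ?J" by (simp add: q_def)
    obtain M where M: "M \<ge> 0" "\<And>u. norm (Cops (fst i) (P k u)) \<le> norm u * M"
      using bounded_linear.nonneg_bounded[OF bounded_clinear_simps(1)[OF bounded_clinear_compose[OF Cops_bounded P_bounded]]] i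
      by blast
    have iter: "fst ((q ^^ m) i) = fst i \<and> norm (snd ((q ^^ m) i)) \<le> norm (snd i) * C ^ m" for m
    proof (induction m)
      case (Suc m)
      have "norm (Q (snd ((q ^^ m) i))) \<le> norm (snd i) * C ^ m * C"
        using Suc by (intro order.trans[OF C(2) mult_right_mono] C(1)) simp
      then show ?case using Suc by (simp add: q_def[of "(q ^^ m) i"] mult_ac)
    qed simp
    have "norm (?v ((q ^^ m) i)) \<le> norm (snd i) * M * C ^ m" for m
      using order.trans[OF M(2) mult_right_mono[OF conjunct2[OF iter] M(1)], of m] iter[of m]
      by (simp add: mult_ac)
    then show "\<exists>D. \<forall>m. norm (?v ((q ^^ m) i)) \<le> D * C ^ m" by blast
  next
    fix B assume "bounded_clinear B" "\<And>p. p \<in> ?J \<Longrightarrow> B (?v p) = ?w p"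
    then show ?thesis by (intro exI[of _ B]) auto
  qed (rule C(1))
qed

lemma level_span: "P n u \<in> closure (cspan {tau n y h | y h. y \<in> carrier (X n)})"
  using P_in unfolding level_def .

text \<open>Invariance of the subspace \<open>(1 - \<lambda>S)L\<close>, where \<open>S = 1 \<otimes> S\<^sub>0\<close> and \<open>L\<close> is the part of
  degree at least \<open>k\<close>, is compared in degree \<open>0\<close> as \<open>\<lambda> \<rightarrow> 0\<close>.\<close>

lemma intertwiner_relation:
  assumes k: "k > 0" and B: "bounded_clinear B"
    and inv: "\<And>N u. csubspace N \<Longrightarrow> closed N \<Longrightarrow>
      (\<And>T u. T \<in> hardy_algebra E X \<psi> tens \<Longrightarrow> u \<in> N \<Longrightarrow> amp T u \<in> N) \<Longrightarrow> u \<in> N \<Longrightarrow> B u \<in> N"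
    and S0: "bounded_clinear S0" "\<And>u. S0 (P k u) = S0 u" "\<And>u. P 0 (S0 u) = S0 u"
      "\<And>a u. S0 (rho a u) = rho a (S0 u)"
  shows "P 0 (B (S0 u)) = S0 (P k (B (P k u)))"
proof -
  obtain S where S: "bounded_clinear S"
    and SC: "\<And>\<xi>s u. set \<xi>s \<subseteq> carrier E \<Longrightarrow> S (Cops \<xi>s (P k u)) = Cops \<xi>s (S0 u)"
    using intertwiner_extension[OF S0] by blast
  \<comment> \<open>These tensors span the part of degree at least k, and by
    \<open>Cops_elementary\<close> each is elementary, as \<open>hardy_intertwines\<close>
    demands.\<close>
  define G where "G = {Cops \<xi>s (tau k y h) | \<xi>s y h. set \<xi>s \<subseteq> carrier E \<and> y \<in> carrier (X k)}"
  define L where "L = closure (cspan G)"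
  have Lc: "csubspace L" "closed L" unfolding L_def by (rule csubspace_closure_cspan) simp
  have GE: "\<exists>\<xi>s y h. g = Cops \<xi>s (tau k y h) \<and> set \<xi>s \<subseteq> carrier E \<and> y \<in> carrier (X k)" if "g \<in> G" for g
    using that unfolding G_def by blast
  have GI: "Cops \<xi>s (tau k y h) \<in> L" if "set \<xi>s \<subseteq> carrier E" "y \<in> carrier (X k)" for \<xi>s y h
    unfolding L_def by (rule in_closure_cspan) (use that in \<open>auto simp: G_def\<close>)
  have t: "P k (tau k y h) = tau k y h" if "y \<in> carrier (X k)" for y h using that by (simp add: P_tau_n)
  have St: "S (Cops \<xi>s (tau k y h)) = Cops \<xi>s (S0 (tau k y h))"
    if "set \<xi>s \<subseteq> carrier E" "y \<in> carrier (X k)" for \<xi>s y h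
    using SC[OF that(1), of "tau k y h"] by (simp add: t that)
  have elem: "\<exists>x\<in>carrier F. \<exists>h. g = \<tau> x h" if "g \<in> G" for g
    using GE[OF that] Cops_elementary incl_in unfolding tau_def by metis
  have ind: "A u \<in> L \<and> S (A u) = A (S u)"
    if A: "bounded_clinear A" "\<And>g. g \<in> G \<Longrightarrow> A g \<in> L \<and> S (A g) = A (S g)" and u: "u \<in> L" for A u
  proof
    show "A u \<in> L"
      by (rule bounded_clinear_image_closure_cspan[OF A(1) _ Lc u[unfolded L_def]]) (use A(2) in blast)
    show "S (A u) = A (S u)"
      by (rule bounded_clinear_eq_on_closure[OF bounded_clinear_compose[OF S A(1)]
            bounded_clinear_compose[OF A(1) S] _ u[unfolded L_def]]) (use A(2) in blast)
  qed
  have LC: "Cop \<xi> v \<in> L \<and> S (Cop \<xi> v) = Cop \<xi> (S v)" if \<xi>: "\<xi> \<in> carrier E" and v: "v \<in> L" for \<xi> v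
  proof (rule ind[OF Cop(1)[OF \<xi>] _ v])
    fix g assume "g \<in> G"
    then obtain \<xi>s y h where g: "g = Cops \<xi>s (tau k y h)" "set \<xi>s \<subseteq> carrier E" "y \<in> carrier (X k)"
      using GE by blast
    then show "Cop \<xi> g \<in> L \<and> S (Cop \<xi> g) = Cop \<xi> (S g)"
      using GI[of "\<xi> # \<xi>s" y h] St[of "\<xi> # \<xi>s" y h] St[of \<xi>s y h] \<xi> by (simp add: Cops_simps)
  qed
  have LR: "rho a v \<in> L \<and> S (rho a v) = rho a (S v)" if v: "v \<in> L" for a v
  proof (rule ind[OF rho_bounded _ v])
    fix g assume "g \<in> G"
    then obtain \<xi>s y h where g: "g = Cops \<xi>s (tau k y h)" "set \<xi>s \<subseteq> carrier E" "y \<in> carrier (X k)"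
      using GE by blast
    show "rho a g \<in> L \<and> S (rho a g) = rho a (S g)"
    proof (cases \<xi>s)
      case Nil
      then show ?thesis
        using GI[of "[]" "\<psi> k a y" h] St[of "[]" "\<psi> k a y" h] St[of "[]" y h] g S0(4)[of a "tau k y h"]
        by (simp add: Cops_simps rho_tau_n X_closed)
    next
      case (Cons \<xi> r)
      then show ?thesis
        using GI[of "\<phi> a \<xi> # r" y h] St[of "\<phi> a \<xi> # r" y h] St[of \<xi>s y h] g act_closed
        by (simp add: rho_Cops)
    qed
  qed
  \<comment> \<open>\<open>S\<close> lowers degrees by k, so only the level k part of v can reach
    degree 0; v itself has no part there because k > 0.\<close>
  have P0: "P 0 v = 0 \<and> P 0 (S v) = S0 (P k v)" if v: "v \<in> L" for v
  proof -
    have gen: "P 0 g = 0 \<and> P 0 (S g) = S0 (P k g)" if gG: "g \<in> G" for g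
    proof -
      obtain \<xi>s y h where g: "g = Cops \<xi>s (tau k y h)" "set \<xi>s \<subseteq> carrier E" "y \<in> carrier (X k)"
        using GE[OF gG] by blast
      have Pg: "P (length \<xi>s + k) g = g" using P_Cops[OF g(2), of k] g by (simp add: t)
      then have "P 0 g = P 0 (P (length \<xi>s + k) g)" by simp
      then have 1: "P 0 g = 0" using k by (simp add: P_P)
      have "P 0 (S g) = S0 (P k g)"
      proof (cases \<xi>s)
        case Nil
        then show ?thesis using St[OF g(2,3)] g t[OF g(3)] by (simp add: Cops_simps S0)
      next
        case (Cons \<xi> r)
        have "P k g = P k (P (length \<xi>s + k) g)" using Pg by simp
        then have "P k g = 0" using Cons by (simp add: P_P)
        moreover have "P 0 (S g) = 0"
          using St[OF g(2,3)] g Cons P_Cop(2) by (simp add: Cops_simps)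
        ultimately show ?thesis by (simp add: bounded_clinear_simps[OF S0(1)])
      qed
      then show ?thesis using 1 by blast
    qed
    have "P 0 v = 0"
      by (rule bounded_clinear_eq_on_closure[OF P_bounded bounded_clinear_zero _ v[unfolded L_def]])
         (use gen in blast)
    moreover have "P 0 (S v) = S0 (P k v)"
      by (rule bounded_clinear_eq_on_closure[OF bounded_clinear_compose[OF P_bounded S]
            bounded_clinear_compose[OF S0(1) P_bounded] _ v[unfolded L_def]]) (use gen in blast)
    ultimately show ?thesis by blast
  qed
  note Ss = bounded_clinear_simps[OF S] and Bs = bounded_clinear_simps[OF B]
  define g where "g = P k u"
  have gL: "g \<in> L"
  proof -
    have "tau k y h \<in> G" if "y \<in> carrier (X k)" for y h
      unfolding G_def mem_Collect_eq
      by (rule exI[of _ "[]"], rule exI[of _ y], rule exI[of _ h]) (simp add: Cops_simps that)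
    then have "level k \<subseteq> L"
      unfolding level_def L_def by (intro closure_mono complex_vec.span_mono) auto
    then show ?thesis unfolding g_def using P_in by blast
  qed
  define s where "s = S0 u"
  have Sg: "S g = s" unfolding g_def s_def using SC[of "[]" u] by (simp add: Cops_simps)
  obtain M where M: "M > 0" "\<And>u. norm (S u) \<le> norm u * M"
    using bounded_linear.pos_bounded[OF Ss(1)] by blast
  \<comment> \<open>The values of \<lambda>: they tend to 0 and satisfy l n * M <= 1 / 2, where M
    bounds \<open>S\<close>, so that 1 - \<lambda>S is bounded below by 1 / 2.\<close>
  define l where "l n = 1 / (2 * M * (real n + 1))" for n
  have l0: "l n > 0" for n unfolding l_def using M(1) by simp
  have lM: "l n * M \<le> 1 / 2" for n
    unfolding l_def using M(1) by (simp add: divide_simps)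
  define A where "A n v = v - complex_of_real (l n) *\<^sub>C S v" for n v
  have Ab: "bounded_clinear (A n)" for n
    unfolding A_def
    by (intro bounded_clinear_diff bounded_clinear_ident bounded_clinear_compose[OF bounded_clinear_scaleC S])
  have Alow: "norm v / 2 \<le> norm (A n v)" for n v
  proof -
    have "norm (complex_of_real (l n) *\<^sub>C S v) \<le> l n * (norm v * M)"
      using l0[of n] M(2)[of v] by (simp add: norm_scaleC)
    also have "\<dots> \<le> norm v / 2" using mult_right_mono[OF lM, of "norm v" n] by (simp add: mult_ac)
    finally show ?thesis using norm_triangle_ineq2[of v "complex_of_real (l n) *\<^sub>C S v"]
      unfolding A_def by simp
  qed
  have "\<exists>v\<in>L. B (A n g) = A n v" for n
  proof -
    have "csubspace (A n ` L)"
      unfolding complex_vec.subspace_def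
    proof (intro conjI ballI allI)
      show "0 \<in> A n ` L"
        using complex_vec.subspace_0[OF Lc(1)] bounded_clinear_simps(4)[OF Ab] by (metis imageI)
      show "x + y \<in> A n ` L" if "x \<in> A n ` L" "y \<in> A n ` L" for x y
        using that complex_vec.subspace_add[OF Lc(1)] bounded_clinear_simps(2)[OF Ab]
        by (auto simp: image_iff) metis
      show "c *\<^sub>C x \<in> A n ` L" if "x \<in> A n ` L" for c x
        using that complex_vec.subspace_scale[OF Lc(1)] bounded_clinear_simps(6)[OF Ab]
        by (auto simp: image_iff) metis
    qed
    \<comment> \<open>A map bounded below sends the complete space \<open>L\<close> onto a complete,
      hence closed, subspace.\<close>
    moreover have "closed (A n ` L)"
    proof (rule complete_imp_closed, rule complete_isometric_image[of "1/2"])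
      show "subspace L" by (rule csubspace_imp_subspace[OF Lc(1)])
      show "complete L" using Lc(2) complete_eq_closed by blast
    qed (use Alow bounded_clinear_simps(1)[OF Ab] in auto)
    moreover have "amp T w \<in> A n ` L" if T: "T \<in> hardy_algebra E X \<psi> tens" and w: "w \<in> A n ` L" for T w
    proof -
      obtain v where v: "v \<in> L" "w = A n v" using w by blast
      obtain T' where T': "adj_pair T' T" using adjointable_pair[OF hardy_adjointable[OF T]] by blast
      have "amp T v \<in> L" "S (amp T v) = amp T (S v)"
        using hardy_intertwines[OF S L_def elem LC LR T v(1)] by blast+
      then have "amp T w = A n (amp T v)"
        unfolding v(2) A_def by (simp add: bounded_clinear_simps[OF amp_spec(1)[OF T']])
      then show ?thesis using \<open>amp T v \<in> L\<close> by blast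
    qed
    ultimately have "B (A n g) \<in> A n ` L" using inv[of "A n ` L" "A n g"] gL by blast
    then show ?thesis by blast
  qed
  then obtain v where v: "\<And>n. v n \<in> L" "\<And>n. B (A n g) = A n (v n)" by metis
  have llim: "l \<longlonglongrightarrow> 0"
  proof -
    have "(\<lambda>n. (1 / (2 * M)) * inverse (real (Suc n))) \<longlonglongrightarrow> (1 / (2 * M)) * 0"
      by (intro tendsto_mult tendsto_const LIMSEQ_inverse_real_of_nat)
    then show ?thesis unfolding l_def by (simp add: divide_simps add.commute)
  qed
  \<comment> \<open>(1 - \<lambda>S)(v n - B g) equals \<lambda> (S B g - B s), and the lower bound
    1 / 2 turns this into an error of order \<lambda>.\<close>
  have vlim: "v \<longlonglongrightarrow> B g"
  proof (rule LIM_zero_cancel, rule Lim_null_comparison)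
    have "norm (v n - B g) \<le> l n * (2 * norm (S (B g) - B s))" for n
    proof -
      have "A n (v n - B g) = B (A n g) - A n (B g)"
        by (simp add: bounded_clinear_simps[OF Ab] v(2))
      also have "\<dots> = complex_of_real (l n) *\<^sub>C (S (B g) - B s)"
        unfolding A_def by (simp add: Bs Sg scaleC_diff)
      finally have "norm (A n (v n - B g)) = l n * norm (S (B g) - B s)"
        using l0[of n] by (simp add: norm_scaleC)
      then show ?thesis using Alow[of "v n - B g" n] by simp
    qed
    then show "\<forall>\<^sub>F n in sequentially. norm (v n - B g) \<le> l n * (2 * norm (S (B g) - B s))" by simp
    show "(\<lambda>n. l n * (2 * norm (S (B g) - B s))) \<longlonglongrightarrow> 0" by (rule tendsto_mult_left_zero[OF llim])
  qed
  \<comment> \<open>The degree 0 parts of the two expressions for B (A n g).\<close>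
  have key: "P 0 (B g) = complex_of_real (l n) *\<^sub>C (P 0 (B s) - S0 (P k (v n)))" for n
  proof -
    have "P 0 (B (A n g)) = P 0 (B g) - complex_of_real (l n) *\<^sub>C P 0 (B s)"
      unfolding A_def by (simp add: Bs P_linear Sg)
    moreover have "P 0 (A n (v n)) = - complex_of_real (l n) *\<^sub>C S0 (P k (v n))"
      unfolding A_def using P0[OF v(1)] by (simp add: P_linear scaleC_minus)
    ultimately have "P 0 (B g) - complex_of_real (l n) *\<^sub>C P 0 (B s) = - complex_of_real (l n) *\<^sub>C S0 (P k (v n))"
      using v(2) by metis
    then show ?thesis by (simp add: scaleC_diff scaleC_minus algebra_simps)
  qed
  have Slim: "(\<lambda>n. S0 (P k (v n))) \<longlonglongrightarrow> S0 (P k (B g))"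
    by (intro bounded_linear.tendsto[OF bounded_clinear_simps(1)[OF S0(1)]]
        bounded_linear.tendsto[OF bounded_clinear_simps(1)[OF P_bounded]] vlim)
  \<comment> \<open>The right side of \<open>key\<close> tends to 0 while its left side is constant,
    so both are 0. The positive factor l n can then be cancelled.\<close>
  have "(\<lambda>n. l n *\<^sub>R (P 0 (B s) - S0 (P k (v n)))) \<longlonglongrightarrow> 0 *\<^sub>R (P 0 (B s) - S0 (P k (B g)))"
    by (intro tendsto_intros llim Slim)
  then have "(\<lambda>n. P 0 (B g)) \<longlonglongrightarrow> 0" unfolding key[symmetric, folded scaleR_eq_scaleC] by simp
  then have "P 0 (B g) = 0" by (simp add: LIMSEQ_const_iff)
  then have "S0 (P k (v n)) = P 0 (B s)" for n
    using key[of n] l0[of n] by (metis complex_vec.scale_eq_0_iff eq_iff_diff_eq_0 less_irrefl of_real_eq_0_iff)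
  then have "(\<lambda>n. P 0 (B s)) \<longlonglongrightarrow> S0 (P k (B g))" using Slim by simp
  then show ?thesis unfolding s_def g_def by (simp add: LIMSEQ_const_iff)
qed

end

section \<open>Disjointness from level 0 and separation by intertwiners\<close>

context fock_rep
begin

text \<open>Disjointness of the subrepresentation on \<open>D\<close> from that on level 0,
  expressed through the commutant of \<open>rho\<close> on the whole space, which is where the
  matrix entries of a projection in the doubled space live.\<close>

definition disjoint_module :: "'k set \<Rightarrow> bool" where
  "disjoint_module D \<longleftrightarrow> csubspace D \<and> closed D \<and> (\<forall>a. \<forall>v\<in>D. rho a v \<in> D) \<and> (\<forall>v\<in>D. P 0 v = 0) \<and>
     (\<forall>S. bounded_clinear S \<and> (\<forall>a u. S (rho a u) = rho a (S u)) \<longrightarrow> (\<forall>v\<in>D. P 0 (S v) = 0))"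

lemma disjoint_moduleD:
  assumes "disjoint_module D"
  shows "csubspace D" "closed D" "\<And>a v. v \<in> D \<Longrightarrow> rho a v \<in> D" "\<And>v. v \<in> D \<Longrightarrow> P 0 v = 0"
    "\<And>S v. bounded_clinear S \<Longrightarrow> (\<And>a u. S (rho a u) = rho a (S u)) \<Longrightarrow> v \<in> D \<Longrightarrow> P 0 (S v) = 0"
  using assms unfolding disjoint_module_def by simp_all

text \<open>Double commutant argument in \<open>K \<oplus> K\<close>: if no operator commuting with \<open>\<rho>\<close> maps \<open>D\<close> to
  level \<open>0\<close>, the projection onto a cyclic subspace splits along level \<open>0\<close> and \<open>D\<close>.\<close>

lemma cyclic_subspace_splits:
  fixes D :: "'k set"
  defines "r2 \<equiv> \<lambda>a (z :: 'k \<times> 'k). (rho a (fst z), rho a (snd z))"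
  assumes disj: "disjoint_module D"
    and \<kappa>: "P 0 \<kappa> = \<kappa>" "P 0 u = u" and d: "d \<in> D" "w \<in> D"
  shows "(d, w) \<in> closure (cspan {r2 a (\<kappa> + d, u + w) | a. True})"
proof -
  note D = disjoint_moduleD(1-4)[OF disj] and noint = disjoint_moduleD(5)[OF disj]
  define G where "G = {r2 a (\<kappa> + d, u + w) | a. True}"
  define N where "N = closure (cspan G)"
  have N: "csubspace N" "closed N" unfolding N_def by (rule csubspace_closure_cspan) simp
  have r2b: "bounded_clinear (r2 a)" for a
  proof (rule bounded_clinearI[where C = "norm a"])
    show "norm (r2 a z) \<le> norm a * norm z" for z
    proof -
      have "(norm (rho a (fst z)))\<^sup>2 + (norm (rho a (snd z)))\<^sup>2 \<le> (norm a * norm (fst z))\<^sup>2 + (norm a * norm (snd z))\<^sup>2"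
        by (intro add_mono power_mono norm_rho_le) auto
      also have "\<dots> = (norm a)\<^sup>2 * ((norm (fst z))\<^sup>2 + (norm (snd z))\<^sup>2)"
        by (simp add: power_mult_distrib distrib_left)
      finally show ?thesis
        using real_sqrt_le_mono by (fastforce simp: r2_def norm_prod_def real_sqrt_mult)
    qed
  qed (simp_all add: r2_def rho_linear scaleC_prod_def)
  have r2m: "r2 a (r2 b z) = r2 (a * b) z" for a b z by (simp add: r2_def rho_mult)
  have r2N: "r2 a z \<in> N" if "z \<in> N" for a z
    by (rule bounded_clinear_image_closure_cspan[OF r2b _ N that[unfolded N_def]])
       (auto simp: G_def r2m N_def intro!: in_closure_cspan)
  have r2a: "cinner (r2 a y) z = cinner y (r2 (star a) z)" for a y z
    by (simp add: r2_def cinner_prod_def rho_adjoint')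
  define Q where "Q = orth_proj N"
  have Qb: "bounded_clinear Q" unfolding Q_def by (rule bounded_clinear_orth_proj[OF N])
  have QN: "Q z \<in> N" for z unfolding Q_def by (rule orth_proj_in[OF N])
  have Qr: "Q (r2 a z) = r2 a (Q z)" for a z
    unfolding Q_def
  proof (rule orth_proj_unique[OF N])
    show "r2 a (orth_proj N z) \<in> N" by (intro r2N orth_proj_in[OF N])
    fix s assume s: "s \<in> N"
    have "r2 a z - r2 a (orth_proj N z) = r2 a (z - orth_proj N z)"
      by (simp only: bounded_clinear_simps[OF r2b])
    then show "cinner (r2 a z - r2 a (orth_proj N z)) s = 0"
      using orth_proj_orth[OF N r2N[OF s]] by (simp add: r2a)
  qed
  note Qs = bounded_clinear_simps[OF Qb]
  have pairb: "bounded_clinear (\<lambda>u :: 'k. (u, 0 :: 'k))" "bounded_clinear (\<lambda>u :: 'k. (0 :: 'k, u))"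
    by (rule bounded_clinearI[where C = 1]; simp add: scaleC_prod_def norm_Pair)+
  have comm: "fst (Q (rho a u, 0)) = rho a (fst (Q (u, 0)))" "snd (Q (rho a u, 0)) = rho a (snd (Q (u, 0)))"
    "fst (Q (0, rho a u)) = rho a (fst (Q (0, u)))" "snd (Q (0, rho a u)) = rho a (snd (Q (0, u)))" for a u
    using Qr[of a "(u, 0)"] Qr[of a "(0, u)"] by (simp_all add: r2_def rho_linear)
  \<comment> \<open>The four entries of the projection \<open>Q\<close> commute with
    \<open>rho\<close>, so disjointness forbids them to carry \<open>D\<close> into level 0.\<close>
  have QD: "P 0 (fst (Q (x, y))) = 0" "P 0 (snd (Q (x, y))) = 0" if xy: "x \<in> D" "y \<in> D" for x y
  proof -
    have "Q (x, y) = Q (x, 0) + Q (0, y)" using Qs(2)[of "(x, 0)" "(0, y)"] by simp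
    moreover have "P 0 (fst (Q (x, 0))) = 0" "P 0 (snd (Q (x, 0))) = 0"
      "P 0 (fst (Q (0, y))) = 0" "P 0 (snd (Q (0, y))) = 0"
      by (rule noint[OF bounded_clinear_compose[OF _ bounded_clinear_compose[OF Qb]]];
          (rule bounded_clinear_fst_snd pairb comm xy)?)+
    ultimately show "P 0 (fst (Q (x, y))) = 0" "P 0 (snd (Q (x, y))) = 0"
      by (simp_all add: P_linear)
  qed
  define R where "R = orth_proj D"
  have Rb: "bounded_clinear R" unfolding R_def by (rule bounded_clinear_orth_proj[OF D(1,2)])
  have RD: "R v \<in> D" for v unfolding R_def by (rule orth_proj_in[OF D(1,2)])
  have Rid: "R v = v" if "v \<in> D" for v unfolding R_def using that by (rule orth_proj_ident[OF D(1,2)])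
  have orth: "cinner (P 0 v) x = 0" if "x \<in> D" for v x using D(4)[OF that] by (simp add: P_selfadjoint)
  have R0: "R (P 0 v) = 0" for v unfolding R_def by (rule orth_proj_eq_0[OF D(1,2)]) (rule orth)
  \<comment> \<open>\<open>N\<close> is contained in the doubled sum of level 0 and
    \<open>D\<close>, because its generators are.\<close>
  have decomp: "fst z = P 0 (fst z) + R (fst z) \<and> snd z = P 0 (snd z) + R (snd z)" if "z \<in> N" for z
  proof -
    have gen: "v = P 0 v + R v" if "v = rho a (\<kappa>' + d')" "P 0 \<kappa>' = \<kappa>'" "d' \<in> D" for v a \<kappa>' d'
    proof -
      have v: "v = P 0 (rho a \<kappa>') + rho a d'"
        using that(1,2) by (simp add: rho_linear P_rho)
      show ?thesis
        unfolding v by (simp add: P_linear P_P bounded_clinear_simps[OF Rb] R0 D(3,4) Rid that(3))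
    qed
    have 1: "fst g = P 0 (fst g) + R (fst g) \<and> snd g = P 0 (snd g) + R (snd g)" if gG: "g \<in> G" for g
    proof -
      obtain a where "g = r2 a (\<kappa> + d, u + w)" using gG unfolding G_def by blast
      then have "fst g = rho a (\<kappa> + d)" "snd g = rho a (u + w)" by (simp_all add: r2_def)
      then show ?thesis using gen \<kappa> d by blast
    qed
    have PR: "bounded_clinear (\<lambda>v. P 0 v + R v)" by (intro bounded_clinear_add P_bounded Rb)
    have "fst z = (\<lambda>v. P 0 v + R v) (fst z)"
      by (rule bounded_clinear_eq_on_closure[OF bounded_clinear_fst_snd(1)
            bounded_clinear_compose[OF PR bounded_clinear_fst_snd(1)] _ that[unfolded N_def]])
         (use 1 in blast)
    moreover have "snd z = (\<lambda>v. P 0 v + R v) (snd z)"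
      by (rule bounded_clinear_eq_on_closure[OF bounded_clinear_fst_snd(2)
            bounded_clinear_compose[OF PR bounded_clinear_fst_snd(2)] _ that[unfolded N_def]])
         (use 1 in blast)
    ultimately show ?thesis by simp
  qed
  \<comment> \<open>Self-adjointness of \<open>Q\<close> turns \<open>QD\<close> into orthogonality
    of Q (\<kappa>, u) to pairs from \<open>D\<close>.\<close>
  have Q0: "R (fst (Q (\<kappa>, u))) = 0" "R (snd (Q (\<kappa>, u))) = 0"
  proof -
    have orthD: "cinner (Q (\<kappa>, u)) (x, y) = 0" if "x \<in> D" "y \<in> D" for x y
    proof -
      have "cinner (Q (\<kappa>, u)) (x, y) = cinner (\<kappa>, u) (Q (x, y))"
        unfolding Q_def by (rule orth_proj_selfadjoint[OF N])
      also have "\<dots> = cinner (P 0 \<kappa>) (fst (Q (x, y))) + cinner (P 0 u) (snd (Q (x, y)))"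
        by (simp add: cinner_prod_def \<kappa>)
      also have "\<dots> = 0" by (simp add: P_selfadjoint QD that)
      finally show ?thesis .
    qed
    have z: "0 \<in> D" by (rule complex_vec.subspace_0[OF D(1)])
    show "R (fst (Q (\<kappa>, u))) = 0" "R (snd (Q (\<kappa>, u))) = 0"
      unfolding R_def using orthD[OF _ z] orthD[OF z]
      by (auto intro!: orth_proj_eq_0[OF D(1,2)] simp: cinner_prod_def)
  qed
  have fixed: "Q (\<kappa> + d, u + w) = (\<kappa> + d, u + w)"
  proof -
    have "r2 1 (\<kappa> + d, u + w) \<in> N" unfolding N_def by (rule in_closure_cspan) (auto simp: G_def)
    then show ?thesis unfolding Q_def by (intro orth_proj_ident[OF N]) (simp add: r2_def rho_one)
  qed
  have sum: "Q (\<kappa> + d, u + w) = Q (\<kappa>, u) + Q (d, w)" using Qs(2)[of "(\<kappa>, u)" "(d, w)"] by simp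
  have a: "fst (Q (\<kappa>, u)) + fst (Q (d, w)) = \<kappa> + d" "snd (Q (\<kappa>, u)) + snd (Q (d, w)) = u + w"
    using arg_cong[OF sum, of fst] arg_cong[OF sum, of snd] fixed by simp_all
  \<comment> \<open>Q (d, w) has no level 0 part, hence equals its \<open>D\<close> part. Applying
    \<open>R\<close> to the fixed point equation identifies that part as (d, w), which therefore
    lies in \<open>N\<close>.\<close>
  have b: "fst (Q (d, w)) = R (fst (Q (d, w)))" "snd (Q (d, w)) = R (snd (Q (d, w)))"
    using decomp[OF QN[of "(d, w)"]] QD[OF d] by simp_all
  have c: "R (fst (Q (d, w))) = d" "R (snd (Q (d, w))) = w"
    using arg_cong[OF a(1), of R] arg_cong[OF a(2), of R] Q0 R0[of \<kappa>] R0[of u] \<kappa> d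
    by (simp_all add: bounded_clinear_simps[OF Rb] Rid)
  have "Q (d, w) = (d, w)" using b c by (metis prod.collapse)
  then show ?thesis using QN[of "(d, w)"] unfolding N_def G_def by metis
qed

text \<open>Let e be the error of the real best approximation of d. Its real orthogonality to all
  rho a (\<kappa> + d) with a self-adjoint says <e, rho a (\<kappa> + d)> + <\<kappa> + d, rho a e>
  = 0. This is complex linear in a, so it holds for all a and becomes a linear condition on the
  cyclic subspace of (\<kappa> + d, e). By \<open>cyclic_subspace_splits\<close> it also holds at
  (d, w), w being the \<open>D\<close> part of e, which yields Re <e, d> = 0 and thus e = 0.\<close>

lemma self_adjoint_approximation:
  assumes disj: "disjoint_module D"
    and \<kappa>: "P 0 \<kappa> = \<kappa>" and d: "d \<in> D"
  shows "d \<in> closure {rho a (\<kappa> + d) | a. star a = a}"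
proof -
  note D = disjoint_moduleD(1-4)[OF disj]
  define R where "R = {rho a (\<kappa> + d) | a. star a = a}"
  have Rs: "subspace R"
    unfolding real_vector.subspace_def
  proof (intro conjI ballI allI)
    show "0 \<in> R" unfolding R_def using rho_scale[of 0 0 "\<kappa> + d"] by (auto intro!: exI[of _ 0])
    show "x + y \<in> R" if "x \<in> R" "y \<in> R" for x y
      using that unfolding R_def by (auto simp: rho_add[symmetric] star_add)
    show "c *\<^sub>R x \<in> R" if "x \<in> R" for c x
      using that unfolding R_def
      by (auto simp: scaleR_eq_scaleC rho_scale[symmetric] star_scaleC)
  qed
  have "subspace (closure R)"
  proof -
    have "x + y \<in> closure R" if xy: "x \<in> closure R" "y \<in> closure R" for x y
    proof -
      obtain s t where "\<And>n. s n \<in> R" "s \<longlonglongrightarrow> x" "\<And>n. t n \<in> R" "t \<longlonglongrightarrow> y"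
        using xy unfolding closure_sequential by blast
      then show ?thesis unfolding closure_sequential using subspace_add[OF Rs]
        by (intro exI[of _ "\<lambda>n. s n + t n"]) (auto intro: tendsto_add)
    qed
    moreover have "c *\<^sub>R x \<in> closure R" if x: "x \<in> closure R" for c x
    proof -
      obtain s where "\<And>n. s n \<in> R" "s \<longlonglongrightarrow> x" using x unfolding closure_sequential by blast
      then show ?thesis unfolding closure_sequential using subspace_mul[OF Rs]
        by (intro exI[of _ "\<lambda>n. c *\<^sub>R s n"]) (auto intro: tendsto_scaleR)
    qed
    ultimately show ?thesis
      using closure_subset subspace_0[OF Rs] unfolding real_vector.subspace_def by blast
  qed
  then obtain p where p: "p \<in> closure R" "\<And>s. s \<in> closure R \<Longrightarrow> Re (cinner (d - p) s) = 0"
    using projection_exists[of "closure R" d] by auto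
  define e where "e = d - p"
  define w where "w = orth_proj D e"
  have PD: "bounded_clinear (\<lambda>v. P 0 v + orth_proj D v)"
    by (intro bounded_clinear_add P_bounded bounded_clinear_orth_proj[OF D(1,2)])
  have orth: "cinner (P 0 v) x = 0" if "x \<in> D" for v x using D(4)[OF that] by (simp add: P_selfadjoint)
  \<comment> \<open>All approximants, and d itself, lie in the sum of level 0 and \<open>D\<close>;
    so does e.\<close>
  have e_split: "e = P 0 e + w"
  proof -
    let ?f = "\<lambda>v. P 0 v + orth_proj D v"
    note fs = bounded_clinear_simps[OF PD]
    have fD: "?f x = x" if "x \<in> D" for x
      using orth_proj_ident[OF D(1,2) that] D(4)[OF that] by simp
    have f0: "?f (P 0 v) = P 0 v" for v
      using orth_proj_eq_0[OF D(1,2), of "P 0 v"] orth by (simp add: P_P)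
    have "R \<subseteq> {v. ?f v = v}"
    proof
      fix x assume "x \<in> R"
      then obtain a where x: "x = rho a (\<kappa> + d)" unfolding R_def by blast
      have "x = P 0 (rho a \<kappa>) + rho a d" unfolding x by (simp add: rho_linear P_rho \<kappa>)
      then have "?f x = ?f (P 0 (rho a \<kappa>)) + ?f (rho a d)" by (simp only: fs)
      then show "x \<in> {v. ?f v = v}"
        using \<open>x = P 0 (rho a \<kappa>) + rho a d\<close> f0 fD[OF D(3)[OF d]] by simp
    qed
    moreover have "closed {v. ?f v = v}"
      by (intro closed_Collect_eq linear_continuous_on fs(1) continuous_on_id)
    ultimately have "closure R \<subseteq> {v. ?f v = v}" by (rule closure_minimal)
    then have "?f p = p" using p(1) by blast
    then have "?f e = e" unfolding e_def using fD[OF d] fs(3)[of d p] by simp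
    then show ?thesis by (simp add: w_def)
  qed
  have wD: "w \<in> D" unfolding w_def by (rule orth_proj_in[OF D(1,2)])
  let ?p = "\<kappa> + d"
  have f_sa: "cinner e (rho a ?p) + cinner ?p (rho a e) = 0" if a: "star a = a" for a
  proof -
    have "cinner ?p (rho a e) = cnj (cinner e (rho a ?p))"
      using rho_adjoint'[of a ?p e] cinner_commute[of "rho a ?p" e] a by simp
    moreover have "rho a ?p \<in> closure R"
      by (rule subsetD[OF closure_subset]) (use a in \<open>auto simp: R_def\<close>)
    ultimately show ?thesis using p(2) unfolding e_def[symmetric] by (simp add: complex_add_cnj)
  qed
  \<comment> \<open>Splitting a into its self-adjoint real and imaginary parts.\<close>
  have f0: "cinner e (rho a ?p) + cinner ?p (rho a e) = 0" for a
  proof -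
    define b c where "b = (1/2) *\<^sub>C (a + star a)" and "c = (- \<i> / 2) *\<^sub>C (a - star a)"
    have sb: "star b = b" unfolding b_def by (simp add: star_scaleC star_add star_star add.commute)
    have sc: "star c = c"
      unfolding c_def by (simp add: star_scaleC star_diff star_star scaleC_diff scaleC_minus)
    have "a = b + \<i> *\<^sub>C c"
    proof -
      have "b + \<i> *\<^sub>C c = (1/2 + 1/2) *\<^sub>C a + (1/2 - 1/2) *\<^sub>C star a"
        unfolding b_def c_def
        by (simp only: scaleC_scaleC scaleC_add_right scaleC_diff scaleC_add_left) simp
      then show ?thesis by (simp add: scaleC_one)
    qed
    then have "cinner e (rho a ?p) + cinner ?p (rho a e) =
        (cinner e (rho b ?p) + cinner ?p (rho b e)) + \<i> * (cinner e (rho c ?p) + cinner ?p (rho c e))"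
      by (simp add: rho_add rho_scale cinner_add_right cinner_scaleC_right distrib_left)
    then show ?thesis using f_sa[OF sb] f_sa[OF sc] by simp
  qed
  let ?G = "{(rho a (fst (?p, e)), rho a (snd (?p, e))) | a. True}"
  have "(d, w) \<in> closure (cspan ?G)"
    using cyclic_subspace_splits[OF disj \<kappa> _ d wD, of "P 0 e"] e_split by (simp add: P_P)
  moreover have "closure (cspan ?G) \<subseteq> {z. cinner e (fst z) + cinner ?p (snd z) = 0}"
  proof (rule closure_minimal)
    show "cspan ?G \<subseteq> {z. cinner e (fst z) + cinner ?p (snd z) = 0}"
    proof (rule complex_vec.span_minimal)
      show "?G \<subseteq> {z. cinner e (fst z) + cinner ?p (snd z) = 0}" using f0 by auto
      show "csubspace {z. cinner e (fst z) + cinner ?p (snd z) = 0}"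
        unfolding complex_vec.subspace_def
        by (auto simp: cinner_add_right cinner_scaleC_right scaleC_prod_def distrib_left[symmetric])
           (metis add.assoc add.commute add_0)
    qed
    show "closed {z. cinner e (fst z) + cinner ?p (snd z) = 0}"
      by (intro closed_Collect_eq continuous_on_add continuous_on_const linear_continuous_on
          bounded_linear_compose[OF bounded_linear_cinner_right] bounded_linear_fst bounded_linear_snd)
  qed
  ultimately have z: "cinner e d + cinner ?p w = 0" by auto
  have "cinner e d = cinner w d"
    using orth[OF d, of e] arg_cong[OF e_split, of "\<lambda>v. cinner v d"] by (simp add: cinner_add_left)
  moreover have "cinner ?p w = cinner d w" using orth[OF wD, of \<kappa>] \<kappa> by (simp add: cinner_add_left)
  ultimately have "Re (cinner w d) + Re (cinner d w) = 0" using z by (simp add: complex_eq_iff)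
  then have "Re (cinner e d) = 0" using cinner_commute[of w d] \<open>cinner e d = cinner w d\<close> by simp
  moreover have "Re (cinner e p) = 0" unfolding e_def by (rule p(2)[OF p(1)])
  ultimately have "Re (cinner e e) = 0" by (subst (2) e_def) (simp add: cinner_diff)
  then have "e = 0" by (simp add: cinner_self)
  then show ?thesis using p(1) unfolding e_def R_def by simp
qed

text \<open>Kaplansky's substitution: t -> 2t / (1 + t^2) turns self-adjoint elements into
  contractions and fixes 0 and 1. Hence 2 a r inherits from a, whose norm is not controlled, that it
  nearly annihilates \<kappa> and nearly fixes d.\<close>

lemma separating_contraction:
  assumes disj: "disjoint_module D"
    and \<kappa>: "P 0 \<kappa> = \<kappa>" and d: "d \<in> D" and e: "e > 0"
  shows "\<exists>c. norm c \<le> 1 \<and> norm (rho c \<kappa>) \<le> e \<and> norm (rho c d - d) \<le> e"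
proof -
  note D = disjoint_moduleD(1-4)[OF disj]
  have "d \<in> closure {rho a (\<kappa> + d) | a. star a = a}"
    by (rule self_adjoint_approximation[OF disj \<kappa> d])
  then have "\<exists>v\<in>{rho a (\<kappa> + d) | a. star a = a}. dist v d < e / 2"
    unfolding closure_approachable using e by (meson half_gt_zero)
  then obtain a where a: "star a = a" "norm (rho a (\<kappa> + d) - d) < e / 2" by (auto simp: dist_norm)
  \<comment> \<open>Level 0 and \<open>D\<close> are orthogonal, so smallness of the sum bounds both
    parts.\<close>
  have split: "rho a (\<kappa> + d) - d = P 0 (rho a \<kappa>) + (rho a d - d)"
    by (simp add: rho_linear P_rho \<kappa>)
  have dD: "P 0 (rho a d - d) = 0" by (rule D(4)) (intro complex_vec.subspace_diff[OF D(1)] D(3) d)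
  have "P 0 (rho a (\<kappa> + d) - d) = rho a \<kappa>"
    unfolding split by (simp add: P_linear dD[unfolded P_linear] P_P) (simp add: P_rho \<kappa>)
  then have n\<kappa>: "norm (rho a \<kappa>) \<le> e / 2"
    using norm_orth_proj[OF level_closed, of 0 "rho a (\<kappa> + d) - d"] a(2) by (simp add: P_def)
  have nd: "norm (rho a d - d) \<le> e / 2"
  proof -
    have "cinner (P 0 (rho a \<kappa>)) (rho a d - d) = 0" using dD by (simp add: P_selfadjoint)
    then have "(norm (rho a d - d))\<^sup>2 \<le> (norm (rho a (\<kappa> + d) - d))\<^sup>2" unfolding split norm_add_sq by simp
    then have "norm (rho a d - d) \<le> norm (rho a (\<kappa> + d) - d)" by (rule power2_le_imp_le) simp
    then show ?thesis using a(2) by simp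
  qed
  obtain r where r: "r * (1 + a * a) = 1" "norm r \<le> 1" "norm (2 *\<^sub>C (a * r)) \<le> 1"
    "\<And>x. x * a = a * x \<Longrightarrow> x * r = r * x"
    using one_plus_square_inverse[OF a(1)] by metis
  have ar: "a * r = r * a" by (rule r(4)) simp
  let ?c = "2 *\<^sub>C (a * r)"
  have nar: "norm (r * a) \<le> 1 / 2" using r(3) ar by (simp add: norm_scaleC)
  have "norm (rho ?c \<kappa>) = 2 * norm (rho r (rho a \<kappa>))"
    by (simp add: ar rho_scale rho_mult norm_scaleC)
  also have "norm (rho r (rho a \<kappa>)) \<le> 1 * (e / 2)"
    by (rule order.trans[OF norm_rho_le mult_mono[OF r(2) n\<kappa>]]) simp_all
  finally have c\<kappa>: "norm (rho ?c \<kappa>) \<le> e" by simp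
  \<comment> \<open>The scalar identity 2t / (1 + t^2) - 1 = (t - 1)(1 - t) / (1 + t^2). It exhibits
    a factor 1 - a, small on d, and a factor bounded by 2.\<close>
  have eq: "?c - 1 = (r * a - r) * (1 - a)"
  proof -
    have "?c = r * a + r * a" using scaleC_add_left[of 1 1 "a * r"] by (simp add: scaleC_one ar)
    then have "?c - 1 = r * a + r * a - r * (1 + a * a)" by (simp only: r(1))
    then show ?thesis by (simp add: algebra_simps)
  qed
  have "rho ?c d - d = rho (?c - 1) d" by (simp only: rho_diff rho_one)
  also have "\<dots> = rho (r * a - r) (rho (1 - a) d)" unfolding eq by (rule rho_mult)
  also have "norm \<dots> \<le> norm (r * a - r) * norm (rho (1 - a) d)" by (rule norm_rho_le)
  also have "\<dots> \<le> 2 * (e / 2)"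
  proof (rule mult_mono)
    show "norm (r * a - r) \<le> 2" using norm_triangle_ineq4[of "r * a" r] nar r(2) by simp
    show "norm (rho (1 - a) d) \<le> e / 2" using nd by (simp add: rho_diff rho_one norm_minus_commute)
  qed auto
  finally have "norm (rho ?c d - d) \<le> e" by simp
  then show ?thesis using r(3) c\<kappa> by blast
qed

text \<open>The contractions are multiplied. The new one is chosen for the vector rho c1 \<kappa>,
  which is still in level 0, and being a contraction it keeps the vectors treated earlier
  small.\<close>

lemma separating_contraction_finite:
  assumes disj: "disjoint_module D"
    and d: "d \<in> D" and K: "finite K" "\<And>\<kappa>. \<kappa> \<in> K \<Longrightarrow> P 0 \<kappa> = \<kappa>" and e: "e > 0"
  shows "\<exists>c. norm c \<le> 1 \<and> (\<forall>\<kappa>\<in>K. norm (rho c \<kappa>) \<le> e) \<and> norm (rho c d - d) \<le> e"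
  using K e
proof (induction K arbitrary: e rule: finite_induct)
  case empty
  then show ?case by (intro exI[of _ 1]) (simp add: norm_one_le rho_one)
next
  case (insert \<kappa> K)
  then obtain c1 where c1: "norm c1 \<le> 1" "\<And>\<kappa>. \<kappa> \<in> K \<Longrightarrow> norm (rho c1 \<kappa>) \<le> e / 2" "norm (rho c1 d - d) \<le> e / 2"
    by (metis half_gt_zero insertCI)
  have "P 0 (rho c1 \<kappa>) = rho c1 \<kappa>" using insert.prems(1)[of \<kappa>] by (simp add: P_rho)
  then obtain c2 where c2: "norm c2 \<le> 1" "norm (rho c2 (rho c1 \<kappa>)) \<le> e / 2" "norm (rho c2 d - d) \<le> e / 2"
    using separating_contraction[OF disj _ d, of "rho c1 \<kappa>" "e / 2"] insert.prems(2) by auto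
  have con: "norm (rho c2 u) \<le> norm u" for u
    using order.trans[OF norm_rho_le mult_right_mono[OF c2(1) norm_ge_zero]] by simp
  show ?case
  proof (intro exI[of _ "c2 * c1"] conjI ballI)
    show "norm (c2 * c1) \<le> 1"
      using order.trans[OF norm_mult_ineq mult_mono[OF c2(1) c1(1)]] by simp
    show "norm (rho (c2 * c1) \<kappa>') \<le> e" if "\<kappa>' \<in> insert \<kappa> K" for \<kappa>'
      using that c2(2) order.trans[OF con c1(2)] insert.prems(2) by (auto simp: rho_mult) fastforce+
    have "rho (c2 * c1) d - d = rho c2 (rho c1 d - d) + (rho c2 d - d)"
      by (simp add: rho_mult rho_linear)
    then show "norm (rho (c2 * c1) d - d) \<le> e"
      using norm_triangle_mono[OF order.trans[OF con c1(3)] c2(3)] by (simp only: field_sum_of_halves)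
  qed
qed

lemma iota_simps:
  "\<iota> b \<in> carrier (X 0)" "ract (X 0) (\<iota> a) b = \<iota> (a * b)" "ip (X 0) (\<iota> a) (\<iota> b) = star a * b"
  "\<psi> 0 a (\<iota> b) = \<iota> (a * b)" "x \<in> carrier (X 0) \<Longrightarrow> \<exists>a. x = \<iota> a"
  using powers unfolding tensor_powers_def trivial_correspondence_def bij_betw_def by auto

text \<open>Otherwise contractions \<open>c \<in> M\<close> can be chosen which nearly fix \<open>y \<otimes> h\<close> and nearly annihilate
  any given finite set in level \<open>0\<close>. A weak* cluster point satisfies \<open>\<pi>(c) = 0\<close>, that is,
  \<open>c = 0\<close>, which contradicts the normality of the left action.\<close>

lemma intertwiners_separate:
  assumes k: "k > 0" and y: "y \<in> carrier (X k)"
    and zero: "\<And>S. bounded_clinear S \<Longrightarrow> (\<And>u. S (P k u) = S u) \<Longrightarrow> (\<And>u. P 0 (S u) = S u) \<Longrightarrow>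
      (\<And>a u. S (rho a u) = rho a (S u)) \<Longrightarrow> S (tau k y h) = 0"
  shows "tau k y h = 0"
proof -
  define d where "d = tau k y h"
  define D where "D = closure (cspan {rho a d | a. True})"
  have D: "csubspace D" "closed D" unfolding D_def by (rule csubspace_closure_cspan) simp
  have dD: "d \<in> D"
    unfolding D_def by (rule in_closure_cspan) (metis (mono_tags, lifting) mem_Collect_eq rho_one)
  have Dr: "rho a v \<in> D" if "v \<in> D" for a v
    by (rule bounded_clinear_image_closure_cspan[OF rho_bounded _ D that[unfolded D_def]])
       (auto simp: D_def rho_mult[symmetric] intro!: in_closure_cspan)
  have Pkd: "P k d = d" unfolding d_def using y by (simp add: P_tau_n)
  have DP: "P k v = v" if "v \<in> D" for v
    by (rule bounded_clinear_eq_on_closure[OF P_bounded bounded_clinear_ident _ that[unfolded D_def]])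
       (auto simp: P_rho Pkd)
  have D0: "P 0 v = 0" if "v \<in> D" for v
    using P_P[of 0 k v] k DP[OF that] by simp
  have noint: "P 0 (S v) = 0"
    if S: "bounded_clinear S" "\<And>a u. S (rho a u) = rho a (S u)" and v: "v \<in> D" for S v
  proof -
    \<comment> \<open>An arbitrary element of the commutant is cut down to an intertwiner from level
      k to level 0, to which the hypothesis \<open>zero\<close> applies.\<close>
    let ?S = "\<lambda>u. P 0 (S (P k u))"
    have Sb: "bounded_clinear ?S"
      by (intro bounded_clinear_compose[OF P_bounded] bounded_clinear_compose[OF S(1) P_bounded])
    have Sr: "?S (rho a u) = rho a (?S u)" for a u by (simp add: P_rho S(2))
    have "?S d = 0" unfolding d_def by (rule zero[OF Sb _ _ Sr]) (simp_all add: P_P)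
    then have "?S v = 0"
      by (intro bounded_clinear_eq_on_closure[OF Sb bounded_clinear_zero _ v[unfolded D_def]])
         (use Sr in \<open>auto simp: rho_linear\<close>)
    then show ?thesis by (simp add: DP[OF v])
  qed
  have disj: "disjoint_module D" unfolding disjoint_module_def using D Dr D0 noint by simp
  \<comment> \<open>Pairs of a finite set of level 0 vectors and a precision 1 / (n + 1), directed
    by union and maximum.\<close>
  define I where "I = {K. finite K \<and> K \<subseteq> {\<kappa>. P 0 \<kappa> = \<kappa>}} \<times> (UNIV :: nat set)"
  define C where "C p = {c. norm c \<le> 1 \<and> (\<forall>\<kappa>\<in>fst p. norm (rho c \<kappa>) \<le> 1 / (real (snd p) + 1)) \<and>
    norm (rho c d - d) \<le> 1 / (real (snd p) + 1)}" for p :: "'k set \<times> nat"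
  define Fil where "Fil = (INF p\<in>I. principal (C p))"
  have Cne: "C p \<noteq> {}" if p: "p \<in> I" for p
  proof -
    have "\<exists>c. norm c \<le> 1 \<and> (\<forall>\<kappa>\<in>fst p. norm (rho c \<kappa>) \<le> 1 / (real (snd p) + 1)) \<and>
        norm (rho c d - d) \<le> 1 / (real (snd p) + 1)"
      by (rule separating_contraction_finite[OF disj dD]) (use p in \<open>auto simp: I_def\<close>)
    then show ?thesis unfolding C_def by blast
  qed
  have "Fil \<noteq> bot"
    unfolding Fil_def
  proof (subst INF_filter_bot_base)
    fix p q assume pq: "p \<in> I" "q \<in> I"
    let ?r = "(fst p \<union> fst q, max (snd p) (snd q))"
    have "?r \<in> I" using pq unfolding I_def by auto
    moreover have "C ?r \<subseteq> C p \<inter> C q"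
    proof -
      have "1 / (real (max (snd p) (snd q)) + 1) \<le> 1 / (real (snd p) + 1)"
        "1 / (real (max (snd p) (snd q)) + 1) \<le> 1 / (real (snd q) + 1)"
        by (intro divide_left_mono; simp)+
      then show ?thesis unfolding C_def by (auto intro: order.trans)
    qed
    ultimately show "\<exists>r\<in>I. principal (C r) \<le> inf (principal (C p)) (principal (C q))"
      by (intro bexI[of _ ?r]) simp_all
  next
    show "\<not> (\<exists>p\<in>I. principal (C p) = bot)" using Cne by (simp add: principal_eq_bot_iff)
  qed
  have evC: "eventually (\<lambda>c. c \<in> C p) Fil" if "p \<in> I" for p
    unfolding Fil_def using that by (intro eventually_INF1[of p]) (simp_all add: eventually_principal)
  have "eventually (\<lambda>c. norm c \<le> 1) Fil"
    using evC[of "({}, 0)"] by (rule eventually_mono) (auto simp: I_def C_def)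
  then obtain c G where G: "G \<le> Fil" "G \<noteq> bot" "\<And>\<omega>. \<omega> \<in> predual \<Longrightarrow> (\<omega> \<longlongrightarrow> \<omega> c) G"
    using weak_star_compactness[OF \<open>Fil \<noteq> bot\<close>] by metis
  \<comment> \<open>The finite set may depend on the precision n, which only has to improve along
    the filter.\<close>
  have null: "(f \<longlongrightarrow> 0) G" if ex: "\<And>n :: nat. \<exists>K. (K, n) \<in> I \<and> (\<forall>c\<in>C (K, n). norm (f c) \<le> M / (real n + 1))"
    for f :: "'m \<Rightarrow> complex" and M
  proof (rule tendstoI)
    fix e :: real assume e: "e > 0"
    obtain n :: nat where n: "M / e < n" using reals_Archimedean2 by blast
    have "M < e * n" using n e by (simp add: pos_divide_less_eq mult.commute)
    also have "\<dots> \<le> e * (real n + 1)" using e by (intro mult_left_mono) auto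
    finally have lt: "M / (real n + 1) < e" by (simp add: pos_divide_less_eq)
    obtain K where K: "(K, n) \<in> I" "\<And>c. c \<in> C (K, n) \<Longrightarrow> norm (f c) \<le> M / (real n + 1)" using ex[of n] by blast
    have "eventually (\<lambda>c. c \<in> C (K, n)) G" using evC[OF K(1)] G(1) filter_leD by blast
    then show "eventually (\<lambda>c. dist (f c) 0 < e) G"
      by (rule eventually_mono) (use K(2) lt in fastforce)
  qed
  have "c = 0"
  proof (rule pi_inject)
    fix h' k'
    \<comment> \<open>The vectors \<iota> 1 \<otimes> h of level 0 turn matrix coefficients of
      \<open>\<pi>\<close> into those of \<open>rho\<close>, which the contractions make
      small.\<close>
    let ?t = "\<lambda>h. tau 0 (\<iota> 1) h"
    have pit: "cinner h' (\<pi> a k') = cinner (?t h') (rho a (?t k'))" for a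
      by (simp add: rho_tau_n iota_simps tau_inner_n)
    have "((\<lambda>a. cinner h' (\<pi> a k')) \<longlongrightarrow> 0) G"
    proof (rule null[where M = "norm (?t h')"])
      fix n :: nat
      have "({?t k'}, n) \<in> I" by (simp add: I_def P_tau_n iota_simps)
      moreover have "norm (cinner h' (\<pi> c k')) \<le> norm (?t h') / (real n + 1)" if "c \<in> C ({?t k'}, n)" for c
      proof -
        have "norm (rho c (?t k')) \<le> 1 / (real n + 1)" using that by (simp add: C_def)
        then show ?thesis
          unfolding pit using order.trans[OF cauchy_schwarz mult_left_mono[OF _ norm_ge_zero]] by fastforce
      qed
      ultimately show "\<exists>K. (K, n) \<in> I \<and> (\<forall>c\<in>C (K, n). norm (cinner h' (\<pi> c k')) \<le> norm (?t h') / (real n + 1))"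
        by blast
    qed
    then have "cinner h' (\<pi> c k') = 0"
      using G(3)[OF vector_functional] G(2) tendsto_unique by blast
    then show "cinner h' (\<pi> c k') = cinner h' (\<pi> 0 k')" by (simp add: pi_zero)
  qed
  have dd: "cinner d (rho a d) = cinner h (\<pi> (ip (X k) y (\<psi> k a y)) h)" for a
    unfolding d_def using y by (simp add: rho_tau_n tau_inner_n X_closed)
  \<comment> \<open>As d is an elementary tensor, normality of the left action makes this
    coefficient a weak* continuous function of a. It tends to 0 since c = 0, but also to |d|^2 since
    rho a d tends to d.\<close>
  have "(\<lambda>a. cinner d (rho a d)) \<in> predual"
    unfolding dd by (rule correspondence.act_normal[OF X_correspondence
          normal_functional_single[OF vector_functional y y]])
  from G(3)[OF this] have "((\<lambda>a. cinner d (rho a d)) \<longlongrightarrow> 0) G"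
    using rho_scale[of 0 0 d] by (simp add: \<open>c = 0\<close>)
  moreover have "((\<lambda>a. cinner d (rho a d) - cinner d d) \<longlongrightarrow> 0) G"
  proof (rule null[where M = "norm d"])
    fix n :: nat
    have "norm (cinner d (rho c d) - cinner d d) \<le> norm d / (real n + 1)" if "c \<in> C ({}, n)" for c
    proof -
      have "norm (rho c d - d) \<le> 1 / (real n + 1)" using that by (simp add: C_def)
      then show ?thesis
        unfolding cinner_diff(2)[symmetric]
        using order.trans[OF cauchy_schwarz mult_left_mono[OF _ norm_ge_zero]] by fastforce
    qed
    then show "\<exists>K. (K, n) \<in> I \<and> (\<forall>c\<in>C (K, n). norm (cinner d (rho c d) - cinner d d) \<le> norm d / (real n + 1))"
      by (intro exI[of _ "{}"]) (auto simp: I_def)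
  qed
  ultimately have "((\<lambda>a. cinner d (rho a d) - (cinner d (rho a d) - cinner d d)) \<longlongrightarrow> 0 - 0) G"
    by (rule tendsto_diff)
  then have "cinner d d = 0" using G(2) by (simp add: tendsto_const_iff)
  then show ?thesis unfolding d_def by (simp add: cinner_self)
qed

end

subsection \<open>The zeroth Fourier coefficient\<close>

lemma has_integral_bounded_limit:
  fixes f :: "nat \<Rightarrow> real \<Rightarrow> complex"
  assumes int: "\<And>k. (f k has_integral I k) {a..b}"
    and bound: "\<And>k t. t \<in> {a..b} \<Longrightarrow> cmod (f k t) \<le> C"
    and lim: "\<And>t. t \<in> {a..b} \<Longrightarrow> (\<lambda>k. f k t) \<longlonglongrightarrow> g t" and I: "I \<longlonglongrightarrow> J"
  shows "(g has_integral J) {a..b}"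
proof -
  have 1: "f k integrable_on {a..b}" for k using int by (rule has_integral_integrable)
  have 2: "(\<lambda>t :: real. C) integrable_on {a..b}" by (rule integrable_const_ivl)
  have "g integrable_on {a..b}" "(\<lambda>k. integral {a..b} (f k)) \<longlonglongrightarrow> integral {a..b} g"
    by (rule dominated_convergence[OF 1 2 bound lim]; assumption)+
  moreover have "(\<lambda>k. integral {a..b} (f k)) = I" using int by (simp add: integral_unique fun_eq_iff)
  ultimately show ?thesis using I LIMSEQ_unique has_integral_integral by metis
qed

lemma has_integral_characters:
  "((\<lambda>t. cis (real n * t) * cis (- (real m * t))) has_integral (if n = m then complex_of_real (2 * pi) else 0)) {0..2 * pi}"
proof (cases "n = m")
  case True
  have "((\<lambda>t :: real. 1 :: complex) has_integral (2 * pi - 0) *\<^sub>R 1) {0..2 * pi}"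
    using has_integral_const_real[of "1 :: complex" 0 "2 * pi"] by simp
  then show ?thesis using True by (simp add: cis_mult scaleR_conv_of_real)
next
  case False
  define r where "r = real n - real m"
  have r: "r \<noteq> 0" unfolding r_def using False by simp
  let ?F = "\<lambda>z :: complex. exp (\<i> * complex_of_real r * z) / (\<i> * complex_of_real r)"
  have "((\<lambda>t. exp (\<i> * complex_of_real r * complex_of_real t)) has_integral
      ?F (complex_of_real (2 * pi)) - ?F (complex_of_real 0)) {0..2 * pi}"
  proof (rule fundamental_theorem_of_calculus)
    fix t :: real
    have "(?F has_field_derivative exp (\<i> * complex_of_real r * complex_of_real t)) (at (complex_of_real t))"
      using r by (auto intro!: derivative_eq_intros)
    then show "((\<lambda>t. ?F (complex_of_real t)) has_vector_derivative exp (\<i> * complex_of_real r * complex_of_real t))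
        (at t within {0..2 * pi})"
      by (rule has_vector_derivative_real_field)
  qed simp
  moreover have "exp (\<i> * complex_of_real r * complex_of_real t) = cis (real n * t) * cis (- (real m * t))" for t
  proof -
    have "exp (\<i> * complex_of_real r * complex_of_real t) = cis (r * t)" by (simp add: cis_conv_exp mult.assoc)
    also have "\<dots> = cis (real n * t) * cis (- (real m * t))"
      unfolding cis_mult r_def by (simp add: left_diff_distrib)
    finally show ?thesis .
  qed
  moreover have "exp (\<i> * complex_of_real r * complex_of_real (2 * pi)) = 1"
  proof -
    have "cis (2 * pi * r) = 1" unfolding r_def by (rule cis_multiple_2pi) simp
    then show ?thesis by (simp add: cis_conv_exp mult_ac)
  qed
  ultimately show ?thesis using False by simp
qed

context fock_rep
begin

abbreviation "W \<equiv> gauge_unitary X"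

lemma W_apply: "x \<in> carrier F \<Longrightarrow> W t x = (\<lambda>n. cis (real n * t) *\<^sub>C x n)"
  by (simp add: gauge_unitary_def op_on_def)

lemma norm_part_W:
  assumes x: "x \<in> carrier F"
  shows "norm (part N (\<lambda>n. cis (real n * t) *\<^sub>C x n) h) = norm (part N x h)"
proof -
  have xc: "x n \<in> carrier (X n)" "cis (real n * t) *\<^sub>C x n \<in> carrier (X n)" for n
    using F_component[OF x] by (auto intro: X_closed)
  have sq: "(norm (part N y h))\<^sup>2 = (\<Sum>n<N. (norm (tau n (y n) h))\<^sup>2)" if "\<And>n. y n \<in> carrier (X n)" for y
    unfolding part_def using tau_orthogonal[of y] that by (intro norm_sq_sum_orthogonal) auto
  have "(norm (part N (\<lambda>n. cis (real n * t) *\<^sub>C x n) h))\<^sup>2 = (norm (part N x h))\<^sup>2"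
    unfolding sq[OF xc(1)] sq[OF xc(2)] by (simp add: tau_scale xc norm_scaleC)
  then show ?thesis by simp
qed

lemma W_in:
  assumes x: "x \<in> carrier F"
  shows "W t x \<in> carrier F"
  using x unfolding F_iff W_apply[OF x] norm_part_W[OF x] by (simp add: X_closed)

lemma hnorm_W:
  assumes x: "x \<in> carrier F"
  shows "hnorm F (W t x) \<le> hnorm F x"
proof (rule hnorm_le[OF W_in[OF x] hnorm_nonneg])
  fix h
  have "(\<lambda>N. norm (part N (W t x) h)) \<longlonglongrightarrow> norm (\<tau> (W t x) h)"
    by (intro tendsto_norm tau_tendsto W_in x)
  moreover have "(\<lambda>N. norm (part N (W t x) h)) \<longlonglongrightarrow> norm (\<tau> x h)"
    unfolding W_apply[OF x] norm_part_W[OF x] by (intro tendsto_norm tau_tendsto x)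
  ultimately have "norm (\<tau> (W t x) h) = norm (\<tau> x h)" by (rule LIMSEQ_unique)
  then show "norm (\<tau> (W t x) h) \<le> hnorm F x * norm h" using norm_tau_le[OF x] by simp
qed

lemma W_pair: "adj_pair (W (- t)) (W t)"
proof (rule adj_pairI)
  fix x y h k assume xy: "x \<in> carrier F" "y \<in> carrier F"
  have "cinner h (\<pi> (ip (X n) (W (- t) x n) (y n)) k) = cinner h (\<pi> (ip (X n) (x n) (W t y n)) k)" for n
  proof -
    have c: "x n \<in> carrier (X n)" "y n \<in> carrier (X n)" using xy F_component by auto
    have "cinner (tau n (W (- t) x n) h) (tau n (y n) k) = cinner (tau n (x n) h) (tau n (W t y n) k)"
      by (simp add: W_apply xy tau_scale c cinner_linear cis_cnj)
    then show ?thesis using c by (simp add: W_apply xy tau_inner_n X_closed)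
  qed
  then show "cinner (\<tau> (W (- t) x) h) (\<tau> y k) = cinner (\<tau> x h) (\<tau> (W t y) k)"
    using inner_sums[OF W_in[OF xy(1)] xy(2), of h "- t" k] inner_sums[OF xy(1) W_in[OF xy(2)], of h t k]
      sums_unique2 by simp
qed (rule W_in; assumption)+

lemma W_adjoint: "adjoint_of F (W t) = W (- t)"
  unfolding adjoint_of_def
proof (rule the_equality)
  have off: "W s x = 0" if "x \<notin> carrier F" for s x using that by (simp add: gauge_unitary_def op_on_def)
  have "W (- t) \<in> adjointables F" by (rule adjointableI[OF adj_pair_sym[OF W_pair]]) (rule off)
  then show "W (- t) \<in> adjointables F \<and> (\<forall>x\<in>carrier F. \<forall>y\<in>carrier F. ip F (W (- t) x) y = ip F x (W t y))"
    using adj_pairD(3)[OF W_pair] by blast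
  fix S assume S: "S \<in> adjointables F \<and> (\<forall>x\<in>carrier F. \<forall>y\<in>carrier F. ip F (S x) y = ip F x (W t y))"
  show "S = W (- t)"
  proof
    fix x
    show "S x = W (- t) x"
    proof (cases "x \<in> carrier F")
      case True
      have Sx: "S x \<in> carrier F" using S True unfolding adjointables_def by blast
      show ?thesis
      proof (rule F_ext[OF Sx W_in[OF True]], rule tau_total_ext)
        fix h y k assume y: "y \<in> carrier F"
        have "ip F (S x) y = ip F (W (- t) x) y" using S True y adj_pairD(3)[OF W_pair] by simp
        then have "cinner (\<tau> (S x) h) (\<tau> y k) = cinner (\<tau> (W (- t) x) h) (\<tau> y k)"
          using Sx W_in[OF True] y by (simp add: tau_inner)
        then show "cinner (\<tau> y k) (\<tau> (S x) h) = cinner (\<tau> y k) (\<tau> (W (- t) x) h)"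
          using cinner_commute by metis
      qed
    next
      case False
      then show ?thesis using S off by (simp add: adjointables_def)
    qed
  qed
qed

lemma gauge_action_apply: "gauge_action X t T y = W t (T (W (- t) y))"
  by (simp add: gauge_action_def W_adjoint)

lemma norm_partial_ip_le:
  assumes x: "x \<in> carrier F" and y: "y \<in> carrier F"
  shows "norm (\<Sum>n<N. ip (X n) (x n) (y n)) \<le> hnorm F x * hnorm F y"
proof (rule norm_le_pi)
  fix h k
  have "cmod (cinner (part N x h) (part N y k)) \<le> (hnorm F x * norm h) * (hnorm F y * norm k)"
    by (intro order.trans[OF cauchy_schwarz] mult_mono order.trans[OF norm_component_le(1)] norm_tau_le x y)
       (simp_all add: hnorm_nonneg)
  then show "cmod (cinner h (\<pi> (\<Sum>n<N. ip (X n) (x n) (y n)) k)) \<le> hnorm F x * hnorm F y * norm h * norm k"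
    by (simp add: part_inner F_component x y mult_ac)
qed (simp add: hnorm_nonneg)

context
  fixes Y a
  assumes Y: "Y \<in> adjointables F"
    and diag: "\<And>n y. y \<in> carrier (X n) \<Longrightarrow> Y (incl n y) n = \<psi> n a y"
begin

text \<open>With x = S (incl n p) the integrand is cis (n t) times \<open>\<omega>\<close> of <x, W
  (-t) y>. Expanding over the degrees m of y produces the characters of n - m, of which only m = n
  has a nonzero integral; a constant dominates the partial sums.\<close>

lemma fourier_component:
  assumes \<omega>: "\<omega> \<in> predual" and p: "p \<in> carrier (X n)" and y: "y \<in> carrier F"
  shows "((\<lambda>t. \<omega> (ip (X n) p (gauge_action X t Y y n))) has_integral
    complex_of_real (2 * pi) * \<omega> (ip (X n) p (\<psi> n a (y n)))) {0..2 * pi}"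
proof -
  obtain S where S: "adj_pair S Y" using adjointable_pair[OF Y] by blast
  define x where "x = S (incl n p)"
  have x: "x \<in> carrier F" unfolding x_def by (rule adj_pairD(1)[OF S incl_in[OF p]])
  have xY: "ip F x z = ip (X n) p (Y z n)" if z: "z \<in> carrier F" for z
    unfolding x_def using adj_pairD(3)[OF S incl_in[OF p] z] ip_incl(1)[OF p adj_pairD(2)[OF S z]] by simp
  let ?f = "\<lambda>M t. \<Sum>m<M. cis (real n * t) * cis (- (real m * t)) * \<omega> (ip (X m) (x m) (y m))"
  have f: "?f M t = cis (real n * t) * \<omega> (\<Sum>m<M. ip (X m) (x m) (W (- t) y m))" for M t
  proof -
    have "\<omega> (ip (X m) (x m) (W (- t) y m)) = cis (- (real m * t)) * \<omega> (ip (X m) (x m) (y m))" for m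
      using F_component[OF x] F_component[OF y] by (simp add: W_apply y X_ip predual_functional[OF \<omega>])
    then show ?thesis by (simp add: predual_sum[OF \<omega>] sum_distrib_left mult.assoc)
  qed
  have "((\<lambda>t. cis (real n * t) * \<omega> (ip F x (W (- t) y))) has_integral
      complex_of_real (2 * pi) * \<omega> (ip (X n) (x n) (y n))) {0..2 * pi}"
  proof (rule has_integral_bounded_limit)
    show "(?f M has_integral (\<Sum>m<M. (if n = m then complex_of_real (2 * pi) else 0) * \<omega> (ip (X m) (x m) (y m)))) {0..2 * pi}" for M
      by (intro has_integral_sum has_integral_mult_left has_integral_characters) simp
    show "cmod (?f M t) \<le> onorm \<omega> * (hnorm F x * hnorm F y)" for M t
    proof -
      have "cmod (?f M t) \<le> onorm \<omega> * norm (\<Sum>m<M. ip (X m) (x m) (W (- t) y m))"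
        unfolding f using predual_functional(6)[OF \<omega>] by (simp add: norm_mult)
      also have "\<dots> \<le> onorm \<omega> * (hnorm F x * hnorm F y)"
        using predual_functional(7)[OF \<omega>]
        by (intro mult_left_mono order.trans[OF norm_partial_ip_le] mult_left_mono hnorm_W x y W_in hnorm_nonneg)
      finally show ?thesis .
    qed
    show "(\<lambda>M. ?f M t) \<longlonglongrightarrow> cis (real n * t) * \<omega> (ip F x (W (- t) y))" for t
      unfolding f by (intro tendsto_mult tendsto_const ip_tendsto x W_in y \<omega>)
    show "(\<lambda>M. \<Sum>m<M. (if n = m then complex_of_real (2 * pi) else 0) * \<omega> (ip (X m) (x m) (y m)))
        \<longlonglongrightarrow> complex_of_real (2 * pi) * \<omega> (ip (X n) (x n) (y n))"
    proof (rule tendsto_eventually, rule eventually_sequentiallyI[of "Suc n"])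
      fix M assume "Suc n \<le> M"
      then show "(\<Sum>m<M. (if n = m then complex_of_real (2 * pi) else 0) * \<omega> (ip (X m) (x m) (y m)))
          = complex_of_real (2 * pi) * \<omega> (ip (X n) (x n) (y n))"
        by (simp add: if_distrib[of "\<lambda>c. c * _"] cong: if_cong)
    qed
  qed
  moreover have "cis (real n * t) * \<omega> (ip F x (W (- t) y)) = \<omega> (ip (X n) p (gauge_action X t Y y n))" for t
  proof -
    have z: "Y (W (- t) y) \<in> carrier F" by (intro adj_pairD(2)[OF S] W_in y)
    show ?thesis
      using F_component[OF z] by (simp add: xY W_in y gauge_action_apply W_apply[OF z] X_ip p predual_functional[OF \<omega>])
  qed
  moreover have "ip (X n) (x n) (y n) = ip (X n) p (\<psi> n a (y n))"
    using xY[OF incl_in[OF F_component[OF y]]] ip_incl(2)[OF F_component[OF y] x]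
    by (simp add: diag F_component y)
  ultimately show ?thesis by simp
qed

text \<open>\<open>fourier_component\<close> summed over the degrees;
  \<open>norm_partial_ip_le\<close> gives the constant majorant for exchanging limit and
  integral.\<close>

lemma fourier_form:
  assumes \<omega>: "\<omega> \<in> predual" and x: "x \<in> carrier F" and y: "y \<in> carrier F"
  shows "((\<lambda>t. \<omega> (ip F x (gauge_action X t Y y))) has_integral
    complex_of_real (2 * pi) * \<omega> (ip F x (fl a y))) {0..2 * pi}"
proof -
  obtain S where S: "adj_pair S Y" using adjointable_pair[OF Y] by blast
  obtain C where C: "C \<ge> 0" "\<And>x. x \<in> carrier F \<Longrightarrow> hnorm F (Y x) \<le> C * hnorm F x"
    using adj_pair_bounded[OF adj_pair_sym[OF S]] by blast
  have gF: "gauge_action X t Y y \<in> carrier F" for t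
    unfolding gauge_action_apply by (intro W_in adj_pairD(2)[OF S] y)
  have gn: "hnorm F (gauge_action X t Y y) \<le> C * hnorm F y" for t
    unfolding gauge_action_apply
    by (intro order.trans[OF hnorm_W] order.trans[OF C(2)] mult_left_mono[OF hnorm_W C(1)] W_in y adj_pairD(2)[OF S])
  let ?f = "\<lambda>N t. \<Sum>n<N. \<omega> (ip (X n) (x n) (gauge_action X t Y y n))"
  show ?thesis
  proof (rule has_integral_bounded_limit)
    show "(?f N has_integral (\<Sum>n<N. complex_of_real (2 * pi) * \<omega> (ip (X n) (x n) (\<psi> n a (y n))))) {0..2 * pi}" for N
      by (intro has_integral_sum fourier_component \<omega> y F_component[OF x]) simp
    show "cmod (?f N t) \<le> onorm \<omega> * (hnorm F x * (C * hnorm F y))" for N t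
      unfolding predual_sum[OF \<omega>, symmetric]
      using predual_functional(7)[OF \<omega>]
      by (intro order.trans[OF predual_functional(6)[OF \<omega>]] mult_left_mono
          order.trans[OF norm_partial_ip_le] gn x gF hnorm_nonneg)
    show "(\<lambda>N. ?f N t) \<longlonglongrightarrow> \<omega> (ip F x (gauge_action X t Y y))" for t
      using ip_tendsto[OF x gF \<omega>] by (simp add: predual_sum[OF \<omega>])
    show "(\<lambda>N. \<Sum>n<N. complex_of_real (2 * pi) * \<omega> (ip (X n) (x n) (\<psi> n a (y n))))
        \<longlonglongrightarrow> complex_of_real (2 * pi) * \<omega> (ip F x (fl a y))"
      using tendsto_mult[OF tendsto_const ip_tendsto[OF x fl_in[OF y] \<omega>], of "complex_of_real (2 * pi)" a]
      by (simp add: predual_sum[OF \<omega>] sum_distrib_left fl_apply y)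
  qed
qed

text \<open>The same exchange once more, now for the series that defines a normal functional; its
  summability condition provides the majorant.\<close>

lemma fourier_functional:
  assumes f: "f \<in> normal_functionals F"
  shows "((\<lambda>t. f (gauge_action X t Y)) has_integral complex_of_real (2 * pi) * f (fl a)) {0..2 * pi}"
proof -
  obtain \<omega> x y where f_def: "f = (\<lambda>T. \<Sum>n. \<omega> n (ip F (x n) (T (y n))))"
    and \<omega>: "\<And>n. \<omega> n \<in> predual" and xy: "\<And>n. x n \<in> carrier F" "\<And>n. y n \<in> carrier F"
    and sum: "summable (\<lambda>n. onorm (\<omega> n) * hnorm F (x n) * hnorm F (y n))"
    using f unfolding normal_functionals_def by blast
  obtain S where S: "adj_pair S Y" using adjointable_pair[OF Y] by blast
  obtain C where C: "C \<ge> 0" "\<And>x. x \<in> carrier F \<Longrightarrow> hnorm F (Y x) \<le> C * hnorm F x"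
    using adj_pair_bounded[OF adj_pair_sym[OF S]] by blast
  obtain D where D: "D \<ge> 0" "\<And>x. x \<in> carrier F \<Longrightarrow> hnorm F (fl a x) \<le> D * hnorm F x"
    using adj_pair_bounded[OF adj_pair_sym[OF fl_pair]] by blast
  let ?s = "\<lambda>n. onorm (\<omega> n) * hnorm F (x n) * hnorm F (y n)"
  have s0: "0 \<le> ?s n" for n by (intro mult_nonneg_nonneg hnorm_nonneg predual_functional(7)[OF \<omega>])
  have bound: "cmod (\<omega> n (ip F (x n) z)) \<le> M * ?s n" if "z \<in> carrier F" "hnorm F z \<le> M * hnorm F (y n)" for n z M
  proof -
    have "cmod (\<omega> n (ip F (x n) z)) \<le> onorm (\<omega> n) * (hnorm F (x n) * (M * hnorm F (y n)))"
      using predual_functional(7)[OF \<omega>] that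
      by (intro order.trans[OF predual_functional(6)[OF \<omega>]] mult_left_mono order.trans[OF norm_ip_le]
          xy hnorm_nonneg)
    then show ?thesis by (simp add: mult_ac)
  qed
  have gF: "gauge_action X t Y (y n) \<in> carrier F" for t n
    unfolding gauge_action_apply by (intro W_in adj_pairD(2)[OF S] xy)
  have gn: "hnorm F (gauge_action X t Y (y n)) \<le> C * hnorm F (y n)" for t n
    unfolding gauge_action_apply
    by (intro order.trans[OF hnorm_W] order.trans[OF C(2)] mult_left_mono[OF hnorm_W C(1)] W_in xy adj_pairD(2)[OF S])
  let ?f = "\<lambda>J t. \<Sum>n<J. \<omega> n (ip F (x n) (gauge_action X t Y (y n)))"
  show ?thesis
  proof (rule has_integral_bounded_limit)
    show "(?f J has_integral (\<Sum>n<J. complex_of_real (2 * pi) * \<omega> n (ip F (x n) (fl a (y n))))) {0..2 * pi}" for J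
      by (intro has_integral_sum fourier_form \<omega> xy) simp
    show "cmod (?f J t) \<le> C * (\<Sum>n. ?s n)" for J t
    proof -
      have "cmod (?f J t) \<le> (\<Sum>n<J. C * ?s n)" by (intro sum_norm_le bound gF gn)
      also have "\<dots> = C * (\<Sum>n<J. ?s n)" by (simp add: sum_distrib_left)
      also have "\<dots> \<le> C * (\<Sum>n. ?s n)"
        by (intro mult_left_mono C(1) sum_le_suminf sum s0) auto
      finally show ?thesis .
    qed
    show "(\<lambda>J. ?f J t) \<longlonglongrightarrow> f (gauge_action X t Y)" for t
      unfolding f_def
      by (rule summable_LIMSEQ, rule summable_comparison_test'[OF summable_mult[OF sum, of C]])
         (rule bound[OF gF gn])
    have "(\<lambda>J. \<Sum>n<J. \<omega> n (ip F (x n) (fl a (y n)))) \<longlonglongrightarrow> f (fl a)"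
      unfolding f_def
      by (rule summable_LIMSEQ, rule summable_comparison_test'[OF summable_mult[OF sum, of D]])
         (rule bound[OF fl_in[OF xy(2)] D(2)[OF xy(2)]])
    then show "(\<lambda>J. \<Sum>n<J. complex_of_real (2 * pi) * \<omega> n (ip F (x n) (fl a (y n))))
        \<longlonglongrightarrow> complex_of_real (2 * pi) * f (fl a)"
      unfolding sum_distrib_left[symmetric] by (intro tendsto_mult tendsto_const)
  qed
qed

text \<open>A competitor is compared with \<open>fl a\<close> through the functionals T -> \<omega>
  <z, T y>, which separate operators on the carrier; off the carrier both vanish by
  convention.\<close>

lemma fourier0_eq: "fourier0 X Y = fl a"
  unfolding fourier0_def
proof (rule the_equality)
  show "fl a \<in> adjointables F \<and> (\<forall>f\<in>normal_functionals F.
      ((\<lambda>t. f (gauge_action X t Y)) has_integral complex_of_real (2 * pi) * f (fl a)) {0..2 * pi})"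
    using fl_adjointable fourier_functional by blast
  fix Z assume Z: "Z \<in> adjointables F \<and> (\<forall>f\<in>normal_functionals F.
      ((\<lambda>t. f (gauge_action X t Y)) has_integral complex_of_real (2 * pi) * f Z) {0..2 * pi})"
  obtain S where S: "adj_pair S Z" using adjointable_pair Z by blast
  show "Z = fl a"
  proof
    fix y
    show "Z y = fl a y"
    proof (cases "y \<in> carrier F")
      case True
      show ?thesis
      proof (rule F_module_ext[OF adj_pairD(2)[OF S True] fl_in[OF True]], rule predual_separates)
        fix z and \<omega> :: "'m \<Rightarrow> complex" assume z: "z \<in> carrier F" and \<omega>: "\<omega> \<in> predual"
        have f: "(\<lambda>T. \<omega> (ip F z (T y))) \<in> normal_functionals F"
          by (rule normal_functional_single[OF \<omega> z True])
        have "complex_of_real (2 * pi) * \<omega> (ip F z (Z y)) = complex_of_real (2 * pi) * \<omega> (ip F z (fl a y))"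
          using fourier_functional[OF f] Z[THEN conjunct2, rule_format, OF f] has_integral_unique by blast
        then show "\<omega> (ip F z (Z y)) = \<omega> (ip F z (fl a y))" by simp
      qed
    next
      case False
      then show ?thesis using Z by (simp add: adjointables_def fock_left_def op_on_def)
    qed
  qed
qed

end

section \<open>From reflexivity to the diagonal form\<close>

lemma fl_hardy: "fl a \<in> hardy_algebra E X \<psi> tens"
proof -
  have "normal_functionals F \<noteq> {}" by (rule notI) (use normal_functionals_nonempty in simp)
  then have "fl a \<in> topspace (initial_topology (adjointables F) (normal_functionals F))"
    using fl_adjointable by (simp add: topspace_initial_topology)
  moreover have "fl a \<in> generated_algebra hardy_generators" by (rule generated_algebra.generator) blast
  ultimately show ?thesis
    unfolding hardy_algebra_def ultraweak_topology_def in_closure_of by blast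
qed

lemma diagonal_of_reflexive:
  assumes Y: "Y \<in> adjointables F"
    and alg: "amp Y \<in> Alg (Lat (amp ` hardy_algebra E X \<psi> tens))"
  shows "\<exists>a. \<forall>n. \<forall>y\<in>carrier (X n). Y (incl n y) n = \<psi> n a y"
proof -
  obtain S where S: "adj_pair S Y" using adjointable_pair[OF Y] by blast
  note B = amp_spec[OF S]
  have inv: "amp Y u \<in> N" if "csubspace N" "closed N"
    "\<And>T u. T \<in> hardy_algebra E X \<psi> tens \<Longrightarrow> u \<in> N \<Longrightarrow> amp T u \<in> N" "u \<in> N" for N u
  proof -
    have "N \<in> Lat (amp ` hardy_algebra E X \<psi> tens)" unfolding Lat_def using that(1,2,3) by auto
    then show ?thesis using alg that(4) unfolding Alg_def by blast
  qed
  have PB: "P n (amp Y (tau n y h)) = tau n (Y (incl n y) n) h" if "y \<in> carrier (X n)" for n y h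
    using that unfolding tau_def by (simp add: B incl_in P_tau adj_pairD(2)[OF S]) (simp add: tau_def)
  have Yc: "Y (incl n y) n \<in> carrier (X n)" if "y \<in> carrier (X n)" for n y
    by (intro F_component adj_pairD(2)[OF S] incl_in that)
  obtain a where a: "Y (incl 0 (\<iota> 1)) 0 = \<iota> a" using iota_simps(5)[OF Yc[OF iota_simps(1)]] by blast
  have t0: "P 0 (amp Y (tau 0 x h)) = rho a (tau 0 x h)" if x: "x \<in> carrier (X 0)" for x h
  proof -
    obtain b where b: "x = \<iota> b" using iota_simps(5)[OF x] by blast
    \<comment> \<open>Moving b into the Hilbert space factor takes the place of right linearity of
      \<open>Y\<close>.\<close>
    have "tau 0 x h = tau 0 (\<iota> 1) (\<pi> b h)"
      using tau_ract[OF iota_simps(1), of 1 b h] by (simp add: b iota_simps)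
    then have "P 0 (amp Y (tau 0 x h)) = tau 0 (\<iota> a) (\<pi> b h)" by (simp add: PB iota_simps a)
    also have "\<dots> = tau 0 (\<iota> (a * b)) h"
      using tau_ract[OF iota_simps(1), of a b h] by (simp add: iota_simps)
    finally show ?thesis by (simp add: b rho_tau_n iota_simps)
  qed
  have P0: "P 0 (amp Y (P 0 u)) = rho a (P 0 u)" for u
    by (rule bounded_clinear_eq_on_closure[OF bounded_clinear_compose[OF P_bounded B(1)] rho_bounded _ level_span])
       (use t0 in blast)
  have "Y (incl n y) n = \<psi> n a y" if y: "y \<in> carrier (X n)" for n y
  proof (rule tau_ext[OF Yc[OF y]])
    show py: "\<psi> n a y \<in> carrier (X n)" using y by (rule X_closed)
    fix h
    show "tau n (Y (incl n y) n) h = tau n (\<psi> n a y) h"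
    proof (cases "n = 0")
      case True
      then show ?thesis using PB[OF y, of h] t0[of y h] y by (simp add: rho_tau_n)
    next
      case False
      let ?z = "Y (incl n y) n - \<psi> n a y"
      have z: "?z \<in> carrier (X n)" by (intro X_closed Yc y)
      have td: "tau n ?z h = P n (amp Y (tau n y h)) - rho a (tau n y h)"
        by (simp add: tau_diff Yc y py PB rho_tau_n)
      \<comment> \<open>Every intertwiner S0 annihilates this vector:
        \<open>intertwiner_relation\<close> turns S0 P_n Y into P_0 Y S0, which is rho a S0 = S0 rho
        a on it.\<close>
      have "tau n ?z h = 0"
      proof (rule intertwiners_separate[OF _ z])
        show "n > 0" using False by simp
        fix S0 assume S0: "bounded_clinear S0" "\<And>u. S0 (P n u) = S0 u" "\<And>u. P 0 (S0 u) = S0 u"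
          "\<And>a u. S0 (rho a u) = rho a (S0 u)"
        have "P 0 (amp Y (S0 (tau n y h))) = S0 (P n (amp Y (P n (tau n y h))))"
        proof (rule intertwiner_relation[OF _ B(1) _ S0])
          show "0 < n" using False by simp
        qed (rule inv)
        then have "S0 (P n (amp Y (tau n y h))) = P 0 (amp Y (S0 (tau n y h)))"
          using y by (simp add: P_tau_n)
        also have "\<dots> = S0 (rho a (tau n y h))" using P0[of "S0 (tau n y h)"] by (simp add: S0)
        finally show "S0 (tau n ?z h) = 0" unfolding td by (simp add: bounded_clinear_simps[OF S0(1)])
      qed
      then show ?thesis by (simp add: tau_diff Yc y py)
    qed
  qed
  then show ?thesis by blast
qed

end

theorem theorem3p15:
  fixes E :: "('e :: complex_vec, 'm :: wstar_algebra) hmodule"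
    and \<phi> :: "'m \<Rightarrow> 'e \<Rightarrow> 'e"
    and X :: "nat \<Rightarrow> ('x :: complex_vec, 'm) hmodule"
    and \<psi> :: "nat \<Rightarrow> 'm \<Rightarrow> 'x \<Rightarrow> 'x"
    and \<iota> :: "'m \<Rightarrow> 'x"
    and tens :: "nat \<Rightarrow> 'e \<Rightarrow> 'x \<Rightarrow> 'x"
    and \<pi> :: "'m \<Rightarrow> 'h \<Rightarrow> 'h :: chilbert_space"
    and \<tau> :: "(nat \<Rightarrow> 'x) \<Rightarrow> 'h \<Rightarrow> 'k :: chilbert_space"
    and Y :: "(nat \<Rightarrow> 'x) \<Rightarrow> nat \<Rightarrow> 'x"
  assumes "wstar_correspondence E \<phi>"
    and "tensor_powers E \<phi> X \<psi> \<iota> tens"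
    and "normal_representation \<pi>" and "inj \<pi>"
    and "hilbert_tensor (ultraweak_sum X) \<pi> \<tau>"
    and "Y \<in> adjointables (ultraweak_sum X)"
    and "ampliation (ultraweak_sum X) \<tau> Y
           \<in> Alg (Lat (ampliation (ultraweak_sum X) \<tau> ` hardy_algebra E X \<psi> tens))"
  shows "ampliation (ultraweak_sum X) \<tau> (fourier0 X Y)
           \<in> ampliation (ultraweak_sum X) \<tau> ` hardy_algebra E X \<psi> tens"
proof -
  interpret fock_rep \<pi> E \<phi> X \<psi> \<iota> tens \<tau>
    using assms(1-5) by unfold_locales
  obtain a where "\<And>n y. y \<in> carrier (X n) \<Longrightarrow> Y (incl n y) n = \<psi> n a y"
    using diagonal_of_reflexive[OF assms(6,7)] by blast
  then have "fourier0 X Y = fock_left X \<psi> a" by (rule fourier0_eq[OF assms(6)])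
  then show ?thesis using imageI[OF fl_hardy] by simp
qed

end
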